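(* Let $n\ge1$ be an integer and $p>(n-1)/2$ a real number. For every real symmetric positive definite matrix $\sigma$ of order $n$, the Fisher information $I_p(\sigma)$ at $\sigma$ of the statistical model $\{f_{p,\sigma}(x)\,dx;\ \sigma\in E_+\}$ on $\mathbb{R}^n$ is $$I_p(\sigma)=\frac{1}{2(2p+3)}\Big((2p+1)\,\mathbb{P}(\sigma^{-1})-\sigma^{-1}\otimes\sigma^{-1}\Big).$$
   Context: $E$ is the Euclidean space of real symmetric matrices of order $n$ with $\langle u,v\rangle=\operatorname{tr}(uv)$; $E_+\subset E$ is the open cone of positive definite matrices. For $u\in E$, the endomorphisms $u\otimes u$ and $\mathbb{P}(u)$ of $E$ are defined by $(u\otimes u)(v)=u\operatorname{tr}(uv)$ and $\mathbb{P}(u)(v)=uvu$. For $p>(n-1)/2$ and $\sigma\in E_+$, the Wishart distribution $\gamma_{p,\sigma}$ is the probability measure on $E_+$ characterized by $\int_{E_+}e^{-\operatorname{tr}(su)}\gamma_{p,\sigma}(du)=\det(I_n+\sigma s)^{-p}$ for all $s\in E_+$. The density $f_{p,\sigma}$ on $\mathbb{R}^n$ is that of $X$ where $U\sim\gamma_{p,\sigma}$ and $X|U\sim N(0,U^{-1})$: $$f_{p,\sigma}(x)=\frac{1}{(2\pi)^{n/2}}\int_{E_+}e^{-x^tux/2}(\det u)^{1/2}\gamma_{p,\sigma}(du),$$ and explicitly $$f_{p,\sigma}(x)=\frac{1}{(2\pi)^{n/2}}\frac{\Gamma(p+\frac12)}{\Gamma(p-\frac{n-1}{2})}\frac{(\det\sigma)^{1/2}}{(1+\frac12x^t\sigma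 x)^{p+\frac12}}.$$ The Fisher information is the endomorphism of $E$ $$I_p(\sigma)=\int_{\mathbb{R}^n}\ell_x'(\sigma)\otimes\ell_x'(\sigma)\,f_{p,\sigma}(x)\,dx=-\int_{\mathbb{R}^n}\ell_x''(\sigma)\,f_{p,\sigma}(x)\,dx,$$ where $\ell_x(\sigma)=\log f_{p,\sigma}(x)$ up to an additive constant not depending on $\sigma$, and $\ell_x'(\sigma)\in E$ and $\ell_x''(\sigma)$ (a symmetric endomorphism of $E$) are the gradient and the second differential of $\sigma\mapsto\ell_x(\sigma)$ on $E_+$ with respect to the scalar product of $E$. *)

theory Defs
  imports "HOL-Probability.Probability"
begin

definition sym_matrices :: "(real^'n^'n) set" where
  "sym_matrices = {u. transpose u = u}"

definition pos_def_matrices :: "(real^'n^'n) set" where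
  "pos_def_matrices = {u \<in> sym_matrices. \<forall>x. x \<noteq> 0 \<longrightarrow> x \<bullet> (u *v x) > 0}"

definition tensor_square :: "real^'n^'n \<Rightarrow> real^'n^'n \<Rightarrow> real^'n^'n" where
  "tensor_square u v = trace (u ** v) *\<^sub>R u"

definition quad_rep :: "real^'n^'n \<Rightarrow> real^'n^'n \<Rightarrow> real^'n^'n" where
  "quad_rep u v = u ** v ** u"

definition is_wishart :: "real \<Rightarrow> real^'n^'n \<Rightarrow> (real^'n^'n) measure \<Rightarrow> bool" where
  "is_wishart p \<sigma> M \<longleftrightarrow>
     prob_space M \<and>
     space M = pos_def_matrices \<and>
     sets M = sets (restrict_space borel pos_def_matrices) \<and>
     (\<forall>s\<in>pos_def_matrices.
        (LINT u|M. exp (- trace (s ** u))) = det (mat 1 + \<sigma> ** s) powr (- p))"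

definition wishart :: "real \<Rightarrow> real^'n^'n \<Rightarrow> (real^'n^'n) measure" where
  "wishart p \<sigma> = (THE M. is_wishart p \<sigma> M)"

text \<open>
  The density of \<open>X\<close>, where \<open>U\<close> is Wishart distributed and \<open>X\<close> given \<open>U\<close>
  is centred Gaussian with covariance matrix \<open>U\<close> inverse.
\<close>

definition mix_density :: "real \<Rightarrow> real^'n^'n \<Rightarrow> real^'n \<Rightarrow> real" where
  "mix_density p \<sigma> x =
     1 / (2 * pi) powr (real CARD('n) / 2) *
     (LINT u|wishart p \<sigma>. exp (- (x \<bullet> (u *v x)) / 2) * sqrt (det u))"

definition log_lik :: "real \<Rightarrow> real^'n \<Rightarrow> real^'n^'n \<Rightarrow> real" where
  "log_lik p x \<sigma> = ln (mix_density p \<sigma> x)"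

text \<open>
  The gradient of a function on the positive definite cone, taken in the space of symmetric
  matrices. The cone has empty interior in the space of all matrices (for order at least 2),
  so the derivative is taken within the cone; requiring \<open>g\<close> to be symmetric makes it unique.
\<close>

definition sym_gradient :: "(real^'n^'n \<Rightarrow> real) \<Rightarrow> real^'n^'n \<Rightarrow> real^'n^'n" where
  "sym_gradient F \<sigma> =
     (THE g. g \<in> sym_matrices \<and>
        (F has_derivative (\<lambda>h. trace (g ** h))) (at \<sigma> within pos_def_matrices))"

text \<open>The integral of an endomorphism-valued function is taken pointwise in the argument \<open>v\<close>.\<close>

definition fisher_information :: "real \<Rightarrow> real^'n^'n \<Rightarrow> real^'n^'n \<Rightarrow> real^'n^'n" where
  "fisher_information p \<sigma> v =
     (LINT x|lborel. mix_density p \<sigma> x *\<^sub>R tensor_square (sym_gradient (log_lik p x) \<sigma>) v)"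

end

theory Submission
  imports Defs
begin

text \<open>
  The Wishart law with parameters \<open>p\<close>, \<open>\<sigma>\<close> is realised as the law of \<open>X\<^sup>T X\<close>, where the square matrix \<open>X\<close> has
  density proportional to \<open>|det X|\<^bsup>2p-n\<^esup> exp (- tr (\<sigma>\<inverse> X\<^sup>T X))\<close>. The substitution \<open>X = Y A\<^sup>T\<close>, whose
  Jacobian is \<open>|det A|\<^sup>n\<close>, gives its Laplace transform, and multiplying by \<open>(det u)\<^bsup>1/2\<^esup> = |det X|\<close> only replaces
  \<open>p\<close> by \<open>p + 1/2\<close>; this yields the mixture density up to a constant \<open>k\<close> not depending on \<open>\<sigma>\<close>, and \<open>k\<close> is fixed by
  total mass one. The Laplace transform determines the measure by Stone--Weierstrass.
  With \<open>a = p + 1/2\<close> and \<open>r = 1 + x\<^sup>T\<sigma>x/2\<close> the gradient is \<open>\<sigma>\<inverse>/2 - a/(2r) x x\<^sup>T\<close>. After the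
  substitution \<open>x = A y\<close> with \<open>A\<^sup>T \<sigma> A = 1\<close>, the Fisher information reduces to
  \<open>E (y\<^sub>i y\<^sub>j / r) = \<delta>\<^sub>i\<^sub>j / a\<close> and to the fourth moments
  \<open>E (y\<^sub>i y\<^sub>j y\<^sub>k y\<^sub>l / r\<^sup>2) = (\<delta>\<^sub>i\<^sub>j \<delta>\<^sub>k\<^sub>l + \<delta>\<^sub>i\<^sub>k \<delta>\<^sub>j\<^sub>l + \<delta>\<^sub>i\<^sub>l \<delta>\<^sub>j\<^sub>k) / (a (a + 1))\<close>.
\<close>

text \<open>\<open>wishart\<close> is a \<open>THE\<close> over measures with a prescribed Laplace
  transform, so nothing can be computed before existence and uniqueness are settled for every real p
  > (n-1)/2. As p need not be a half-integer, sums of Gaussian samples do not suffice for existence;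
  square matrices X carry a weight |det X|^q with real q instead, and Lebesgue measure on
  \<open>real^'n^'n\<close> takes the place of a measure on the symmetric matrices. The transform
  then has the determinant power -(n+q)/2, hence q = 2p - n. The hypothesis on p is exactly q > -1,
  the threshold for integrability of |det X|^q across the singular matrices; for q < 0 this is the
  main analytic obstacle. Uniqueness starts from the transform at positive definite arguments only,
  so the test functions have to be built from exponentials with parameter in the cone, and constants
  have to be added by hand. The cone may be thin in the space of all matrices. Gradients are
  therefore identified by derivatives along rays and by the fact that the cone spans the symmetric
  matrices.\<close>

lemma matrix_add_rdistrib: "(A + B) ** C = A ** C + B ** (C :: real^'n^'k)"
  by (simp add: matrix_matrix_mult_def vec_eq_iff sum.distrib distrib_right)

lemma matrix_diff_ldistrib: "A ** (B - C) = A ** B - A ** (C :: real^'n^'k)"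
  by (simp add: matrix_matrix_mult_def vec_eq_iff sum_subtractf right_diff_distrib)

lemma matrix_diff_rdistrib: "(A - B) ** C = A ** C - B ** (C :: real^'n^'k)"
  by (simp add: matrix_matrix_mult_def vec_eq_iff sum_subtractf left_diff_distrib)

lemma matrix_scaleR_left: "(c *\<^sub>R A) ** B = c *\<^sub>R (A ** (B :: real^'n^'k))"
  by (simp add: matrix_matrix_mult_def vec_eq_iff sum_distrib_left mult.assoc)

lemma matrix_scaleR_right: "A ** (c *\<^sub>R B) = c *\<^sub>R (A ** (B :: real^'n^'k))"
  by (simp add: matrix_matrix_mult_def vec_eq_iff sum_distrib_left mult_ac)

lemma trace_scaleR: "trace (c *\<^sub>R A) = c * trace (A :: real^'n^'n)"
  by (simp add: trace_def sum_distrib_left)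

subsection \<open>Positive definite matrices\<close>

text \<open>Turns an \<open>s\<close>-orthonormal family, taken as columns, into a congruence of
  \<open>s\<close> to the identity.\<close>

lemma mult_matrix_transpose_component:
  fixes A :: "real^'n^'m"
  shows "(transpose A ** s ** A) $ i $ j = column i A \<bullet> (s *v column j A)"
proof -
  have "(transpose A ** s ** A) $ i $ j = (\<Sum>k\<in>UNIV. \<Sum>l\<in>UNIV. A $ l $ i * s $ l $ k * A $ k $ j)"
    by (simp add: matrix_matrix_mult_def transpose_def sum_distrib_right)
  also have "\<dots> = (\<Sum>l\<in>UNIV. \<Sum>k\<in>UNIV. A $ l $ i * s $ l $ k * A $ k $ j)"
    by (rule sum.swap)
  also have "\<dots> = column i A \<bullet> (s *v column j A)"
    by (simp add: column_def inner_vec_def matrix_vector_mult_def sum_distrib_left mult.assoc)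
  finally show ?thesis .
qed

lemma inner_matrix_vector_transpose:
  fixes s :: "real^'n^'m"
  shows "x \<bullet> (s *v y) = (transpose s *v x) \<bullet> y"
  by (simp add: dot_lmul_matrix)

text \<open>Gram--Schmidt for the inner product given by \<open>s\<close>, adding one coordinate at a time: the vectors indexed
  by \<open>S\<close> are supported in \<open>S\<close>, so a new unit vector is never in their span.\<close>

lemma pos_def_orthonormal_family:
  fixes s :: "real^'n^'n"
  assumes s: "s \<in> pos_def_matrices" and "finite S"
  shows "\<exists>w :: 'n \<Rightarrow> real^'n. (\<forall>i\<in>S. \<forall>k. k \<notin> S \<longrightarrow> w i $ k = 0) \<and>
     (\<forall>i\<in>S. \<forall>j\<in>S. w i \<bullet> (s *v w j) = (if i = j then 1 else 0))"
  using \<open>finite S\<close>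
proof induction
  case empty
  show ?case by simp
next
  case (insert m S)
  then obtain w :: "'n \<Rightarrow> real^'n" where supp: "\<And>i k. i \<in> S \<Longrightarrow> k \<notin> S \<Longrightarrow> w i $ k = 0"
    and orth: "\<And>i j. i \<in> S \<Longrightarrow> j \<in> S \<Longrightarrow> w i \<bullet> (s *v w j) = (if i = j then 1 else 0)" by blast
  have sym: "x \<bullet> (s *v y) = y \<bullet> (s *v x)" for x y
    using s by (simp add: pos_def_matrices_def sym_matrices_def inner_matrix_vector_transpose[of x s y] inner_commute)
  define v where "v = axis m 1 - (\<Sum>j\<in>S. (axis m 1 \<bullet> (s *v w j)) *\<^sub>R w j)"
  have "v $ m = 1" using insert supp by (simp add: v_def)
  then have "v \<noteq> 0" by auto
  then have pos: "v \<bullet> (s *v v) > 0" using s by (auto simp: pos_def_matrices_def)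
  have vw: "v \<bullet> (s *v w j) = 0" if "j \<in> S" for j
    using that \<open>finite S\<close> by (simp add: v_def inner_diff_left inner_sum_left orth if_distrib cong: if_cong)
  define c where "c = 1 / sqrt (v \<bullet> (s *v v))"
  have c: "c * c * (v \<bullet> (s *v v)) = 1"
    using pos by (simp add: c_def field_simps)
  define w' where "w' = w(m := c *\<^sub>R v)"
  have "w' i $ k = 0" if "i \<in> insert m S" "k \<notin> insert m S" for i k
    using that supp by (auto simp: w'_def v_def axis_def)
  moreover have "w' i \<bullet> (s *v w' j) = (if i = j then 1 else 0)" if "i \<in> insert m S" "j \<in> insert m S" for i j
    using that orth vw c insert.hyps
    by (auto simp: w'_def matrix_vector_mult_scaleR sym[of "w _" v])
  ultimately show ?case by blast
qed

text \<open>The columns of \<open>A\<close> form an \<open>s\<close>-orthonormal basis. This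
  congruence takes the place of a spectral decomposition: positivity of the determinant, the inverse
  and the linear substitutions are read off from it.\<close>

lemma pos_def_diagonalize:
  fixes s :: "real^'n^'n"
  assumes s: "s \<in> pos_def_matrices"
  obtains A :: "real^'n^'n" where "transpose A ** s ** A = mat 1"
proof -
  obtain w :: "'n \<Rightarrow> real^'n" where w: "\<And>i j. w i \<bullet> (s *v w j) = (if i = j then 1 else 0)"
    using pos_def_orthonormal_family[OF s, of UNIV] by auto
  let ?A = "\<chi> i j. w j $ i"
  have "column j ?A = w j" for j by (simp add: column_def vec_eq_iff)
  then have "transpose ?A ** s ** ?A = mat 1"
    using w by (simp add: vec_eq_iff[of "_ ** _"] mult_matrix_transpose_component mat_def vec_eq_iff[of "_ $ _"])
  then show ?thesis by (rule that)
qed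

lemma diagonalize_det:
  fixes s A :: "real^'n^'n"
  assumes "transpose A ** s ** A = mat 1"
  shows "det A ^ 2 * det s = 1" "det A \<noteq> 0"
proof -
  show *: "det A ^ 2 * det s = 1"
    using arg_cong[OF assms, of det] by (simp add: det_mul power2_eq_square mult_ac)
  then show "det A \<noteq> 0" by auto
qed

lemma pos_def_det_pos:
  fixes s :: "real^'n^'n"
  assumes "s \<in> pos_def_matrices"
  shows "det s > 0"
proof -
  obtain A :: "real^'n^'n" where "transpose A ** s ** A = mat 1" using pos_def_diagonalize[OF assms] .
  from diagonalize_det[OF this] show ?thesis by (metis zero_less_mult_pos zero_less_one zero_less_power2)
qed

lemma matrix_inv_unique:
  fixes A B :: "real^'n^'n"
  assumes "A ** B = mat 1"
  shows "matrix_inv A = B"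
proof -
  have BA: "B ** A = mat 1" using assms by (simp add: matrix_left_right_inverse)
  then have "invertible A" using assms by (auto simp: invertible_def)
  then have "matrix_inv A ** A = mat 1"
    unfolding invertible_def matrix_inv_def by (rule someI2_ex) simp
  then have "matrix_inv A ** (A ** B) = B" by (simp add: matrix_mul_assoc)
  then show ?thesis by (simp add: assms)
qed

text \<open>A one-sided inverse of a square matrix is two-sided, so the outer factor
  \<open>transpose A\<close> may be moved to the other end of the product.\<close>

lemma diagonalize_inverse:
  fixes s A :: "real^'n^'n"
  assumes "transpose A ** s ** A = mat 1"
  shows "matrix_inv s = A ** transpose A" "s ** (A ** transpose A) = mat 1"
proof -
  have "(s ** A) ** transpose A = mat 1"
    using assms matrix_left_right_inverse[of "transpose A" "s ** A"] by (simp add: matrix_mul_assoc)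
  then show "s ** (A ** transpose A) = mat 1" by (simp add: matrix_mul_assoc)
  then show "matrix_inv s = A ** transpose A" by (rule matrix_inv_unique)
qed

lemma det_nz_mult_vec_nz:
  fixes X :: "real^'n^'n"
  assumes "det X \<noteq> 0" "x \<noteq> 0"
  shows "X *v x \<noteq> 0"
  using assms by (metis invertible_det_nz invertible_left_inverse matrix_left_invertible_ker)

lemma gram_pos_def:
  fixes X :: "real^'n^'n"
  assumes "det X \<noteq> 0"
  shows "transpose X ** X \<in> pos_def_matrices"
proof -
  have "x \<bullet> ((transpose X ** X) *v x) = (X *v x) \<bullet> (X *v x)" for x
    by (metis inner_matrix_vector_transpose matrix_vector_mul_assoc transpose_transpose)
  then show ?thesis
    using det_nz_mult_vec_nz[OF assms]
    by (simp add: pos_def_matrices_def sym_matrices_def matrix_transpose_mul)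
qed

lemma pos_def_inv:
  fixes s :: "real^'n^'n"
  assumes "s \<in> pos_def_matrices"
  shows "matrix_inv s \<in> pos_def_matrices" "s ** matrix_inv s = mat 1" "matrix_inv s ** s = mat 1"
proof -
  obtain A :: "real^'n^'n" where A: "transpose A ** s ** A = mat 1" using pos_def_diagonalize[OF assms] .
  show "matrix_inv s \<in> pos_def_matrices"
    unfolding diagonalize_inverse[OF A]
    using gram_pos_def[of "transpose A"] diagonalize_det[OF A] by simp
  show *: "s ** matrix_inv s = mat 1" using diagonalize_inverse[OF A] by simp
  then show "matrix_inv s ** s = mat 1" by (simp add: matrix_left_right_inverse)
qed

lemma pos_def_add: "s \<in> pos_def_matrices \<Longrightarrow> t \<in> pos_def_matrices \<Longrightarrow> s + t \<in> pos_def_matrices"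
  by (auto simp: pos_def_matrices_def sym_matrices_def transpose_def vec_eq_iff matrix_vector_mult_add_rdistrib
      inner_add_right add_pos_pos)

section \<open>Rank-one matrices and their determinants\<close>

definition outer :: "real^'n \<Rightarrow> real^'n^'n" where
  "outer x = (\<chi> i j. x $ i * x $ j)"

lemma outer_mult_vec: "outer x *v y = (x \<bullet> y) *\<^sub>R x"
  by (simp add: outer_def vec_eq_iff matrix_vector_mult_def inner_vec_def sum_distrib_right sum_distrib_left mult_ac)

lemma outer_sym: "outer x \<in> sym_matrices"
  by (simp add: outer_def sym_matrices_def transpose_def vec_eq_iff mult.commute)

lemma outer_conj: "A ** outer x ** transpose A = outer (A *v x)"
proof -
  have "(A ** outer x) $ i $ k = (A *v x) $ i * x $ k" for i k
    by (simp add: outer_def matrix_matrix_mult_def matrix_vector_mult_def sum_distrib_right mult.assoc)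
  then have "(A ** outer x ** transpose A) $ i $ j = (\<Sum>k\<in>UNIV. (A *v x) $ i * x $ k * A $ j $ k)" for i j
    by (simp add: matrix_matrix_mult_def[of "A ** outer x"] transpose_def)
  also have "\<dots> i j = (A *v x) $ i * (A *v x) $ j" for i j
    by (simp add: matrix_vector_mult_def[of A x] sum_distrib_left mult_ac)
  finally show ?thesis by (simp add: vec_eq_iff outer_def)
qed

lemma trace_mult_outer: "trace (s ** outer x) = x \<bullet> (s *v x)"
  by (simp add: outer_def trace_def matrix_matrix_mult_def matrix_vector_mult_def inner_vec_def sum_distrib_left
      mult.left_commute mult.commute)

lemma trace_conj_mult:
  fixes A X v :: "real^'n^'n"
  shows "trace (A ** X ** transpose A ** v) = trace (X ** (transpose A ** v ** A))"
  using trace_mul_sym[of A "X ** transpose A ** v"] by (simp add: matrix_mul_assoc)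

lemma pos_def_add_outer:
  assumes "s \<in> pos_def_matrices" "c \<ge> 0"
  shows "s + c *\<^sub>R outer x \<in> pos_def_matrices"
proof -
  have "y \<bullet> ((s + c *\<^sub>R outer x) *v y) > 0" if "y \<noteq> 0" for y
  proof -
    have "y \<bullet> ((s + c *\<^sub>R outer x) *v y) = y \<bullet> (s *v y) + c * (x \<bullet> y)\<^sup>2"
      by (simp add: matrix_vector_mult_add_rdistrib inner_add_right scaleR_matrix_vector_assoc[symmetric]
          outer_mult_vec power2_eq_square inner_commute)
    then show ?thesis using assms that by (auto simp: pos_def_matrices_def intro!: add_pos_nonneg)
  qed
  then show ?thesis
    using assms outer_sym[of x] by (auto simp: pos_def_matrices_def sym_matrices_def transpose_def vec_eq_iff)
qed

text \<open>Both sides are invariant under rotations, so \<open>x\<close> may be turned onto a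
  coordinate axis, where the matrix is diagonal with at most one entry different from 1.\<close>

lemma det_one_plus_outer: "det (mat 1 + c *\<^sub>R outer x :: real^'n^'n) = 1 + c * (x \<bullet> x)"
proof -
  \<comment> \<open>Only names some index, whose axis is the target of the rotation.\<close>
  obtain k :: 'n where True by simp
  have "norm x = norm (norm x *\<^sub>R (axis k 1 :: real^'n))" by simp
  then obtain f :: "real^'n \<Rightarrow> real^'n" where f: "orthogonal_transformation f" "f x = norm x *\<^sub>R axis k 1"
    by (rule orthogonal_transformation_exists)
  define R where "R = matrix f"
  have R: "orthogonal_matrix R" "R *v x = norm x *\<^sub>R axis k 1"
    using f by (auto simp: R_def orthogonal_transformation_matrix matrix_works)
  then have RR: "R ** transpose R = mat 1" by (simp add: orthogonal_matrix_def)
  have "R ** (mat 1 + c *\<^sub>R outer x) ** transpose R = mat 1 + c *\<^sub>R outer (R *v x)"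
    by (simp add: matrix_add_ldistrib matrix_add_rdistrib RR outer_conj[symmetric] matrix_scaleR_left matrix_scaleR_right)
  also have "\<dots> = (\<chi> i j. if i = j then (if i = k then 1 + c * (x \<bullet> x) else 1) else 0)"
    unfolding R by (auto simp: vec_eq_iff mat_def outer_def axis_def dot_square_norm power2_eq_square)
  finally have "det (R ** (mat 1 + c *\<^sub>R outer x) ** transpose R) = (\<Prod>i\<in>UNIV. if i = k then 1 + c * (x \<bullet> x) else 1)"
    by (simp add: det_diagonal)
  then have "det R * det R * det (mat 1 + c *\<^sub>R outer x) = 1 + c * (x \<bullet> x)"
    by (simp add: det_mul mult_ac)
  moreover have "det R * det R = 1" using arg_cong[OF RR, of det] by (simp add: det_mul)
  ultimately show ?thesis by simp
qed

text \<open>With \<open>matrix_inv \<sigma> = A ** transpose A\<close> and \<open>x = A *v z\<close>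
  the factors \<open>A\<close> split off, and a rank-one update of the identity remains. For
  \<open>c = 1/2\<close> this produces the quantity 1 + x^T \<sigma> x / 2 of the density.\<close>

lemma det_inv_plus_outer:
  fixes \<sigma> :: "real^'n^'n"
  assumes \<sigma>: "\<sigma> \<in> pos_def_matrices"
  shows "det (matrix_inv \<sigma> + c *\<^sub>R outer x) = (1 + c * (x \<bullet> (\<sigma> *v x))) / det \<sigma>"
proof -
  obtain A :: "real^'n^'n" where A: "transpose A ** \<sigma> ** A = mat 1" using pos_def_diagonalize[OF \<sigma>] .
  obtain B where B: "A ** B = mat 1" "B ** A = mat 1"
    using diagonalize_det(2)[OF A] by (metis invertible_det_nz invertible_def)
  let ?z = "B *v x"
  have x: "A *v ?z = x" by (simp add: matrix_vector_mul_assoc B)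
  have "?z \<bullet> ?z = ?z \<bullet> ((transpose A ** \<sigma> ** A) *v ?z)" by (simp add: A)
  also have "\<dots> = x \<bullet> (\<sigma> *v x)"
    by (metis x inner_matrix_vector_transpose matrix_vector_mul_assoc transpose_transpose)
  finally have z: "?z \<bullet> ?z = x \<bullet> (\<sigma> *v x)" .
  have "matrix_inv \<sigma> + c *\<^sub>R outer x = A ** (mat 1 + c *\<^sub>R outer ?z) ** transpose A"
    by (simp add: matrix_add_ldistrib matrix_add_rdistrib diagonalize_inverse[OF A] outer_conj x matrix_scaleR_left
       matrix_scaleR_right)
  then have "det (matrix_inv \<sigma> + c *\<^sub>R outer x) = det A ^ 2 * (1 + c * (x \<bullet> (\<sigma> *v x)))"
    by (simp add: det_mul det_one_plus_outer z power2_eq_square)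
  moreover have "det A ^ 2 = 1 / det \<sigma>"
    using diagonalize_det(1)[OF A] pos_def_det_pos[OF \<sigma>] by (simp add: field_simps)
  ultimately show ?thesis by simp
qed

subsection \<open>Linear changes of variables\<close>

text \<open>Tonelli with the coordinate along \<open>k\<close> as innermost variable, so that
  one-dimensional translation invariance can be applied with the other coordinates frozen.\<close>

lemma nn_integral_lborel_isolate_coordinate:
  fixes k :: "'a::euclidean_space" and G :: "'a \<Rightarrow> ennreal"
  assumes k: "k \<in> Basis" and [measurable]: "G \<in> borel_measurable borel"
  shows "(\<integral>\<^sup>+x. G x \<partial>lborel) = (\<integral>\<^sup>+f. (\<integral>\<^sup>+y. G ((\<Sum>b\<in>Basis - {k}. f b *\<^sub>R b) + y *\<^sub>R k) \<partial>lborel)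
      \<partial>(\<Pi>\<^sub>M b\<in>Basis - {k}. lborel))"
proof -
  interpret product_sigma_finite "\<lambda>_::'a. lborel::real measure" ..
  have ins: "Basis = insert k (Basis - {k})" using k by auto
  have "(\<integral>\<^sup>+x. G x \<partial>lborel) = (\<integral>\<^sup>+f. G (\<Sum>b\<in>Basis. f b *\<^sub>R b) \<partial>(\<Pi>\<^sub>M b\<in>Basis. lborel))"
    by (subst lborel_eq, subst nn_integral_distr) simp_all
  also have "\<dots> = (\<integral>\<^sup>+f. G (\<Sum>b\<in>Basis. f b *\<^sub>R b) \<partial>(\<Pi>\<^sub>M b\<in>insert k (Basis - {k}). lborel))"
    using ins by simp
  also have "\<dots> = (\<integral>\<^sup>+f. (\<integral>\<^sup>+y. G (\<Sum>b\<in>Basis. (f(k := y)) b *\<^sub>R b) \<partial>lborel) \<partial>(\<Pi>\<^sub>M b\<in>Basis - {k}. lborel))"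
    by (subst product_nn_integral_insert) (simp_all add: ins[symmetric])
  also have "(\<lambda>f y. G (\<Sum>b\<in>Basis. (f(k := y)) b *\<^sub>R b)) = (\<lambda>f y. G ((\<Sum>b\<in>Basis - {k}. f b *\<^sub>R b) + y *\<^sub>R k))"
  proof (intro ext)
    fix f y
    have "(\<Sum>b\<in>Basis. (f(k := y)) b *\<^sub>R b) = y *\<^sub>R k + (\<Sum>b\<in>Basis - {k}. (f(k := y)) b *\<^sub>R b)"
      using k by (subst sum.remove[of _ k]) auto
    also have "(\<Sum>b\<in>Basis - {k}. (f(k := y)) b *\<^sub>R b) = (\<Sum>b\<in>Basis - {k}. f b *\<^sub>R b)"
      by (intro sum.cong) auto
    finally show "G (\<Sum>b\<in>Basis. (f(k := y)) b *\<^sub>R b) = G ((\<Sum>b\<in>Basis - {k}. f b *\<^sub>R b) + y *\<^sub>R k)"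
      by (simp add: add.commute)
  qed
  finally show ?thesis .
qed

lemma borel_measurable_linear:
  fixes f :: "'a::euclidean_space \<Rightarrow> 'b::real_normed_vector"
  shows "linear f \<Longrightarrow> f \<in> borel_measurable borel"
  by (intro borel_measurable_continuous_onI linear_continuous_on linear_conv_bounded_linear[THEN iffD1])

text \<open>With the other coordinates frozen, \<open>l k = 0\<close> makes the shear a translation
  along \<open>k\<close>.\<close>

lemma nn_integral_lborel_shear:
  fixes k :: "'a::euclidean_space" and F :: "'a \<Rightarrow> ennreal"
  assumes k: "k \<in> Basis" and l: "linear l" "l k = 0" and F[measurable]: "F \<in> borel_measurable borel"
  shows "(\<integral>\<^sup>+x. F (x + l x *\<^sub>R k) \<partial>lborel) = (\<integral>\<^sup>+x. F x \<partial>lborel)"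
proof -
  interpret l: linear l by fact
  have [measurable]: "l \<in> borel_measurable borel"
    using l by (intro borel_measurable_linear)
  have "(\<integral>\<^sup>+y. F (v + y *\<^sub>R k + l (v + y *\<^sub>R k) *\<^sub>R k) \<partial>lborel) = (\<integral>\<^sup>+y. F (v + y *\<^sub>R k) \<partial>lborel)" for v
  proof -
    have "(\<integral>\<^sup>+y. F (v + y *\<^sub>R k) \<partial>lborel) = (\<integral>\<^sup>+y. F (v + (l v + 1 * y) *\<^sub>R k) \<partial>lborel)"
      by (subst nn_integral_real_affine[where c=1 and t="l v"]) auto
    then show ?thesis by (simp add: l.add l.scaleR l algebra_simps)
  qed
  then show ?thesis
    by (subst (1 2) nn_integral_lborel_isolate_coordinate[OF k]) simp_all
qed

text \<open>Taking \<open>'b\<close> to be \<open>real\<close> or again a vector type serves both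
  vectors and matrices.\<close>

lemma prod_Basis_vec:
  fixes g :: "('b::euclidean_space)^'n \<Rightarrow> 'c::comm_monoid_mult"
  shows "(\<Prod>b\<in>Basis. g b) = (\<Prod>i\<in>UNIV. \<Prod>u\<in>Basis. g (axis i u))"
proof -
  have "bij_betw (\<lambda>(i, u). axis i u) (UNIV \<times> Basis) (Basis :: ('b^'n) set)"
    by (auto simp: bij_betw_def inj_on_def Basis_vec_def axis_eq_axis image_iff)
  then have "(\<Prod>b\<in>Basis. g b) = (\<Prod>(i, u)\<in>UNIV \<times> Basis. g (axis i u))"
    by (subst prod.reindex_bij_betw[symmetric]) (auto simp: case_prod_unfold)
  then show ?thesis by (simp add: prod.cartesian_product)
qed

lemma emeasure_lborel_box_cart:
  fixes l u :: "real^'n"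
  assumes "\<And>i. l $ i \<le> u $ i"
  shows "emeasure lborel (box l u) = ennreal (\<Prod>i\<in>UNIV. u $ i - l $ i)"
proof -
  have "emeasure lborel (box l u) = ennreal (\<Prod>b\<in>Basis. (u - l) \<bullet> b)"
    using assms by (intro emeasure_lborel_box) (auto simp: Basis_vec_def inner_axis)
  then show ?thesis by (simp add: prod_Basis_vec inner_axis)
qed

text \<open>Invertible linear maps are composed of coordinate scalings, transpositions and shears,
  each with an evident effect on Lebesgue measure, and the determinant is multiplicative along
  compositions.\<close>

lemma nn_integral_lborel_linear:
  fixes f :: "real^'n \<Rightarrow> real^'n" and F :: "real^'n \<Rightarrow> ennreal"
  assumes f: "linear f" and d: "det (matrix f) \<noteq> 0" and F: "F \<in> borel_measurable borel"
  shows "ennreal \<bar>det (matrix f)\<bar> * (\<integral>\<^sup>+x. F (f x) \<partial>lborel) = (\<integral>\<^sup>+x. F x \<partial>lborel)"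
proof -
  \<comment> \<open>Nonvanishing of the determinant is a premise inside \<open>P\<close>: a
    composition passes it on to both factors, and maps with a vanishing coordinate satisfy
    \<open>P\<close> trivially.\<close>
  define P where "P f \<longleftrightarrow> (det (matrix f) \<noteq> 0 \<longrightarrow> (\<forall>F \<in> borel_measurable borel.
    ennreal \<bar>det (matrix f)\<bar> * (\<integral>\<^sup>+x. F (f x) \<partial>lborel) = (\<integral>\<^sup>+x. F x \<partial>lborel)))" for f :: "real^'n \<Rightarrow> real^'n"
  have "P f"
  proof (rule induct_linear_elementary[OF f])
    fix f g :: "real^'n \<Rightarrow> real^'n" assume lin: "linear f" "linear g" and "P f" "P g"
    have m: "f \<in> borel_measurable borel"
      using lin by (intro borel_measurable_linear)
    show "P (f \<circ> g)"
      unfolding P_def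
    proof (intro impI ballI)
      fix F :: "real^'n \<Rightarrow> ennreal" assume F: "F \<in> borel_measurable borel" and "det (matrix (f \<circ> g)) \<noteq> 0"
      then have d: "det (matrix f) \<noteq> 0" "det (matrix g) \<noteq> 0"
        using lin by (auto simp: matrix_compose det_mul)
      have Ff: "(\<lambda>x. F (f x)) \<in> borel_measurable borel" using F m by measurable
      have "ennreal \<bar>det (matrix (f \<circ> g))\<bar> * (\<integral>\<^sup>+x. F ((f \<circ> g) x) \<partial>lborel)
        = ennreal \<bar>det (matrix f)\<bar> * (ennreal \<bar>det (matrix g)\<bar> * (\<integral>\<^sup>+x. F (f (g x)) \<partial>lborel))"
        using lin by (simp add: matrix_compose det_mul abs_mult ennreal_mult mult.assoc)
      also have "\<dots> = ennreal \<bar>det (matrix f)\<bar> * (\<integral>\<^sup>+x. F (f x) \<partial>lborel)"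
        using \<open>P g\<close> d Ff unfolding P_def by auto
      also have "\<dots> = (\<integral>\<^sup>+x. F x \<partial>lborel)"
        using \<open>P f\<close> d F unfolding P_def by auto
      finally show "ennreal \<bar>det (matrix (f \<circ> g))\<bar> * (\<integral>\<^sup>+x. F ((f \<circ> g) x) \<partial>lborel) = (\<integral>\<^sup>+x. F x \<partial>lborel)" .
    qed
  next
    fix f :: "real^'n \<Rightarrow> real^'n" and i assume "linear f" "\<And>x. f x $ i = 0"
    then have "det (matrix f) = 0"
      by (intro det_zero_row(1)[of i]) (auto simp: matrix_def row_def vec_eq_iff)
    then show "P f" by (simp add: P_def)
  next
    fix c :: "'n \<Rightarrow> real"
    let ?f = "\<lambda>x::real^'n. \<chi> i. c i * x $ i"
    have det: "det (matrix ?f) = (\<Prod>i\<in>UNIV. c i)"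
      by (subst det_diagonal) (auto simp: matrix_def axis_def)
    have "linear ?f" by (auto intro!: linearI simp: vec_eq_iff algebra_simps)
    then have [measurable]: "?f \<in> borel_measurable borel" by (rule borel_measurable_linear)
    show "P ?f"
      unfolding P_def
    proof (intro impI ballI)
      fix F :: "real^'n \<Rightarrow> ennreal" assume [measurable]: "F \<in> borel_measurable borel" and d: "det (matrix ?f) \<noteq> 0"
      \<comment> \<open>The affine substitution expects factors indexed by basis vectors;
        \<open>c'\<close> recovers the index of an axis.\<close>
      define c' where "c' b = c (SOME i. b = axis i 1)" for b :: "real^'n"
      have c': "c' (axis i 1) = c i" for i
        unfolding c'_def by (rule arg_cong[of _ _ c]) (auto simp: axis_eq_axis)
      have nz: "c' b \<noteq> 0" if "b \<in> Basis" for b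
        using that d det c' by (auto simp: Basis_vec_def)
      have eq: "0 + (\<Sum>j\<in>Basis. (c' j * (x \<bullet> j)) *\<^sub>R j) = ?f x" for x :: "real^'n"
        by (rule euclidean_eqI) (auto simp: inner_sum_left inner_Basis if_distrib c' Basis_vec_def inner_axis cong: if_cong)
      have pr: "(\<Prod>j\<in>Basis. \<bar>c' j\<bar>) = \<bar>det (matrix ?f)\<bar>"
        unfolding det abs_prod by (simp add: prod_Basis_vec c')
      have "lborel = density (distr lborel borel ?f) (\<lambda>_. \<bar>det (matrix ?f)\<bar>)"
        using lborel_affine_euclidean[of c' 0] nz unfolding eq pr by simp
      then have "(\<integral>\<^sup>+x. F x \<partial>lborel) = (\<integral>\<^sup>+x. F x \<partial>(density (distr lborel borel ?f) (\<lambda>_. \<bar>det (matrix ?f)\<bar>)))"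
        by simp
      also have "\<dots> = ennreal \<bar>det (matrix ?f)\<bar> * (\<integral>\<^sup>+x. F (?f x) \<partial>lborel)"
        by (simp add: nn_integral_density nn_integral_distr nn_integral_cmult)
      finally show "ennreal \<bar>det (matrix ?f)\<bar> * (\<integral>\<^sup>+x. F (?f x) \<partial>lborel) = (\<integral>\<^sup>+x. F x \<partial>lborel)" ..
    qed
  next
    fix m n :: 'n assume "m \<noteq> n"
    let ?T = "\<lambda>x::real^'n. \<chi> i. x $ Transposition.transpose m n i"
    have lin: "linear ?T" by (auto intro!: linearI simp: vec_eq_iff)
    \<comment> \<open>An involution has determinant 1 or -1, and only the absolute value
      matters.\<close>
    have "?T \<circ> ?T = id" by (auto simp: fun_eq_iff vec_eq_iff)
    then have "matrix ?T ** matrix ?T = mat 1"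
      using matrix_compose[OF lin lin] by (simp add: matrix_id_mat_1)
    then have "det (matrix ?T) * det (matrix ?T) = 1"
      by (metis det_mul det_I)
    then have det: "\<bar>det (matrix ?T)\<bar> = 1"
      by (auto simp: square_eq_1_iff)
    have [measurable]: "?T \<in> borel_measurable borel"
      using lin by (intro borel_measurable_linear)
    have "lborel = distr lborel borel ?T"
    proof (rule lborel_eqI)
      fix l u :: "real^'n" assume "\<And>b. b \<in> Basis \<Longrightarrow> l \<bullet> b \<le> u \<bullet> b"
      then have lu: "l $ i \<le> u $ i" for i
        by (metis axis_in_Basis_iff inner_axis real_inner_1_right Basis_real_def singletonI)
      have "?T -` box l u = box (?T l) (?T u)"
        by (auto simp: mem_box_cart) (metis transpose_involutory)+
      then have "emeasure (distr lborel borel ?T) (box l u) = emeasure lborel (box (?T l) (?T u))"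
        by (simp add: emeasure_distr)
      also have "\<dots> = ennreal (\<Prod>i\<in>UNIV. (u - l) $ Transposition.transpose m n i)"
        using lu by (subst emeasure_lborel_box_cart) auto
      also have "(\<Prod>i\<in>UNIV. (u - l) $ Transposition.transpose m n i) = (\<Prod>i\<in>UNIV. (u - l) $ i)"
        by (rule prod.reindex_bij_betw) simp
      also have "\<dots> = (\<Prod>b\<in>Basis. (u - l) \<bullet> b)"
        by (simp add: prod_Basis_vec inner_axis)
      finally show "emeasure (distr lborel borel ?T) (box l u) = ennreal (\<Prod>b\<in>Basis. (u - l) \<bullet> b)" .
    qed simp
    then have "(\<integral>\<^sup>+x. F (?T x) \<partial>lborel) = (\<integral>\<^sup>+x. F x \<partial>lborel)" if "F \<in> borel_measurable borel" for F
      using that nn_integral_distr[of ?T lborel borel F] by simp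
    then show "P ?T" by (simp add: P_def det)
  next
    fix m n :: 'n assume "m \<noteq> n"
    let ?T = "\<lambda>x::real^'n. \<chi> i. if i = m then x $ m + x $ n else x $ i"
    have "matrix ?T = (\<chi> k. if k = m then row m (mat 1) + 1 *s row n (mat 1) else row k (mat 1))"
      by (auto simp: matrix_def vec_eq_iff row_def mat_def axis_def)
    then have det: "det (matrix ?T) = 1"
      using det_row_operation[OF \<open>m \<noteq> n\<close>, of "mat 1 :: real^'n^'n" 1] by simp
    have T: "?T x = x + (x $ n) *\<^sub>R axis m 1" for x
      by (auto simp: vec_eq_iff axis_def)
    have "linear (\<lambda>x::real^'n. x $ n)" by (auto intro!: linearI)
    then have "(\<integral>\<^sup>+x. F (?T x) \<partial>lborel) = (\<integral>\<^sup>+x. F x \<partial>lborel)" if "F \<in> borel_measurable borel" for F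
      unfolding T using that \<open>m \<noteq> n\<close> by (intro nn_integral_lborel_shear) (auto simp: axis_in_Basis_iff, simp add: axis_def)
    then show "P ?T" by (simp add: P_def det)
  qed
  then show ?thesis using d F by (auto simp: P_def)
qed


lemma nn_integral_lborel_matrix_vector_mult:
  fixes A :: "real^'n^'n" and F :: "real^'n \<Rightarrow> ennreal"
  assumes "det A \<noteq> 0" "F \<in> borel_measurable borel"
  shows "ennreal \<bar>det A\<bar> * (\<integral>\<^sup>+x. F (A *v x) \<partial>lborel) = (\<integral>\<^sup>+x. F x \<partial>lborel)"
  using nn_integral_lborel_linear[of "(*v) A" F] assms by simp

text \<open>Lebesgue measure on matrices is the product of the Lebesgue measures on the rows, which
  is checked on boxes. A map that acts on each row separately can thus be treated one row at a
  time.\<close>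

lemma emeasure_lborel_rows:
  fixes P :: "'m::finite \<Rightarrow> (real^'n) set"
  assumes P: "\<And>i. P i \<in> sets borel"
  shows "emeasure lborel {X :: real^'n^'m. \<forall>i. X $ i \<in> P i} = (\<Prod>i\<in>UNIV. emeasure lborel (P i))"
proof -
  let ?M = "\<Pi>\<^sub>M i\<in>(UNIV::'m set). (lborel :: (real^'n) measure)"
  let ?v = "\<lambda>f::'m \<Rightarrow> real^'n. \<chi> i. f i"
  interpret product_sigma_finite "\<lambda>_::'m. lborel::(real^'n) measure" ..
  have [measurable]: "?v \<in> borel_measurable ?M"
  proof (subst borel_measurable_euclidean_space, intro ballI)
    fix b :: "real^'n^'m" assume "b \<in> Basis"
    then obtain i u where "b = axis i u" by (auto simp: Basis_vec_def)
    moreover have "(\<lambda>f. f i \<bullet> u) \<in> borel_measurable ?M" by measurable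
    ultimately show "(\<lambda>f. ?v f \<bullet> b) \<in> borel_measurable ?M" by (simp add: inner_axis)
  qed
  have eq: "lborel = distr ?M borel ?v"
  proof (rule lborel_eqI)
    fix l u :: "real^'n^'m" assume le: "\<And>b. b \<in> Basis \<Longrightarrow> l \<bullet> b \<le> u \<bullet> b"
    have lu: "l $ i $ j \<le> u $ i $ j" for i j
      using le[of "axis i (axis j 1)"] by (simp add: inner_axis axis_in_Basis_iff)
    have "?v -` box l u \<inter> space ?M = Pi\<^sub>E UNIV (\<lambda>i. box (l $ i) (u $ i))"
      by (auto simp: mem_box Basis_vec_def inner_axis space_PiM PiE_iff)
    then have "emeasure (distr ?M borel ?v) (box l u) = (\<Prod>i\<in>UNIV. emeasure lborel (box (l $ i) (u $ i)))"
      by (subst emeasure_distr) (auto simp: emeasure_PiM)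
    also have "\<dots> = (\<Prod>i\<in>UNIV. ennreal (\<Prod>j\<in>UNIV. u $ i $ j - l $ i $ j))"
      using lu by (simp add: emeasure_lborel_box_cart)
    also have "\<dots> = ennreal (\<Prod>b\<in>Basis. (u - l) \<bullet> b)"
      using lu by (subst prod_ennreal) (auto intro!: prod_nonneg simp: prod_Basis_vec inner_axis)
    finally show "emeasure (distr ?M borel ?v) (box l u) = ennreal (\<Prod>b\<in>Basis. (u - l) \<bullet> b)" .
  qed simp
  have [measurable]: "{X :: real^'n^'m. \<forall>i. X $ i \<in> P i} \<in> sets borel"
  proof -
    have "(\<lambda>X::real^'n^'m. X $ i) -` P i \<inter> space borel \<in> sets borel" for i
      by (rule measurable_sets[OF borel_measurable_linear P]) (auto intro: linearI)
    then have "(\<Inter>i. (\<lambda>X::real^'n^'m. X $ i) -` P i) \<in> sets borel" by (intro sets.finite_INT) auto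
    also have "(\<Inter>i. (\<lambda>X::real^'n^'m. X $ i) -` P i) = {X. \<forall>i. X $ i \<in> P i}" by auto
    finally show ?thesis .
  qed
  have "?v -` {X. \<forall>i. X $ i \<in> P i} \<inter> space ?M = Pi\<^sub>E UNIV P"
    by (auto simp: space_PiM PiE_iff)
  then show ?thesis
    using P by (subst eq, subst emeasure_distr) (auto simp: emeasure_PiM)
qed

text \<open>Right multiplication by \<open>B\<close> applies \<open>transpose B\<close> to every
  row, whence one factor |det B| per row. It is enough to look at boxes, whose preimages are
  products over the rows.\<close>

lemma nn_integral_lborel_matrix_mult:
  fixes B :: "real^'n^'n" and F :: "real^'n^'m \<Rightarrow> ennreal"
  assumes d: "det B \<noteq> 0" and [measurable]: "F \<in> borel_measurable borel"
  shows "ennreal (\<bar>det B\<bar> ^ CARD('m)) * (\<integral>\<^sup>+X. F (X ** B) \<partial>lborel) = (\<integral>\<^sup>+X. F X \<partial>lborel)"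
proof -
  let ?T = "\<lambda>X::real^'n^'m. X ** B"
  have [measurable]: "?T \<in> borel_measurable borel"
    by (intro borel_measurable_linear linearI)
       (simp_all add: matrix_add_rdistrib matrix_scaleR_left)
  have row: "(X ** B) $ i = transpose B *v (X $ i)" for X :: "real^'n^'m" and i
    by (simp add: vec_eq_iff matrix_matrix_mult_def vector_matrix_mult_def mult.commute)
  have "lborel = density (distr lborel borel ?T) (\<lambda>_. ennreal (\<bar>det B\<bar> ^ CARD('m)))"
  proof (rule lborel_eqI)
    fix l u :: "real^'n^'m" assume le: "\<And>b. b \<in> Basis \<Longrightarrow> l \<bullet> b \<le> u \<bullet> b"
    have lu: "l $ i $ j \<le> u $ i $ j" for i j
      using le[of "axis i (axis j 1)"] by (simp add: inner_axis axis_in_Basis_iff)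
    define P where "P i = (\<lambda>x. transpose B *v x) -` box (l $ i) (u $ i)" for i
    have P: "P i \<in> sets borel" for i
    proof -
      have "(\<lambda>x. transpose B *v x) \<in> borel_measurable borel"
        by (rule borel_measurable_linear) (rule matrix_vector_mul_linear)
      from measurable_sets[OF this, of "box (l $ i) (u $ i)"] show ?thesis by (simp add: P_def)
    qed
    have Pm: "ennreal \<bar>det B\<bar> * emeasure lborel (P i) = ennreal (\<Prod>j\<in>UNIV. u $ i $ j - l $ i $ j)" for i
    proof -
      have "ennreal \<bar>det B\<bar> * (\<integral>\<^sup>+x. indicator (box (l $ i) (u $ i)) (transpose B *v x) \<partial>lborel)
          = (\<integral>\<^sup>+x. indicator (box (l $ i) (u $ i)) x \<partial>lborel)"
        using nn_integral_lborel_matrix_vector_mult[of "transpose B" "indicator (box (l $ i) (u $ i))"] d by simp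
      also have "(\<lambda>x. indicator (box (l $ i) (u $ i)) (transpose B *v x)) = (indicator (P i) :: _ \<Rightarrow> ennreal)"
        by (auto simp: P_def indicator_def)
      finally show ?thesis using P lu by (simp add: emeasure_lborel_box_cart)
    qed
    have "?T -` box l u = {X. \<forall>i. X $ i \<in> P i}"
      by (auto simp: P_def row mem_box Basis_vec_def inner_axis simp del: transpose_matrix_vector)
    then have "emeasure (density (distr lborel borel ?T) (\<lambda>_. ennreal (\<bar>det B\<bar> ^ CARD('m)))) (box l u)
       = ennreal (\<bar>det B\<bar> ^ CARD('m)) * (\<Prod>i\<in>UNIV. emeasure lborel (P i))"
      by (simp add: emeasure_density_const emeasure_distr emeasure_lborel_rows P)
    also have "\<dots> = (\<Prod>i\<in>UNIV. ennreal \<bar>det B\<bar> * emeasure lborel (P i))"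
      by (simp add: prod.distrib ennreal_power)
    also have "\<dots> = (\<Prod>i\<in>UNIV. ennreal (\<Prod>j\<in>UNIV. u $ i $ j - l $ i $ j))"
      by (simp add: Pm)
    also have "\<dots> = ennreal (\<Prod>b\<in>Basis. (u - l) \<bullet> b)"
      using lu by (subst prod_ennreal) (auto intro!: prod_nonneg simp: prod_Basis_vec inner_axis)
    finally show "emeasure (density (distr lborel borel ?T) (\<lambda>_. ennreal (\<bar>det B\<bar> ^ CARD('m)))) (box l u)
      = ennreal (\<Prod>b\<in>Basis. (u - l) \<bullet> b)" .
  qed simp
  then have "(\<integral>\<^sup>+X. F X \<partial>lborel)
      = (\<integral>\<^sup>+X. F X \<partial>(density (distr lborel borel ?T) (\<lambda>_. ennreal (\<bar>det B\<bar> ^ CARD('m)))))"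
    by simp
  also have "\<dots> = ennreal (\<bar>det B\<bar> ^ CARD('m)) * (\<integral>\<^sup>+X. F (X ** B) \<partial>lborel)"
    by (simp add: nn_integral_density nn_integral_distr nn_integral_cmult)
  finally show ?thesis ..
qed

text \<open>Stated for measures so that the substitution carries over to Bochner integrals of
  vector-valued functions.\<close>

lemma lborel_eq_density_distr_matrix_vector_mult:
  fixes A :: "real^'n^'n"
  assumes d: "det A \<noteq> 0"
  shows "lborel = density (distr lborel borel (\<lambda>x. A *v x)) (\<lambda>_. ennreal \<bar>det A\<bar>)"
proof (rule measure_eqI)
  have [measurable]: "(\<lambda>x. A *v x) \<in> borel_measurable borel"
    by (intro borel_measurable_linear matrix_vector_mul_linear)
  fix S :: "(real^'n) set" assume "S \<in> sets lborel"
  then have [measurable]: "S \<in> sets borel" by simp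
  have "emeasure lborel S = (\<integral>\<^sup>+x. indicator S x \<partial>lborel)" by simp
  also have "\<dots> = ennreal \<bar>det A\<bar> * (\<integral>\<^sup>+x. indicator S (A *v x) \<partial>lborel)"
    by (rule nn_integral_lborel_matrix_vector_mult[symmetric, OF d]) measurable
  also have "\<dots> = ennreal \<bar>det A\<bar> * (\<integral>\<^sup>+x. indicator S x \<partial>distr lborel borel (\<lambda>x. A *v x))"
    by (subst nn_integral_distr) auto
  finally show "emeasure lborel S = emeasure (density (distr lborel borel (\<lambda>x. A *v x)) (\<lambda>_. ennreal \<bar>det A\<bar>)) S"
    by (simp add: emeasure_density_const)
qed simp

lemma integral_lborel_matrix_vector_mult:
  fixes A :: "real^'n^'n" and f :: "real^'n \<Rightarrow> 'b::{banach, second_countable_topology}"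
  assumes d: "det A \<noteq> 0" and [measurable]: "f \<in> borel_measurable borel"
  shows "(LINT x|lborel. f x) = (LINT x|lborel. \<bar>det A\<bar> *\<^sub>R f (A *v x))"
proof -
  have [measurable]: "(\<lambda>x. A *v x) \<in> borel_measurable borel"
    by (intro borel_measurable_linear matrix_vector_mul_linear)
  have "(LINT x|lborel. f x) = (LINT x|density (distr lborel borel (\<lambda>x. A *v x)) (\<lambda>_. ennreal \<bar>det A\<bar>). f x)"
    using lborel_eq_density_distr_matrix_vector_mult[OF d] by simp
  also have "\<dots> = (LINT x|distr lborel borel (\<lambda>x. A *v x). \<bar>det A\<bar> *\<^sub>R f x)"
    by (rule integral_density) auto
  also have "\<dots> = (LINT x|lborel. \<bar>det A\<bar> *\<^sub>R f (A *v x))"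
    by (rule integral_distr) auto
  finally show ?thesis .
qed

subsection \<open>Integrability of powers of the determinant\<close>

lemma nn_integral_exp_neg_square:
  assumes "c > 0"
  shows "(\<integral>\<^sup>+x. ennreal (exp (- c * x\<^sup>2)) \<partial>lborel) = ennreal (sqrt (pi / c))"
proof -
  let ?s = "1 / sqrt (2 * c)"
  have s: "?s > 0" using assms by simp
  have eq: "exp (- c * x\<^sup>2) = sqrt (pi / c) * normal_density 0 ?s x" for x
    using assms by (simp add: normal_density_def power_divide real_sqrt_divide real_sqrt_mult field_simps)
  have "(\<integral>\<^sup>+x. ennreal (exp (- c * x\<^sup>2)) \<partial>lborel) = ennreal (sqrt (pi / c)) * (\<integral>\<^sup>+x. ennreal (normal_density 0 ?s x) \<partial>lborel)"
    unfolding eq using assms by (simp add: ennreal_mult nn_integral_cmult)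
  also have "(\<integral>\<^sup>+x. ennreal (normal_density 0 ?s x) \<partial>lborel) = 1"
    using s by (subst nn_integral_eq_integral) auto
  finally show ?thesis by simp
qed

lemma nn_integral_exp_neg_inner:
  assumes "c > 0"
  shows "(\<integral>\<^sup>+x. ennreal (exp (- c * (x \<bullet> x))) \<partial>(lborel :: 'a::euclidean_space measure)) = ennreal (sqrt (pi / c) ^ DIM('a))"
proof -
  have "ennreal (exp (- c * (x \<bullet> x))) = (\<Prod>b\<in>Basis. ennreal (exp (- c * (x \<bullet> b)\<^sup>2)))" for x :: 'a
    by (subst prod_ennreal) (simp_all add: exp_sum[symmetric] sum_distrib_left euclidean_inner[of x x] power2_eq_square sum_negf)
  then have "(\<integral>\<^sup>+x. ennreal (exp (- c * (x \<bullet> x))) \<partial>(lborel :: 'a measure))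
      = (\<integral>\<^sup>+x. (\<Prod>b\<in>Basis. ennreal (exp (- c * (x \<bullet> b)\<^sup>2))) \<partial>(lborel :: 'a measure))" by simp
  also have "\<dots> = (\<Prod>b\<in>(Basis::'a set). ennreal (sqrt (pi / c)))"
    using nn_integral_exp_neg_square[OF assms] by (subst nn_integral_lborel_prod) auto
  finally show ?thesis using assms by (simp add: ennreal_power)
qed

text \<open>The value at \<open>0\<close> is \<open>\<infinity>\<close>, not the \<open>0\<close> of \<open>powr\<close>: otherwise the bound for affine arguments below would fail
  for slope \<open>0\<close>.\<close>

definition sing_powr :: "real \<Rightarrow> real \<Rightarrow> ennreal" where
  "sing_powr q y = (if y = 0 then \<infinity> else ennreal (\<bar>y\<bar> powr q))"

lemma sing_powr_measurable[measurable]: "sing_powr q \<in> borel_measurable borel"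
  unfolding sing_powr_def by measurable

lemma nn_integral_abs_powr_unit_finite:
  assumes "q > -1"
  shows "(\<integral>\<^sup>+s. ennreal (indicator {-1..1} s * \<bar>s\<bar> powr q) \<partial>lborel) < \<infinity>"
proof -
  have "((\<lambda>s. s powr q) has_integral (1 powr (q + 1) / (q + 1))) {0..1}"
    using has_integral_powr_from_0[of q 1] assms by simp
  from nn_integral_has_integral_lebesgue[OF _ this]
  have half: "(\<integral>\<^sup>+s. ennreal (indicator {0..1} s * s powr q) \<partial>lborel) = ennreal (1 / (q + 1))"
    by simp
  have "(\<integral>\<^sup>+s. ennreal (indicator {-1..1} s * \<bar>s\<bar> powr q) \<partial>lborel)
     \<le> (\<integral>\<^sup>+s. ennreal (indicator {0..1} s * s powr q) + ennreal (indicator {0..1} (-s) * (-s) powr q) \<partial>lborel)"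
    by (intro nn_integral_mono) (auto simp: indicator_def)
  also have "\<dots> = (\<integral>\<^sup>+s. ennreal (indicator {0..1} s * s powr q) \<partial>lborel) + (\<integral>\<^sup>+s. ennreal (indicator {0..1} (-s) * (-s) powr q) \<partial>lborel)"
    by (rule nn_integral_add) auto
  also have "(\<integral>\<^sup>+s. ennreal (indicator {0..1} (-s) * (-s) powr q) \<partial>lborel) = (\<integral>\<^sup>+s. ennreal (indicator {0..1} s * s powr q) \<partial>lborel)"
    using nn_integral_real_affine[of "\<lambda>s. ennreal (indicator {0..1} s * s powr q)" "-1" 0] by simp
  also have "(\<integral>\<^sup>+s. ennreal (indicator {0..1} s * s powr q) \<partial>lborel) + (\<integral>\<^sup>+s. ennreal (indicator {0..1} s * s powr q) \<partial>lborel) < \<infinity>"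
    unfolding half by simp
  finally show ?thesis .
qed

text \<open>The argument is \<open>\<alpha>\<close> times b + t. For q < 0 the power of |b + t| is
  at most 1 where |b + t| \<ge> 1, and elsewhere its integral is at most the one over [-1, 1];
  neither bound depends on b.\<close>

lemma nn_integral_sing_powr_affine_le:
  assumes q: "-1 < q" "q < 0"
  obtains C where "C < \<infinity>" "\<And>\<alpha> \<beta>. (\<integral>\<^sup>+t. indicator {0..1} t * sing_powr q (t * \<alpha> + \<beta>) \<partial>lborel) \<le> C * sing_powr q \<alpha>"
proof -
  define C0 where "C0 = (\<integral>\<^sup>+s. ennreal (indicator {-1..1} s * \<bar>s\<bar> powr q) \<partial>lborel)"
  have C0: "C0 < \<infinity>" unfolding C0_def using q by (intro nn_integral_abs_powr_unit_finite)
  have "(\<integral>\<^sup>+t. indicator {0..1} t * sing_powr q (t * \<alpha> + \<beta>) \<partial>lborel) \<le> (1 + C0) * sing_powr q \<alpha>" for \<alpha> \<beta>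
  proof (cases "\<alpha> = 0")
    case True
    then show ?thesis by (simp add: sing_powr_def ennreal_mult_top)
  next
    case False
    define b where "b = \<beta> / \<alpha>"
    \<comment> \<open>At t = -b the left side is infinite and the pointwise bound fails, but this is
      a null set.\<close>
    have "AE t in lborel. t \<noteq> - b" by (rule AE_lborel_singleton)
    then have "AE t in lborel. indicator {0..1} t * sing_powr q (t * \<alpha> + \<beta>)
       \<le> ennreal (\<bar>\<alpha>\<bar> powr q) * (indicator {0..1} t + ennreal (indicator {-1..1} (b + 1 * t) * \<bar>b + 1 * t\<bar> powr q))"
    proof eventually_elim
      case (elim t)
      have e: "t * \<alpha> + \<beta> = \<alpha> * (b + t)" using False by (simp add: b_def field_simps)
      have nz: "t * \<alpha> + \<beta> \<noteq> 0" unfolding e using elim False by auto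
      have "\<bar>b + t\<bar> powr q \<le> 1 + indicator {-1..1} (b + t) * \<bar>b + t\<bar> powr q"
      proof (cases "\<bar>b + t\<bar> \<le> 1")
        case False
        then have "\<bar>b + t\<bar> powr q \<le> 1 powr q" using q by (intro powr_mono2') auto
        then show ?thesis by (simp add: indicator_def)
      qed (auto simp: indicator_def)
      then have "ennreal (\<bar>\<alpha>\<bar> powr q * \<bar>b + t\<bar> powr q) \<le> ennreal (\<bar>\<alpha>\<bar> powr q * (1 + indicator {-1..1} (b + t) * \<bar>b + t\<bar> powr q))"
        by (intro ennreal_leI mult_left_mono) auto
      then show ?case
        using nz unfolding sing_powr_def e
        by (auto simp: abs_mult powr_mult ennreal_mult ennreal_plus indicator_def)
    qed
    then have "(\<integral>\<^sup>+t. indicator {0..1} t * sing_powr q (t * \<alpha> + \<beta>) \<partial>lborel) \<le>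
      (\<integral>\<^sup>+t. ennreal (\<bar>\<alpha>\<bar> powr q) * (indicator {0..1} t + ennreal (indicator {-1..1} (b + 1 * t) * \<bar>b + 1 * t\<bar> powr q)) \<partial>lborel)"
      by (rule nn_integral_mono_AE)
    also have "\<dots> = ennreal (\<bar>\<alpha>\<bar> powr q) * ((\<integral>\<^sup>+t. indicator {0..1} t \<partial>(lborel::real measure)) + (\<integral>\<^sup>+t. ennreal (indicator {-1..1} (b + 1 * t) * \<bar>b + 1 * t\<bar> powr q) \<partial>lborel))"
      by (subst nn_integral_cmult, simp, subst nn_integral_add) simp_all
    also have "(\<integral>\<^sup>+t. ennreal (indicator {-1..1} (b + 1 * t) * \<bar>b + 1 * t\<bar> powr q) \<partial>lborel) = C0"
    proof -
      have "C0 = ennreal \<bar>1\<bar> * (\<integral>\<^sup>+t. ennreal (indicator {-1..1} (b + 1 * t) * \<bar>b + 1 * t\<bar> powr q) \<partial>lborel)"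
        unfolding C0_def by (rule nn_integral_real_affine) auto
      then show ?thesis by simp
    qed
    finally show ?thesis using False by (simp add: sing_powr_def mult.commute)
  qed
  moreover have "1 + C0 < \<infinity>" using C0 by (simp add: less_top)
  ultimately show ?thesis using that by blast
qed

text \<open>The principal minor on \<open>S\<close>, padded by the identity so that all minors are
  determinants of the same matrix type and \<open>S\<close> can grow by induction.\<close>

definition det_on :: "'n set \<Rightarrow> real^'n^'n \<Rightarrow> real" where
  "det_on S X = det (\<chi> i j. if i \<in> S \<and> j \<in> S then X $ i $ j else of_bool (i = j))"

lemma continuous_on_det: "continuous_on UNIV (det :: real^'n^'n \<Rightarrow> real)"
  unfolding det_def by (auto intro!: continuous_intros)

lemma det_on_measurable[measurable]: "(det_on S :: real^'n^'n \<Rightarrow> real) \<in> borel_measurable borel"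
proof -
  have "continuous_on UNIV (\<lambda>X::real^'n^'n. if P then X $ i $ j else b)" for P i j b
    by (cases P) (auto intro!: continuous_intros)
  then have "continuous_on UNIV (det_on S :: real^'n^'n \<Rightarrow> real)"
    unfolding det_on_def det_def by (auto intro!: continuous_intros)
  then show ?thesis by (rule borel_measurable_continuous_onI)
qed

text \<open>A permutation that moves \<open>k\<close> picks a zero from row \<open>k\<close>, and
  one that fixes \<open>k\<close> meets no other entry of column \<open>k\<close>. So the rest of
  that column is irrelevant.\<close>

lemma det_cong_unit_row:
  fixes A B :: "real^'n^'n"
  assumes "A $ k = axis k 1" "B $ k = axis k 1" and AB: "\<And>i j. i \<noteq> k \<Longrightarrow> j \<noteq> k \<Longrightarrow> A $ i $ j = B $ i $ j"
  shows "det A = det B"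
  unfolding det_def
proof (rule sum.cong[OF refl])
  fix p assume "p \<in> {p. p permutes (UNIV::'n set)}"
  then have p: "p permutes UNIV" by simp
  have "(\<Prod>i\<in>UNIV. A $ i $ p i) = (\<Prod>i\<in>UNIV. B $ i $ p i)"
  proof (cases "p k = k")
    case True
    have "A $ i $ p i = B $ i $ p i" for i
    proof (cases "i = k")
      case False
      then have "p i \<noteq> k" using True permutes_inj[OF p] by (metis injD)
      then show ?thesis using AB False by blast
    qed (simp add: assms)
    then show ?thesis by simp
  next
    case False
    then have "A $ k $ p k = 0" "B $ k $ p k = 0" by (simp_all add: assms axis_def)
    then have "(\<Prod>i\<in>UNIV. A $ i $ p i) = 0" "(\<Prod>i\<in>UNIV. B $ i $ p i) = 0" by (auto intro!: prod_zero bexI[of _ k])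
    then show ?thesis by (simp only:)
  qed
  then show "of_int (sign p) * (\<Prod>i\<in>UNIV. A $ i $ p i) = of_int (sign p) * (\<Prod>i\<in>UNIV. B $ i $ p i)" by simp
qed

text \<open>The shift affects only row \<open>k\<close>, in which the determinant is linear. In the
  term carrying \<open>t\<close>, row \<open>k\<close> is a unit vector, so column \<open>k\<close>
  may be cleared, which leaves the padded minor.\<close>

lemma det_on_insert_diag:
  fixes X :: "real^'n^'n"
  assumes "k \<notin> S"
  shows "det_on (insert k S) (X + t *\<^sub>R axis k (axis k 1)) = t * det_on S X + det_on (insert k S) X"
proof -
  let ?M = "\<lambda>X::real^'n^'n. \<chi> i j. if i \<in> insert k S \<and> j \<in> insert k S then X $ i $ j else of_bool (i = j)"
  have "?M (X + t *\<^sub>R axis k (axis k 1)) = (\<chi> i. if i = k then t *s axis k 1 + ?M X $ k else ?M X $ i)"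
    by (auto simp: vec_eq_iff axis_def)
  then have "det_on (insert k S) (X + t *\<^sub>R axis k (axis k 1)) = det (\<chi> i. if i = k then t *s axis k 1 + ?M X $ k else ?M X $ i)"
    by (simp add: det_on_def)
  also have "\<dots> = det (\<chi> i. if i = k then t *s axis k 1 else ?M X $ i) + det (\<chi> i. if i = k then ?M X $ k else ?M X $ i)"
    by (rule det_row_add)
  also have "det (\<chi> i. if i = k then t *s axis k 1 else ?M X $ i) = t * det (\<chi> i. if i = k then axis k 1 else ?M X $ i)"
    by (rule det_row_mul)
  also have "det (\<chi> i. if i = k then axis k 1 else ?M X $ i) = det_on S X"
    unfolding det_on_def using assms by (intro det_cong_unit_row[of _ k]) (auto simp: axis_def vec_eq_iff)
  also have "(\<chi> i. if i = k then ?M X $ k else ?M X $ i) = ?M X" by (simp add: vec_eq_iff)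
  finally show ?thesis by (simp add: det_on_def)
qed

text \<open>By translation invariance the integral may be averaged over shifts of the single entry \<open>(k,k)\<close>,
  on which the determinant depends affinely with slope the complementary minor.\<close>

lemma nn_integral_det_on_powr_finite:
  assumes q: "-1 < q" "q < 0" and "finite S" "c > 0"
  shows "(\<integral>\<^sup>+X. sing_powr q (det_on S X) * ennreal (exp (- c * (X \<bullet> X))) \<partial>(lborel :: (real^'n^'n) measure)) < \<infinity>"
  using \<open>finite S\<close> \<open>c > 0\<close>
proof (induction S arbitrary: c)
  case empty
  have "det_on {} X = 1" for X :: "real^'n^'n"
  proof -
    have "(\<chi> i j. if i \<in> {} \<and> j \<in> {} then X $ i $ j else of_bool (i = j)) = mat 1"
      by (auto simp: vec_eq_iff mat_def)
    then show ?thesis by (simp add: det_on_def)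
  qed
  then show ?case using nn_integral_exp_neg_inner[OF empty, where 'a="real^'n^'n"] by (simp add: sing_powr_def)
next
  case (insert k S)
  obtain C where C: "C < \<infinity>" "\<And>\<alpha> \<beta>. (\<integral>\<^sup>+t. indicator {0..1} t * sing_powr q (t * \<alpha> + \<beta>) \<partial>lborel) \<le> C * sing_powr q \<alpha>"
    using nn_integral_sing_powr_affine_le[OF q] by blast
  let ?E = "axis k (axis k 1) :: real^'n^'n"
  let ?D = "det_on (insert k S) :: real^'n^'n \<Rightarrow> real"
  let ?H = "\<lambda>X::real^'n^'n. sing_powr q (?D X) * ennreal (exp (- c * (X \<bullet> X)))"
  have shift: "(\<integral>\<^sup>+X. ?H X \<partial>lborel) = (\<integral>\<^sup>+X. ?H (X + t *\<^sub>R ?E) \<partial>lborel)" for t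
  proof -
    have "(\<integral>\<^sup>+X. ?H X \<partial>distr lborel borel ((+) (t *\<^sub>R ?E))) = (\<integral>\<^sup>+X. ?H (t *\<^sub>R ?E + X) \<partial>lborel)"
      by (rule nn_integral_distr) measurable
    then show ?thesis by (simp add: lborel_distr_plus add.commute)
  qed
  \<comment> \<open>The shift costs a constant factor and half of the decay rate, which is why the
    induction is over all rates \<open>c\<close>.\<close>
  have bd: "exp (- c * ((X + t *\<^sub>R ?E) \<bullet> (X + t *\<^sub>R ?E))) \<le> exp c * exp (- (c/2) * (X \<bullet> X))" if "t \<in> {0..1}" for t and X :: "real^'n^'n"
  proof -
    let ?Y = "X + t *\<^sub>R ?E"
    have par: "(Y - Z) \<bullet> (Y - Z) \<le> 2 * (Y \<bullet> Y) + 2 * (Z \<bullet> Z)" for Y Z :: "real^'n^'n"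
      using inner_ge_zero[of "Y + Z"]
      by (simp add: inner_diff_left inner_diff_right inner_add_left inner_add_right inner_commute)
    have "X \<bullet> X \<le> 2 * (?Y \<bullet> ?Y) + 2 * ((t *\<^sub>R ?E) \<bullet> (t *\<^sub>R ?E))" using par[of ?Y "t *\<^sub>R ?E"] by simp
    also have "(t *\<^sub>R ?E) \<bullet> (t *\<^sub>R ?E) = t\<^sup>2" by (simp add: inner_axis power2_eq_square)
    also have "t\<^sup>2 \<le> 1" using that by (simp add: power_le_one)
    finally have "X \<bullet> X \<le> 2 * (?Y \<bullet> ?Y) + 2" by simp
    then have "(c/2) * (X \<bullet> X) \<le> (c/2) * (2 * (?Y \<bullet> ?Y) + 2)" using insert.prems by (intro mult_left_mono) auto
    then show ?thesis by (simp add: exp_add[symmetric] algebra_simps)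
  qed
  have "(\<integral>\<^sup>+X. ?H X \<partial>lborel) = (\<integral>\<^sup>+t. indicator {0..1} t * (\<integral>\<^sup>+X. ?H X \<partial>lborel) \<partial>(lborel::real measure))"
    by (simp add: nn_integral_multc)
  also have "\<dots> = (\<integral>\<^sup>+t. (\<integral>\<^sup>+X. indicator {0..1} t * ?H (X + t *\<^sub>R ?E) \<partial>lborel) \<partial>(lborel::real measure))"
    by (intro nn_integral_cong, subst shift, subst nn_integral_cmult) simp_all
  also have "\<dots> = (\<integral>\<^sup>+X. (\<integral>\<^sup>+t. indicator {0..1} t * ?H (X + t *\<^sub>R ?E) \<partial>(lborel::real measure)) \<partial>lborel)"
    by (rule lborel_pair.Fubini') measurable
  also have "\<dots> \<le> (\<integral>\<^sup>+X. (\<integral>\<^sup>+t. indicator {0..1} t * sing_powr q (t * det_on S X + ?D X) * ennreal (exp c * exp (- (c/2) * (X \<bullet> X))) \<partial>(lborel::real measure)) \<partial>lborel)"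
    using bd by (intro nn_integral_mono) (auto simp: det_on_insert_diag[OF insert.hyps(2)] indicator_def intro!: mult_left_mono ennreal_leI)
  also have "\<dots> \<le> (\<integral>\<^sup>+X. C * sing_powr q (det_on S X) * ennreal (exp c * exp (- (c/2) * (X \<bullet> X))) \<partial>lborel)"
    by (intro nn_integral_mono) (auto simp: nn_integral_multc intro!: mult_right_mono C)
  also have "\<dots> = (C * ennreal (exp c)) * (\<integral>\<^sup>+X. sing_powr q (det_on S X) * ennreal (exp (- (c/2) * (X \<bullet> X))) \<partial>lborel)"
    by (subst nn_integral_cmult[symmetric]) (auto simp: ennreal_mult mult_ac intro!: nn_integral_cong)
  also have "\<dots> < \<infinity>"
    using C(1) insert.IH[of "c/2"] insert.prems by (simp add: ennreal_mult_less_top)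
  finally show ?case .
qed

text \<open>A crude polynomial bound, enough for the Gaussian factor to absorb nonnegative powers of
  the determinant.\<close>

lemma abs_det_le:
  fixes X :: "real^'n^'n"
  shows "\<bar>det X\<bar> \<le> fact CARD('n) * (1 + X \<bullet> X) ^ CARD('n)"
proof -
  have ent: "\<bar>X $ i $ j\<bar> \<le> 1 + X \<bullet> X" for i j
  proof -
    have "\<bar>X $ i $ j\<bar> \<le> norm X"
      using component_le_norm_cart[of "X $ i" j] Finite_Cartesian_Product.norm_nth_le[of X i] by linarith
    also have "\<dots> \<le> 1 + (norm X)\<^sup>2"
      using sum_squares_bound[of "norm X" 1] norm_ge_zero[of X] by (simp del: norm_ge_zero)
    finally show ?thesis by (simp add: dot_square_norm)
  qed
  have "\<bar>det X\<bar> \<le> (\<Sum>p | p permutes (UNIV::'n set). \<bar>of_int (sign p) * (\<Prod>i\<in>UNIV. X $ i $ p i)\<bar>)"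
    unfolding det_def by (rule sum_abs)
  also have "\<dots> \<le> (\<Sum>p | p permutes (UNIV::'n set). (1 + X \<bullet> X) ^ CARD('n))"
  proof (rule sum_mono)
    fix p :: "'n \<Rightarrow> 'n"
    have "\<bar>of_int (sign p) * (\<Prod>i\<in>UNIV. X $ i $ p i)\<bar> = (\<Prod>i\<in>UNIV. \<bar>X $ i $ p i\<bar>)"
      by (simp add: abs_mult abs_prod sign_def)
    also have "\<dots> \<le> (\<Prod>i\<in>(UNIV::'n set). 1 + X \<bullet> X)" using ent by (intro prod_mono) auto
    finally show "\<bar>of_int (sign p) * (\<Prod>i\<in>UNIV. X $ i $ p i)\<bar> \<le> (1 + X \<bullet> X) ^ CARD('n)" by simp
  qed
  also have "\<dots> = fact CARD('n) * (1 + X \<bullet> X) ^ CARD('n)"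
    by (simp add: card_permutations)
  finally show ?thesis .
qed

lemma nn_integral_det_powr_finite:
  assumes "q > -1"
  shows "(\<integral>\<^sup>+X. ennreal (\<bar>det X\<bar> powr q * exp (- (X \<bullet> X))) \<partial>(lborel :: (real^'n^'n) measure)) < \<infinity>"
proof (cases "q < 0")
  case True
  have "det_on UNIV X = det X" for X :: "real^'n^'n" by (simp add: det_on_def)
  then have "(\<integral>\<^sup>+X. ennreal (\<bar>det X\<bar> powr q * exp (- (X \<bullet> X))) \<partial>(lborel :: (real^'n^'n) measure))
     \<le> (\<integral>\<^sup>+X. sing_powr q (det_on UNIV X) * ennreal (exp (- 1 * (X \<bullet> X))) \<partial>(lborel :: (real^'n^'n) measure))"
    by (intro nn_integral_mono) (auto simp: sing_powr_def ennreal_mult)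
  also have "\<dots> < \<infinity>" using assms True by (intro nn_integral_det_on_powr_finite) auto
  finally show ?thesis .
next
  case False
  \<comment> \<open>\<open>r\<close> is the growth exponent of |det X|^q in terms of 1 + |X|^2, and
    \<open>e\<close> is small enough for \<open>e * r \<le> 1/2\<close>: then (1 + |X|^2)^r grows at
    most like exp (|X|^2 / 2), and half of the Gaussian decay is left.\<close>
  define r where "r = real CARD('n) * q"
  have r: "r \<ge> 0" using False by (simp add: r_def)
  define e where "e = 1 / (2 * (r + 1))"
  have e: "0 < e" "e \<le> 1" "e * r \<le> 1/2" using r by (auto simp: e_def field_simps)
  define D where "D = fact CARD('n) powr q * (1/e) powr r"
  have bd: "\<bar>det X\<bar> powr q * exp (- (X \<bullet> X)) \<le> D * exp (- (1/2) * (X \<bullet> X))" for X :: "real^'n^'n"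
  proof -
    let ?w = "X \<bullet> X"
    have "\<bar>det X\<bar> powr q \<le> (fact CARD('n) * (1 + ?w) ^ CARD('n)) powr q"
      using False abs_det_le[of X] by (intro powr_mono2) auto
    also have "\<dots> = fact CARD('n) powr q * (1 + ?w) powr r"
      by (simp add: powr_mult r_def powr_powr[symmetric] powr_realpow add_pos_nonneg)
    also have "(1 + ?w) powr r \<le> ((1/e) * exp (e * ?w)) powr r"
    proof (rule powr_mono2)
      have "e * (1 + ?w) \<le> 1 + e * ?w" using e by (simp add: distrib_left)
      also have "\<dots> \<le> exp (e * ?w)" by (rule exp_ge_add_one_self)
      finally show "1 + ?w \<le> (1/e) * exp (e * ?w)" using e by (simp add: field_simps)
    qed (use r in auto)
    also have "\<dots> = (1/e) powr r * exp (e * r * ?w)"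
      using e by (subst powr_mult) (auto simp: exp_powr_real mult_ac)
    also have "exp (e * r * ?w) \<le> exp (1/2 * ?w)" using e mult_right_mono[OF e(3), of ?w] by simp
    finally have "\<bar>det X\<bar> powr q \<le> D * exp (1/2 * ?w)"
      by (simp add: D_def mult_left_mono mult.assoc)
    then have "\<bar>det X\<bar> powr q * exp (- ?w) \<le> D * exp (1/2 * ?w) * exp (- ?w)" by (intro mult_right_mono) auto
    also have "\<dots> = D * exp (- (1/2) * ?w)" by (simp add: mult.assoc exp_add[symmetric])
    finally show ?thesis .
  qed
  have "(\<integral>\<^sup>+X. ennreal (\<bar>det X\<bar> powr q * exp (- (X \<bullet> X))) \<partial>(lborel :: (real^'n^'n) measure))
     \<le> (\<integral>\<^sup>+X. ennreal D * ennreal (exp (- (1/2) * (X \<bullet> X))) \<partial>(lborel :: (real^'n^'n) measure))"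
    using bd by (intro nn_integral_mono) (auto simp: ennreal_mult''[symmetric] intro!: ennreal_leI)
  also have "\<dots> = ennreal D * ennreal (sqrt (pi / (1/2)) ^ DIM(real^'n^'n))"
    by (subst nn_integral_cmult) (simp_all only: nn_integral_exp_neg_inner[of "1/2"], auto)
  also have "\<dots> < \<infinity>" by (simp add: ennreal_mult_less_top)
  finally show ?thesis .
qed

subsection \<open>The Laplace transform determines the measure\<close>

lemma measurable_if_sets_eq: "f \<in> measurable L' N \<Longrightarrow> sets L = sets L' \<Longrightarrow> f \<in> measurable L N"
  by (simp cong: measurable_cong_sets)

text \<open>Both laws live on the compact set \<open>K\<close>, so uniform approximation by
  polynomials on \<open>K\<close> controls both integrals of \<open>f\<close>.\<close>

lemma integral_eq_if_polynomial_integrals_eq: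
  fixes M N :: "'a::euclidean_space measure"
  assumes M: "prob_space M" "sets M = sets borel" "AE x in M. x \<in> K"
    and N: "prob_space N" "sets N = sets borel" "AE x in N. x \<in> K"
    and K: "compact K"
    and eq: "\<And>g. real_polynomial_function g \<Longrightarrow> (LINT x|M. g x) = (LINT x|N. g x)"
    and f: "continuous_on UNIV (f :: 'a \<Rightarrow> real)"
  shows "(LINT x|M. f x) = (LINT x|N. f x)"
proof -
  have int: "integrable L h" if L: "prob_space L" "sets L = sets borel" "AE x in L. x \<in> K" and h: "continuous_on UNIV h"
    for L :: "'a measure" and h :: "'a \<Rightarrow> real"
  proof -
    interpret prob_space L by fact
    have "compact (h ` K)" using K h by (intro compact_continuous_image) (auto intro: continuous_on_subset)
    then obtain B where B: "\<And>x. x \<in> K \<Longrightarrow> norm (h x) \<le> B"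
      by (meson bounded_iff compact_imp_bounded imageI)
    have "h \<in> borel_measurable L"
      by (rule measurable_if_sets_eq[OF borel_measurable_continuous_onI[OF h] L(2)])
    then show ?thesis using L(3) B by (intro integrable_const_bound[of _ B]) auto
  qed
  have close: "\<bar>(LINT x|L. f x) - (LINT x|L. g x)\<bar> \<le> e"
    if L: "prob_space L" "sets L = sets borel" "AE x in L. x \<in> K" and g: "continuous_on UNIV g"
      and fg: "\<And>x. x \<in> K \<Longrightarrow> \<bar>f x - g x\<bar> < e" for L :: "'a measure" and g e
  proof -
    interpret prob_space L by fact
    have i: "integrable L f" "integrable L g" using int[OF L] f g by auto
    have "(LINT x|L. f x - g x) \<le> e"
      using L(3) i by (intro integral_le_const) (auto elim!: eventually_mono dest!: fg simp: abs_less_iff)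
    moreover have "(LINT x|L. f x - g x) \<ge> - e"
      using L(3) i by (intro integral_ge_const) (auto elim!: eventually_mono dest!: fg simp: abs_less_iff)
    ultimately show ?thesis using i by auto
  qed
  have "\<bar>(LINT x|M. f x) - (LINT x|N. f x)\<bar> \<le> e" if "e > 0" for e
  proof -
    obtain g where g: "real_polynomial_function g" and fg: "\<And>x. x \<in> K \<Longrightarrow> \<bar>f x - g x\<bar> < e / 2"
      by (rule Stone_Weierstrass_real_polynomial_function[OF K continuous_on_subset[OF f subset_UNIV], of "e / 2"])
         (use \<open>e > 0\<close> in auto)
    have gc: "continuous_on UNIV g" using g by (intro continuous_at_imp_continuous_on ballI continuous_real_polymonial_function)
    show ?thesis using close[OF M gc fg] close[OF N gc fg] eq[OF g] by linarith
  qed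
  then have "\<bar>(LINT x|M. f x) - (LINT x|N. f x)\<bar> \<le> 0" by (rule dense_ge)
  then show ?thesis by simp
qed

text \<open>Closed sets generate the Borel sets and are stable under intersection, and their
  indicators are limits of bounded continuous functions of the distance.\<close>

lemma measure_eqI_polynomial_integrals:
  fixes M N :: "'a::euclidean_space measure"
  assumes M: "prob_space M" "sets M = sets borel" "AE x in M. x \<in> K"
    and N: "prob_space N" "sets N = sets borel" "AE x in N. x \<in> K"
    and K: "compact K"
    and eq: "\<And>g. real_polynomial_function g \<Longrightarrow> (LINT x|M. g x) = (LINT x|N. g x)"
  shows "M = N"
proof -
  interpret M: prob_space M by fact
  interpret N: prob_space N by fact
  have closed: "emeasure M C = emeasure N C" if C: "closed C" for C
  \<comment> \<open>\<open>infdist\<close> to the empty set is 0 by convention, so for it the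
    functions below would equal 1 instead of tending to the indicator.\<close>
  proof (cases "C = {}")
    case False
    define f where "f k x = max 0 (1 - real k * infdist x C)" for k x
    have f_bound: "\<bar>f k x\<bar> \<le> 1" for k x
      by (simp add: f_def infdist_nonneg)
    have cont: "continuous_on UNIV (f k)" for k
      unfolding f_def by (intro continuous_intros)
    have lim: "(\<lambda>k. f k x) \<longlonglongrightarrow> indicator C x" for x
    proof (cases "x \<in> C")
      case True
      then show ?thesis by (simp add: f_def)
    next
      case x: False
      then have pos: "infdist x C > 0"
        using C False by (metis in_closed_iff_infdist_zero infdist_nonneg less_eq_real_def)
      obtain m where m: "1 / infdist x C < real m" using reals_Archimedean2 by blast
      have "f k x = 0" if "k \<ge> m" for k
      proof -
        have "1 < real m * infdist x C" using m pos by (simp add: field_simps)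
        also have "\<dots> \<le> real k * infdist x C" using that pos by (intro mult_right_mono) auto
        finally show ?thesis by (simp add: f_def)
      qed
      then have "eventually (\<lambda>k. f k x = 0) sequentially" by (auto simp: eventually_sequentially)
      then show ?thesis using x by (simp add: tendsto_eventually)
    qed
    have conv: "(\<lambda>k. LINT x|L. f k x) \<longlonglongrightarrow> measure L C" if L: "prob_space L" "sets L = sets borel" for L :: "'a measure"
    proof -
      interpret prob_space L by fact
      have [measurable]: "f k \<in> borel_measurable L" for k
        by (rule measurable_if_sets_eq[OF borel_measurable_continuous_onI[OF cont] L(2)])
      have CL: "C \<in> sets L" using C L by simp
      have "(\<lambda>k. LINT x|L. f k x) \<longlonglongrightarrow> (LINT x|L. indicator C x)"
        by (rule integral_dominated_convergence[where w="\<lambda>_. 1"])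
           (use CL lim in \<open>auto simp: f_bound\<close>)
      then show ?thesis using CL sets.sets_into_space[OF CL] by (simp add: Int_absorb2)
    qed
    have "(LINT x|M. f k x) = (LINT x|N. f k x)" for k
      by (rule integral_eq_if_polynomial_integrals_eq[OF M N K eq cont])
    then have "measure M C = measure N C"
      using conv[OF M(1,2)] conv[OF N(1,2)] by (simp add: LIMSEQ_unique)
    then show ?thesis by (simp add: M.emeasure_eq_measure N.emeasure_eq_measure)
  qed simp
  show ?thesis
  proof (rule measure_eqI_generator_eq[where E="Collect closed" and \<Omega>=UNIV and A="\<lambda>_. UNIV"])
    show "Int_stable (Collect closed :: 'a set set)" by (auto simp: Int_stable_def)
    show "sets M = sigma_sets UNIV (Collect closed)" "sets N = sigma_sets UNIV (Collect closed)"
      unfolding M N by (subst borel_eq_closed, simp)+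
  qed (use closed in auto)
qed

section \<open>Exponentials on the cone as test functions\<close>

lemma pos_def_factor:
  fixes s :: "real^'n^'n"
  assumes "s \<in> pos_def_matrices"
  obtains A :: "real^'n^'n" where "s = A ** transpose A"
proof -
  obtain A :: "real^'n^'n" where A: "transpose A ** matrix_inv s ** A = mat 1"
    using pos_def_diagonalize[OF pos_def_inv(1)[OF assms]] .
  have "matrix_inv (matrix_inv s) = s"
    by (rule matrix_inv_unique) (rule pos_def_inv[OF assms])
  then have "s = A ** transpose A" using diagonalize_inverse(1)[OF A] by simp
  then show ?thesis by (rule that)
qed

text \<open>Cyclicity of the trace gives a sum of values of the quadratic form of \<open>u\<close>
  on the columns of \<open>A\<close>. This keeps \<open>exp (- trace (s ** u))\<close> within
  [0, 1], hence integrable for any probability on the cone.\<close>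

lemma trace_pos_def_nonneg:
  fixes s u :: "real^'n^'n"
  assumes s: "s \<in> pos_def_matrices" and u: "u \<in> pos_def_matrices"
  shows "trace (s ** u) \<ge> 0"
proof -
  obtain A :: "real^'n^'n" where A: "s = A ** transpose A" using pos_def_factor[OF s] .
  have "x \<bullet> (u *v x) \<ge> 0" for x using u by (cases "x = 0") (auto simp: pos_def_matrices_def less_imp_le)
  then have "trace (transpose A ** u ** A) \<ge> 0"
    unfolding trace_def by (intro sum_nonneg) (simp add: mult_matrix_transpose_component)
  also have "trace (transpose A ** u ** A) = trace (s ** u)"
    unfolding A by (metis trace_mul_sym matrix_mul_assoc)
  finally show ?thesis .
qed

text \<open>The span of the functions whose integrals are values of the Laplace transform. The
  parameter 0, which is not in the cone, is added for the constants; for it, total mass one replaces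
  the transform.\<close>

inductive exp_poly :: "(real^'n^'n \<Rightarrow> real) \<Rightarrow> bool" where
  exp: "s \<in> insert 0 pos_def_matrices \<Longrightarrow> exp_poly (\<lambda>u. exp (- trace (s ** u)))"
| add: "exp_poly f \<Longrightarrow> exp_poly g \<Longrightarrow> exp_poly (\<lambda>u. f u + g u)"
| scale: "exp_poly f \<Longrightarrow> exp_poly (\<lambda>u. c * f u)"

lemma exp_poly_const: "exp_poly (\<lambda>u::real^'n^'n. c)"
proof -
  have "(0::real^'n^'n) ** u = 0" for u by (simp add: matrix_matrix_mult_def vec_eq_iff)
  then show ?thesis using exp_poly.scale[OF exp_poly.exp[of "0::real^'n^'n"], of c] by (simp add: trace_0[unfolded mat_0])
qed

lemma exp_poly_sum: "finite I \<Longrightarrow> (\<And>i. i \<in> I \<Longrightarrow> exp_poly (f i)) \<Longrightarrow> exp_poly (\<lambda>u. \<Sum>i\<in>I. f i u)"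
  by (induction I rule: finite_induct) (auto intro: exp_poly_const exp_poly.add)

text \<open>Exponents add under multiplication, and the cone together with 0 is closed under
  addition.\<close>

lemma exp_poly_mult:
  assumes "exp_poly f" "exp_poly g"
  shows "exp_poly (\<lambda>u. f u * g u)"
  using assms(1)
proof induction
  case (exp s)
  from assms(2) show ?case
  proof induction
    case (exp t)
    have "s + t \<in> insert 0 pos_def_matrices" using \<open>s \<in> _\<close> exp by (auto intro: pos_def_add)
    from exp_poly.exp[OF this] show ?case
      by (simp add: matrix_add_rdistrib trace_add exp_add[symmetric] algebra_simps)
  next
    case (add f g)
    then show ?case using exp_poly.add by (simp add: distrib_left)
  next
    case (scale f c)
    then show ?case using exp_poly.scale[OF scale.IH, of c] by (simp add: mult_ac)
  qed
next
  case (add f g)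
  then show ?case using exp_poly.add by (simp add: distrib_right)
next
  case (scale f c)
  then show ?case using exp_poly.scale[OF scale.IH, of c] by (simp add: mult_ac)
qed

lemma exp_poly_polynomial:
  fixes \<Phi> :: "real^'n^'n \<Rightarrow> 'a::euclidean_space"
  assumes "real_polynomial_function g" and \<Phi>: "\<And>b. b \<in> Basis \<Longrightarrow> exp_poly (\<lambda>u. \<Phi> u \<bullet> b)"
  shows "exp_poly (\<lambda>u. g (\<Phi> u))"
  using assms(1)
proof induction
  case (linear f)
  interpret bounded_linear f by fact
  have "f (\<Phi> u) = (\<Sum>b\<in>Basis. f b * (\<Phi> u \<bullet> b))" for u
    by (subst euclidean_representation[of "\<Phi> u", symmetric]) (simp add: sum scaleR mult.commute)
  then show ?case using \<Phi> by (auto intro!: exp_poly_sum exp_poly.scale)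
qed (auto intro: exp_poly_const exp_poly.add exp_poly_mult)

lemma trace_zero: "trace (0::real^'n^'n) = 0"
  by (simp add: trace_def)

text \<open>Integrability travels along in the induction, since additivity of the Bochner integral
  requires it.\<close>

lemma exp_poly_integral_eq:
  fixes M N :: "(real^'n^'n) measure"
  assumes M: "prob_space M" "space M = pos_def_matrices" "sets M = sets (restrict_space borel pos_def_matrices)"
    and N: "prob_space N" "space N = pos_def_matrices" "sets N = sets (restrict_space borel pos_def_matrices)"
    and eq: "\<And>s. s \<in> pos_def_matrices \<Longrightarrow> (LINT u|M. exp (- trace (s ** u))) = (LINT u|N. exp (- trace (s ** u)))"
    and f: "exp_poly f"
  shows "integrable M f \<and> integrable N f \<and> (LINT u|M. f u) = (LINT u|N. f u)"
  using f
proof induction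
  case (exp s)
  interpret M: prob_space M by fact
  interpret N: prob_space N by fact
  have "trace (s ** u) \<ge> 0" if "u \<in> pos_def_matrices" for u
    using exp that by (auto simp: trace_zero intro: trace_pos_def_nonneg)
  then have bd: "norm (exp (- trace (s ** u))) \<le> 1" if "u \<in> pos_def_matrices" for u using that by simp
  have "(\<lambda>u. exp (- trace (s ** u))) \<in> borel_measurable borel"
    unfolding trace_def matrix_matrix_mult_def
    by (intro borel_measurable_continuous_onI) (auto intro!: continuous_intros)
  then have "(\<lambda>u. exp (- trace (s ** u))) \<in> borel_measurable (restrict_space borel pos_def_matrices)"
    by (rule measurable_restrict_space1)
  then have "(\<lambda>u. exp (- trace (s ** u))) \<in> borel_measurable M" "(\<lambda>u. exp (- trace (s ** u))) \<in> borel_measurable N"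
    using measurable_if_sets_eq M(3) N(3) by blast+
  then have "integrable M (\<lambda>u. exp (- trace (s ** u)))" "integrable N (\<lambda>u. exp (- trace (s ** u)))"
    using bd M(2) N(2) by (auto intro!: M.integrable_const_bound[of _ 1] N.integrable_const_bound[of _ 1])
  moreover have "(LINT u|M. exp (- trace (s ** u))) = (LINT u|N. exp (- trace (s ** u)))"
  proof (cases "s = 0")
    case True
    then have "exp (- trace (s ** u)) = 1" for u by (simp add: trace_zero)
    then show ?thesis by (simp add: M.prob_space N.prob_space)
  qed (use exp eq in auto)
  ultimately show ?case by blast
qed auto

text \<open>Symmetrised coordinate matrices, moved into the cone by adding the identity because the
  transform is known only there. With weight 1/4 the quadratic form is |x|^2 + x_i x_j / 2, which
  stays positive for nonzero x.\<close>

definition sym_coord :: "'n \<Rightarrow> 'n \<Rightarrow> real^'n^'n" where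
  "sym_coord i j = mat 1 + (1/4) *\<^sub>R (axis i (axis j 1) + axis j (axis i 1))"

lemma axis_axis_mult_vec: "axis i (axis j 1) *v x = x $ j *\<^sub>R axis i (1::real)"
proof -
  have "(axis i (axis j 1) *v x) $ k = (x $ j *\<^sub>R axis i (1::real)) $ k" for k
    by (cases "k = i") (simp_all add: matrix_vector_mult_def axis_def[of i] axis_def[of j] if_distrib[of "\<lambda>x. x * _"] cong: if_cong)
  then show ?thesis by (simp add: vec_eq_iff)
qed

lemma sym_coord_pos_def: "sym_coord i j \<in> pos_def_matrices"
proof -
  have "transpose (sym_coord i j) = sym_coord i j"
    by (auto simp: sym_coord_def transpose_def vec_eq_iff mat_def axis_def)
  moreover have "x \<bullet> (sym_coord i j *v x) > 0" if "x \<noteq> 0" for x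
  proof -
    have "x \<bullet> (sym_coord i j *v x) = x \<bullet> x + (x $ i * x $ j) / 2"
      by (simp add: sym_coord_def matrix_vector_mult_add_rdistrib scaleR_matrix_vector_assoc[symmetric]
          axis_axis_mult_vec inner_add_right inner_axis)
    moreover have "\<bar>x $ i * x $ j\<bar> \<le> norm x * norm x"
      unfolding abs_mult by (intro mult_mono component_le_norm_cart) auto
    moreover have "norm x * norm x > 0" using that by simp
    ultimately show ?thesis by (simp add: dot_square_norm power2_eq_square abs_le_iff)
  qed
  ultimately show ?thesis by (simp add: pos_def_matrices_def sym_matrices_def)
qed

lemma sym_matrices_component: "u \<in> sym_matrices \<Longrightarrow> u $ i $ j = u $ j $ i"
  unfolding sym_matrices_def transpose_def by (metis (mono_tags, lifting) mem_Collect_eq vec_lambda_beta)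

lemma trace_sym_coord:
  fixes u :: "real^'n^'n"
  assumes "u \<in> sym_matrices"
  shows "trace (sym_coord i j ** u) = trace u + u $ i $ j / 2"
proof -
  have "(axis i (axis j 1) ** u) $ a $ b = (if a = i then u $ j $ b else 0)" for i j a b :: 'n
    by (cases "a = i") (simp_all add: matrix_matrix_mult_def axis_def[of i] axis_def[of j] if_distrib[of "\<lambda>x. x * _"] cong: if_cong)
  then have "trace (axis i (axis j 1) ** u) = u $ j $ i" for i j
    by (simp add: trace_def)
  moreover have "u $ j $ i = u $ i $ j"
    by (rule sym_matrices_component[OF assms])
  ultimately show ?thesis
    by (simp add: sym_coord_def matrix_add_rdistrib matrix_scaleR_left trace_add trace_scaleR)
qed

text \<open>The map \<open>\<Phi>\<close> below embeds the cone measurably into a compact set, where the monomials pull back to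
  exponentials \<open>exp (- tr (s u))\<close>; Stone--Weierstrass then applies.\<close>

lemma is_wishart_unique:
  fixes M N :: "(real^'n^'n) measure"
  assumes "is_wishart p \<sigma> M" "is_wishart p \<sigma> N"
  shows "M = N"
proof -
  have M: "prob_space M" "space M = pos_def_matrices" "sets M = sets (restrict_space borel pos_def_matrices)"
    and N: "prob_space N" "space N = pos_def_matrices" "sets N = sets (restrict_space borel pos_def_matrices)"
    and eq: "\<And>s. s \<in> pos_def_matrices \<Longrightarrow> (LINT u|M. exp (- trace (s ** u))) = (LINT u|N. exp (- trace (s ** u)))"
    using assms by (auto simp: is_wishart_def)
  define \<Phi> where "\<Phi> u = (\<chi> i j. exp (- trace (sym_coord i j ** u)))" for u :: "real^'n^'n"
  \<comment> \<open>\<open>\<Psi>\<close> recovers \<open>u\<close> from \<open>\<Phi> u\<close>: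
    minus the logarithm of an entry is tr u + u_ij / 2, and on the diagonal these add up to (n +
    1/2) tr u, which yields the trace to be subtracted.\<close>
  define \<Psi> where "\<Psi> y = (\<chi> i j. 2 * (- ln (y $ i $ j) + (\<Sum>k\<in>UNIV. ln (y $ k $ k)) / (real CARD('n) + 1/2)))"
    for y :: "real^'n^'n"
  have \<Psi>\<Phi>: "\<Psi> (\<Phi> u) = u" if "u \<in> pos_def_matrices" for u
  proof -
    have u: "u \<in> sym_matrices" using that by (simp add: pos_def_matrices_def)
    have "(\<Sum>k\<in>UNIV. trace u + u $ k $ k / 2) = (real CARD('n) + 1/2) * trace u"
      by (simp add: sum.distrib trace_def sum_divide_distrib[symmetric] algebra_simps)
    then have s: "(\<Sum>k\<in>UNIV. ln (\<Phi> u $ k $ k)) / (real CARD('n) + 1/2) = - trace u"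
      by (simp add: \<Phi>_def trace_sym_coord[OF u] sum_negf[symmetric] field_simps)
         (simp add: sum_negf field_simps)
    show ?thesis unfolding \<Psi>_def s by (simp add: \<Phi>_def trace_sym_coord[OF u] vec_eq_iff)
  qed
  have \<Phi>m: "\<Phi> \<in> borel_measurable borel"
    unfolding \<Phi>_def trace_def matrix_matrix_mult_def
    by (intro borel_measurable_continuous_onI) (auto intro!: continuous_intros)
  have \<Psi>m: "\<Psi> \<in> borel_measurable borel"
  proof (subst borel_measurable_euclidean_space, intro ballI)
    fix b :: "real^'n^'n" assume "b \<in> Basis"
    then obtain i j where b: "b = axis i (axis j 1)" by (auto simp: Basis_vec_def)
    have [measurable]: "(\<lambda>y::real^'n^'n. y $ i $ j) \<in> borel_measurable borel" for i j
      by (intro borel_measurable_continuous_onI) (auto intro!: continuous_intros)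
    show "(\<lambda>y. \<Psi> y \<bullet> b) \<in> borel_measurable borel"
      unfolding b \<Psi>_def by (simp add: inner_axis)
  qed
  have \<Phi>_meas: "\<Phi> \<in> measurable L borel" if "sets L = sets (restrict_space borel pos_def_matrices)" for L
    by (rule measurable_if_sets_eq[OF measurable_restrict_space1[OF \<Phi>m] that])
  define K where "K = cbox (0::real^'n^'n) (\<chi> i j. 1)"
  have \<Phi>K: "\<Phi> u \<in> K" if "u \<in> pos_def_matrices" for u
    using trace_pos_def_nonneg[OF sym_coord_pos_def that]
    by (auto simp: K_def \<Phi>_def mem_box Basis_vec_def inner_axis)
  have ep: "exp_poly (\<lambda>u. \<Phi> u \<bullet> b)" if "b \<in> Basis" for b
    using that by (auto simp: Basis_vec_def \<Phi>_def inner_axis intro!: exp_poly.exp sym_coord_pos_def)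
  have "distr M borel \<Phi> = distr N borel \<Phi>"
  proof (rule measure_eqI_polynomial_integrals[where K=K])
    show "prob_space (distr M borel \<Phi>)" "prob_space (distr N borel \<Phi>)"
      using \<Phi>_meas M N by (auto intro: prob_space.prob_space_distr)
    show "AE x in distr M borel \<Phi>. x \<in> K" "AE x in distr N borel \<Phi>. x \<in> K"
      using \<Phi>_meas[OF M(3)] \<Phi>_meas[OF N(3)] \<Phi>K M(2) N(2)
      by (auto simp: AE_distr_iff K_def intro!: AE_I2)
    fix g :: "real^'n^'n \<Rightarrow> real" assume g: "real_polynomial_function g"
    have gm: "g \<in> borel_measurable borel"
      using g by (intro borel_measurable_continuous_onI continuous_at_imp_continuous_on ballI continuous_real_polymonial_function)
    show "(LINT x|distr M borel \<Phi>. g x) = (LINT x|distr N borel \<Phi>. g x)"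
      using exp_poly_integral_eq[OF M N eq exp_poly_polynomial[OF g ep]] gm \<Phi>_meas[OF M(3)] \<Phi>_meas[OF N(3)]
      by (simp add: integral_distr)
  qed (simp_all add: K_def)
  \<comment> \<open>Since \<open>\<Psi>\<close> is a measurable left inverse of
    \<open>\<Phi>\<close> on the cone, every event is the preimage under \<open>\<Phi>\<close> of a
    Borel set, and equality of the image laws descends to \<open>M\<close> and
    \<open>N\<close>.\<close>
  moreover have "emeasure L A = emeasure (distr L borel \<Phi>) (\<Psi> -` B)"
    if L: "space L = pos_def_matrices" "sets L = sets (restrict_space borel pos_def_matrices)"
      and A: "A = pos_def_matrices \<inter> B" and B: "B \<in> sets borel" for L A B
  proof -
    have "\<Psi> -` B \<in> sets borel" using measurable_sets[OF \<Psi>m B] by simp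
    moreover have "\<Phi> -` (\<Psi> -` B) \<inter> space L = A" using \<Psi>\<Phi> L A by auto
    ultimately show ?thesis using \<Phi>_meas[OF L(2)] by (simp add: emeasure_distr)
  qed
  note em = this
  show ?thesis
  proof (rule measure_eqI)
    show "sets M = sets N" using M N by simp
    fix A assume "A \<in> sets M"
    then obtain B where "B \<in> sets borel" "A = pos_def_matrices \<inter> B"
      using M(3) by (auto simp: sets_restrict_space)
    then show "emeasure M A = emeasure N A"
      using em[OF M(2,3)] em[OF N(2,3)] calculation by simp
  qed
qed

subsection \<open>The gradient of the log-likelihood\<close>

text \<open>Differentiating the Leibniz sum replaces one factor by an entry of \<open>h\<close>. A
  permutation other than the identity moves at least two indices, so an off-diagonal zero of
  \<open>mat 1\<close> always remains among the other factors.\<close>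

lemma has_derivative_det_mat_1:
  "((det :: real^'n^'n \<Rightarrow> real) has_derivative trace) (at (mat 1))"
proof -
  have "((det :: real^'n^'n \<Rightarrow> real) has_derivative
     (\<lambda>h. \<Sum>p | p permutes (UNIV::'n set). of_int (sign p) *
        (\<Sum>i\<in>UNIV. h $ i $ p i * (\<Prod>j\<in>UNIV - {i}. mat 1 $ j $ p j)))) (at (mat 1))"
    unfolding det_def[abs_def]
    by (auto intro!: derivative_eq_intros has_derivative_prod bounded_linear_imp_has_derivative
       bounded_linear_compose[OF bounded_linear_vec_nth bounded_linear_vec_nth] simp: sum_distrib_left)
  moreover have "(\<Sum>p | p permutes (UNIV::'n set). of_int (sign p) *
        (\<Sum>i\<in>UNIV. h $ i $ p i * (\<Prod>j\<in>UNIV - {i}. mat 1 $ j $ p j))) = trace h" for h :: "real^'n^'n"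
  proof -
    have *: "of_int (sign p) * (\<Sum>i\<in>UNIV. h $ i $ p i * (\<Prod>j\<in>UNIV - {i}. mat 1 $ j $ p j)) = (if p = id then trace h else 0)"
      if p: "p permutes (UNIV::'n set)" for p
    proof (cases "p = id")
      case True
      then show ?thesis by (simp add: trace_def mat_def)
    next
      case False
      have "(\<Prod>j\<in>UNIV - {i}. mat 1 $ j $ p j) = (0::real)" for i
      proof -
        have "\<exists>j. j \<noteq> i \<and> p j \<noteq> j"
        proof (rule ccontr)
          assume "\<not> ?thesis"
          then have fp: "\<And>j. j \<noteq> i \<Longrightarrow> p j = j" by blast
          have "p i = i" using fp permutes_inj[OF p] by (metis injD)
          then have "p = id" using fp by (metis eq_id_iff)
          with False show False by simp
        qed
        then obtain j where "j \<noteq> i" "p j \<noteq> j" by blast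
        then show ?thesis by (intro prod_zero bexI[of _ j]) (auto simp: mat_def)
      qed
      then show ?thesis using False by (simp del: prod_zero_iff)
    qed
    have "(\<Sum>p | p permutes (UNIV::'n set). of_int (sign p) *
        (\<Sum>i\<in>UNIV. h $ i $ p i * (\<Prod>j\<in>UNIV - {i}. mat 1 $ j $ p j))) = (\<Sum>p | p permutes (UNIV::'n set). if p = id then trace h else 0)"
      by (rule sum.cong[OF refl], rule *) simp
    also have "\<dots> = trace h" by (simp add: permutes_id)
    finally show ?thesis .
  qed
  ultimately show ?thesis by simp
qed

lemma bounded_linear_matrix_mult_left: "bounded_linear (\<lambda>X::real^'n^'k. A ** X)"
  by (auto intro!: linear_conv_bounded_linear[THEN iffD1] linearI simp: matrix_add_ldistrib matrix_scaleR_right)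

text \<open>Jacobi's formula, transported from the identity matrix by det X = det \<sigma> * det
  (\<sigma>^-1 X).\<close>

lemma has_derivative_det:
  fixes \<sigma> :: "real^'n^'n"
  assumes \<sigma>: "\<sigma> \<in> pos_def_matrices"
  shows "(det has_derivative (\<lambda>h. det \<sigma> * trace (matrix_inv \<sigma> ** h))) (at \<sigma> within S)"
proof -
  have "((\<lambda>X. matrix_inv \<sigma> ** X) has_derivative (\<lambda>h. matrix_inv \<sigma> ** h)) (at \<sigma> within S)"
    by (rule bounded_linear_imp_has_derivative[OF bounded_linear_matrix_mult_left])
  moreover have "(det has_derivative trace) (at (matrix_inv \<sigma> ** \<sigma>))"
    using has_derivative_det_mat_1 pos_def_inv(3)[OF \<sigma>] by simp
  ultimately have "((\<lambda>X. det (matrix_inv \<sigma> ** X)) has_derivative (\<lambda>h. trace (matrix_inv \<sigma> ** h))) (at \<sigma> within S)"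
    by (rule has_derivative_compose)
  from has_derivative_mult_right[OF this, of "det \<sigma>"]
  have "((\<lambda>X. det \<sigma> * det (matrix_inv \<sigma> ** X)) has_derivative (\<lambda>h. det \<sigma> * trace (matrix_inv \<sigma> ** h))) (at \<sigma> within S)" .
  moreover have "det \<sigma> * det (matrix_inv \<sigma> ** X) = det X" for X
    using arg_cong[OF pos_def_inv(2)[OF \<sigma>], of det] by (simp add: det_mul mult.assoc[symmetric])
  ultimately show ?thesis by simp
qed

text \<open>The cone need not have interior points, so derivatives are compared along rays
  \<open>\<sigma> + t *\<^sub>R s\<close>, which stay in it: a one-sided derivative in one real
  variable is unique.\<close>

lemma has_derivative_within_pos_def_ray_unique:
  fixes F :: "real^'n^'n \<Rightarrow> real"
  assumes \<sigma>: "\<sigma> \<in> pos_def_matrices" and s: "s \<in> pos_def_matrices"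
    and D: "(F has_derivative D) (at \<sigma> within pos_def_matrices)"
    and D': "(F has_derivative D') (at \<sigma> within pos_def_matrices)"
  shows "D s = D' s"
proof -
  let ?r = "\<lambda>t::real. \<sigma> + t *\<^sub>R s"
  have scale: "t *\<^sub>R s \<in> pos_def_matrices" if "t > 0" for t
    using s that by (auto simp: pos_def_matrices_def sym_matrices_def transpose_scalar scaleR_matrix_vector_assoc[symmetric])
  have sub: "?r ` {0..} \<subseteq> pos_def_matrices"
  proof (rule image_subsetI)
    fix t :: real assume "t \<in> {0..}"
    then show "?r t \<in> pos_def_matrices"
      using \<sigma> scale by (cases "t = 0") (auto intro: pos_def_add)
  qed
  have ray: "((\<lambda>t. F (?r t)) has_vector_derivative E s) (at 0 within {0..})"
    if "(F has_derivative E) (at \<sigma> within pos_def_matrices)" for E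
  proof -
    interpret bounded_linear E using that by (rule has_derivative_bounded_linear)
    have "(?r has_derivative (\<lambda>t. t *\<^sub>R s)) (at 0 within {0..})"
      by (auto intro!: derivative_eq_intros)
    moreover have "(F has_derivative E) (at (?r 0) within ?r ` {0..})"
      using has_derivative_subset[OF that sub] by simp
    ultimately have "((\<lambda>t. F (?r t)) has_derivative (\<lambda>t. E (t *\<^sub>R s))) (at 0 within {0..})"
      by (rule has_derivative_in_compose)
    then show ?thesis by (simp add: has_vector_derivative_def scaleR)
  qed
  have "at (0::real) within {0..} \<noteq> bot"
    by (simp add: at_within_Ici_at_right)
  then show ?thesis
    using vector_derivative_unique_within ray[OF D] ray[OF D'] by blast
qed

lemma trace_self_eq_0:
  fixes u :: "real^'n^'n"
  assumes "u \<in> sym_matrices" "trace (u ** u) = 0"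
  shows "u = 0"
proof -
  have "trace (u ** u) = u \<bullet> u"
    using assms(1) by (simp add: trace_def matrix_matrix_mult_def inner_vec_def sym_matrices_component[of u])
  then show ?thesis using assms by simp
qed

text \<open>The difference \<open>d\<close> of two candidates is orthogonal to the cone by the ray
  argument. As the cone spans the symmetric matrices, \<open>d\<close> is orthogonal to itself and
  vanishes.\<close>

lemma sym_gradient_eqI:
  fixes g :: "real^'n^'n"
  assumes \<sigma>: "\<sigma> \<in> pos_def_matrices" and g: "g \<in> sym_matrices"
    and D: "(F has_derivative (\<lambda>h. trace (g ** h))) (at \<sigma> within pos_def_matrices)"
  shows "sym_gradient F \<sigma> = g"
  unfolding sym_gradient_def
proof (rule the_equality, use g D in blast)
  fix g' :: "real^'n^'n"
  assume g': "g' \<in> sym_matrices \<and> (F has_derivative (\<lambda>h. trace (g' ** h))) (at \<sigma> within pos_def_matrices)"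
  define d where "d = g' - g"
  have d: "d \<in> sym_matrices"
    using g g' by (simp add: d_def sym_matrices_def transpose_def vec_eq_iff)
  have ds: "trace (d ** s) = 0" if "s \<in> pos_def_matrices" for s
  proof -
    have "trace (g' ** s) = trace (g ** s)"
      using has_derivative_within_pos_def_ray_unique[OF \<sigma> that] g' D by blast
    moreover have "g' ** s = d ** s + g ** s" by (simp add: d_def matrix_add_rdistrib[symmetric])
    ultimately show ?thesis by (simp add: trace_add)
  qed
  \<comment> \<open>\<open>B\<close> bounds the operator norm of \<open>d\<close>, so
    \<open>(B + 1) *\<^sub>R mat 1 + d\<close> is positive definite and \<open>d\<close> is a
    difference of two elements of the cone.\<close>
  obtain B where B: "B > 0" "\<And>x. norm (d *v x) \<le> norm x * B"
    using bounded_linear.pos_bounded[OF matrix_vector_mul_bounded_linear[of d]] by blast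
  have one: "c *\<^sub>R mat 1 \<in> (pos_def_matrices :: (real^'n^'n) set)" if "c > 0" for c
    using that by (auto simp: pos_def_matrices_def sym_matrices_def transpose_scalar scaleR_matrix_vector_assoc[symmetric])
  have "(B + 1) *\<^sub>R mat 1 + d \<in> pos_def_matrices"
  proof -
    have "x \<bullet> (((B + 1) *\<^sub>R mat 1 + d) *v x) > 0" if "x \<noteq> 0" for x
    proof -
      have "\<bar>x \<bullet> (d *v x)\<bar> \<le> norm x * norm (d *v x)" by (rule Cauchy_Schwarz_ineq2)
      also have "\<dots> \<le> norm x * (norm x * B)" using B(2) by (intro mult_left_mono) auto
      finally have "\<bar>x \<bullet> (d *v x)\<bar> \<le> B * (x \<bullet> x)" by (simp add: dot_square_norm power2_eq_square mult_ac)
      moreover have "x \<bullet> x > 0" using that by simp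
      moreover have "x \<bullet> (((B + 1) *\<^sub>R mat 1 + d) *v x) = (B + 1) * (x \<bullet> x) + x \<bullet> (d *v x)"
        by (simp add: matrix_vector_mult_add_rdistrib scaleR_matrix_vector_assoc[symmetric] inner_add_right)
      ultimately show ?thesis unfolding abs_le_iff distrib_right by linarith
    qed
    then show ?thesis
      using d by (auto simp: pos_def_matrices_def sym_matrices_def transpose_def vec_eq_iff mat_def)
  qed
  from ds[OF this] ds[OF one[of "B + 1"]] B have "trace (d ** d) = 0"
    by (simp add: matrix_add_ldistrib trace_add)
  with d have "d = 0" by (rule trace_self_eq_0)
  then show "g' = g" by (simp add: d_def)
qed

text \<open>The density formula enters for all parameters in the cone, because the derivative at
  \<sigma> sees its neighbours. In the logarithm \<open>k\<close> is an additive constant and drops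
  out.\<close>

lemma sym_gradient_log_lik:
  fixes \<sigma> :: "real^'n^'n"
  assumes \<sigma>: "\<sigma> \<in> pos_def_matrices" and k: "k > 0"
    and f: "\<And>\<sigma>. \<sigma> \<in> pos_def_matrices \<Longrightarrow>
      mix_density p \<sigma> x = k * sqrt (det \<sigma>) * (1 + (x \<bullet> (\<sigma> *v x)) / 2) powr (- a)"
  shows "sym_gradient (log_lik p x) \<sigma> =
    (1/2) *\<^sub>R matrix_inv \<sigma> - (a / (2 * (1 + (x \<bullet> (\<sigma> *v x)) / 2))) *\<^sub>R outer x"
proof (rule sym_gradient_eqI[OF \<sigma>])
  let ?r = "\<lambda>\<sigma>::real^'n^'n. 1 + (x \<bullet> (\<sigma> *v x)) / 2"
  let ?g = "(1/2) *\<^sub>R matrix_inv \<sigma> - (a / (2 * ?r \<sigma>)) *\<^sub>R outer x"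
  have r: "?r \<tau> > 0" if "\<tau> \<in> pos_def_matrices" for \<tau>
    using that by (cases "x = 0") (auto simp: pos_def_matrices_def intro!: add_pos_pos)
  show "?g \<in> sym_matrices"
    using pos_def_inv(1)[OF \<sigma>] outer_sym[of x]
    by (simp add: pos_def_matrices_def sym_matrices_def transpose_def vec_eq_iff)
  have "(det has_derivative (\<lambda>h. det \<sigma> * trace (matrix_inv \<sigma> ** h))) (at \<sigma> within pos_def_matrices)"
    by (rule has_derivative_det[OF \<sigma>])
  moreover have "bounded_linear (\<lambda>h::real^'n^'n. h *v x)"
    by (auto intro!: linear_conv_bounded_linear[THEN iffD1] linearI
       simp: matrix_vector_mult_add_rdistrib scaleR_matrix_vector_assoc[symmetric])
  note bounded_linear_imp_has_derivative[OF this, of "at \<sigma> within pos_def_matrices"]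
  ultimately have "((\<lambda>\<tau>. ln k + ln (det \<tau>) / 2 - a * ln (?r \<tau>)) has_derivative
     (\<lambda>h. (det \<sigma> * trace (matrix_inv \<sigma> ** h)) / det \<sigma> / 2 - a * (((x \<bullet> (h *v x)) / 2) / ?r \<sigma>))) (at \<sigma> within pos_def_matrices)"
    using pos_def_det_pos[OF \<sigma>] r[OF \<sigma>]
    by (auto intro!: derivative_eq_intros simp: field_simps)
  also have "(\<lambda>h. (det \<sigma> * trace (matrix_inv \<sigma> ** h)) / det \<sigma> / 2 - a * (((x \<bullet> (h *v x)) / 2) / ?r \<sigma>)) = (\<lambda>h. trace (?g ** h))"
  proof
    fix h
    have "trace (outer x ** h) = x \<bullet> (h *v x)" by (metis trace_mul_sym trace_mult_outer)
    then show "(det \<sigma> * trace (matrix_inv \<sigma> ** h)) / det \<sigma> / 2 - a * (((x \<bullet> (h *v x)) / 2) / ?r \<sigma>) = trace (?g ** h)"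
      using pos_def_det_pos[OF \<sigma>]
      by (simp add: matrix_diff_rdistrib matrix_scaleR_left trace_sub trace_scaleR)
  qed
  finally have D: "((\<lambda>\<tau>. ln k + ln (det \<tau>) / 2 - a * ln (?r \<tau>)) has_derivative (\<lambda>h. trace (?g ** h))) (at \<sigma> within pos_def_matrices)" .
  have "log_lik p x \<tau> = ln k + ln (det \<tau>) / 2 - a * ln (?r \<tau>)" if "\<tau> \<in> pos_def_matrices" for \<tau>
  proof -
    have "log_lik p x \<tau> = ln (k * sqrt (det \<tau>)) + ln (?r \<tau> powr (- a))"
      unfolding log_lik_def f[OF that] using k r[OF that] pos_def_det_pos[OF that] by (intro ln_mult_pos) auto
    also have "\<dots> = ln k + ln (sqrt (det \<tau>)) - a * ln (?r \<tau>)"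
      using k r[OF that] pos_def_det_pos[OF that] by (simp add: ln_mult_pos ln_powr)
    finally show ?thesis using pos_def_det_pos[OF that] by (simp add: ln_sqrt)
  qed
  then show "(log_lik p x has_derivative (\<lambda>h. trace (?g ** h))) (at \<sigma> within pos_def_matrices)"
    by (intro has_derivative_transform[OF \<sigma> _ D]) auto
qed

subsection \<open>The Wishart distribution and the mixture density\<close>

definition gram_density :: "real \<Rightarrow> real^'n^'n \<Rightarrow> real^'n^'n \<Rightarrow> real" where
  "gram_density q s X = \<bar>det X\<bar> powr q * exp (- trace (s ** (transpose X ** X)))"

lemma trace_gram: "trace (transpose X ** X) = X \<bullet> (X :: real^'n^'n)"
  by (simp add: trace_def matrix_matrix_mult_def transpose_def inner_vec_def) (rule sum.swap)

lemma det_measurable[measurable]: "(det :: real^'n^'n \<Rightarrow> real) \<in> borel_measurable borel"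
  by (intro borel_measurable_continuous_onI continuous_on_det)

lemma gram_measurable[measurable]: "(\<lambda>X::real^'n^'n. transpose X ** X) \<in> borel_measurable borel"
  unfolding matrix_matrix_mult_def transpose_def
  by (intro borel_measurable_continuous_onI) (auto intro!: continuous_intros)

lemma trace_mult_measurable[measurable]: "(\<lambda>X::real^'n^'n. trace (s ** X)) \<in> borel_measurable borel"
  unfolding matrix_matrix_mult_def trace_def
  by (intro borel_measurable_continuous_onI) (auto intro!: continuous_intros)

lemma matrix_vector_mult_measurable[measurable]: "(\<lambda>X::real^'n^'n. X *v x) \<in> borel_measurable borel"
  unfolding matrix_vector_mult_def
  by (intro borel_measurable_continuous_onI) (auto intro!: continuous_intros)

lemma gram_density_measurable[measurable]: "gram_density q s \<in> borel_measurable borel"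
  unfolding gram_density_def by measurable

lemma gram_density_nonneg: "gram_density q s X \<ge> 0"
  by (simp add: gram_density_def)

text \<open>For q > -1 this is, up to a factor depending only on the order n, the multivariate Gamma
  function at (n + q) / 2. Only its finiteness and positivity are established; the value is never
  computed.\<close>

definition gram_const :: "'n::finite itself \<Rightarrow> real \<Rightarrow> real" where
  "gram_const _ q = enn2real (\<integral>\<^sup>+X. ennreal (\<bar>det X\<bar> powr q * exp (- (X \<bullet> X))) \<partial>(lborel :: (real^'n^'n) measure))"

lemma gram_const:
  assumes "q > -1"
  shows "(\<integral>\<^sup>+X. ennreal (\<bar>det X\<bar> powr q * exp (- (X \<bullet> X))) \<partial>(lborel :: (real^'n^'n) measure)) = ennreal (gram_const TYPE('n) q)"
    and "gram_const TYPE('n) q > 0"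
proof -
  let ?I = "\<integral>\<^sup>+X. ennreal (\<bar>det X\<bar> powr q * exp (- (X \<bullet> X))) \<partial>(lborel :: (real^'n^'n) measure)"
  have fin: "?I < \<infinity>" by (rule nn_integral_det_powr_finite[OF assms])
  then show "?I = ennreal (gram_const TYPE('n) q)" by (simp add: gram_const_def)
  have "?I \<noteq> 0"
  proof
    assume "?I = 0"
    then have "AE X in (lborel :: (real^'n^'n) measure). ennreal (\<bar>det X\<bar> powr q * exp (- (X \<bullet> X))) = 0"
      by (subst (asm) nn_integral_0_iff_AE) auto
    then have AE: "AE X in (lborel :: (real^'n^'n) measure). det X = 0"
      by eventually_elim (auto simp: ennreal_eq_0_iff mult_le_0_iff not_le)
    \<comment> \<open>The nonsingular matrices form a nonempty open set, which cannot be null, so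
      the integrand does not vanish almost everywhere.\<close>
    have "open {X :: real^'n^'n. det X \<noteq> 0}"
      using continuous_on_det by (intro open_Collect_neq) auto
    moreover have "mat 1 \<in> {X :: real^'n^'n. det X \<noteq> 0}" by simp
    ultimately have "\<not> {X :: real^'n^'n. det X \<noteq> 0} \<in> null_sets lborel"
      by (metis empty_iff open_not_negligible negligible_iff_null_sets null_sets_completionI)
    with AE show False
      using AE_iff_null_sets[of "{X :: real^'n^'n. det X \<noteq> 0}" lborel] by auto
  qed
  then show "gram_const TYPE('n) q > 0"
    using fin by (simp add: gram_const_def enn2real_positive_iff zero_less_iff_neq_zero less_top)
qed

text \<open>The substitution by the diagonalising \<open>A\<close> turns the exponent into |X|^2.
  The factor |det A| = (det s)^(-1/2) enters once per row through the Jacobian and to the power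
  \<open>q\<close> through the weight.\<close>

lemma nn_integral_gram_density:
  fixes s :: "real^'n^'n"
  assumes q: "q > -1" and s: "s \<in> pos_def_matrices"
  shows "(\<integral>\<^sup>+X. ennreal (gram_density q s X) \<partial>lborel) =
    ennreal (det s powr (- ((real CARD('n) + q) / 2)) * gram_const TYPE('n) q)"
proof -
  obtain A :: "real^'n^'n" where A: "transpose A ** s ** A = mat 1" using pos_def_diagonalize[OF s] .
  have dA: "det A \<noteq> 0" "det A ^ 2 * det s = 1" using diagonalize_det[OF A] by auto
  have "\<bar>det A\<bar> = det s powr (- (1/2))"
  proof -
    have "\<bar>det A\<bar> = sqrt (det A ^ 2)" by simp
    also have "det A ^ 2 = 1 / det s" using dA(2) pos_def_det_pos[OF s] by (simp add: field_simps)
    also have "sqrt (1 / det s) = det s powr (- (1/2))"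
      using pos_def_det_pos[OF s] by (simp add: real_sqrt_divide powr_minus powr_half_sqrt field_simps)
    finally show ?thesis .
  qed
  note absdet = this
  have "\<bar>det A\<bar> ^ CARD('n) * \<bar>det A\<bar> powr q = \<bar>det A\<bar> powr (real CARD('n) + q)"
    using dA(1) by (simp add: powr_realpow[symmetric] powr_add)
  also have "\<dots> = det s powr (- (1/2) * (real CARD('n) + q))" unfolding absdet powr_powr ..
  also have "- (1/2) * (real CARD('n) + q) = - ((real CARD('n) + q) / 2)" by simp
  finally have absA: "\<bar>det A\<bar> ^ CARD('n) * \<bar>det A\<bar> powr q = det s powr (- ((real CARD('n) + q) / 2))" .
  have dens: "gram_density q s (X ** transpose A) = \<bar>det A\<bar> powr q * (\<bar>det X\<bar> powr q * exp (- (X \<bullet> X)))" for X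
  proof -
    have "trace (s ** (transpose (X ** transpose A) ** (X ** transpose A))) = trace ((s ** A) ** (transpose X ** X ** transpose A))"
      by (simp add: matrix_transpose_mul matrix_mul_assoc)
    also have "\<dots> = trace ((transpose X ** X ** transpose A) ** (s ** A))" by (rule trace_mul_sym)
    also have "(transpose X ** X ** transpose A) ** (s ** A) = transpose X ** X ** (transpose A ** s ** A)"
      by (simp add: matrix_mul_assoc)
    also have "trace \<dots> = X \<bullet> X" by (simp add: A trace_gram)
    finally show ?thesis by (simp add: gram_density_def det_mul abs_mult powr_mult)
  qed
  have "(\<integral>\<^sup>+X. ennreal (gram_density q s X) \<partial>lborel)
      = ennreal (\<bar>det (transpose A)\<bar> ^ CARD('n)) * (\<integral>\<^sup>+X. ennreal (gram_density q s (X ** transpose A)) \<partial>lborel)"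
    by (rule nn_integral_lborel_matrix_mult[symmetric]) (use dA in auto)
  also have "\<dots> = ennreal (\<bar>det A\<bar> ^ CARD('n)) * (ennreal (\<bar>det A\<bar> powr q) * ennreal (gram_const TYPE('n) q))"
    unfolding dens by (simp add: ennreal_mult nn_integral_cmult gram_const(1)[OF q, symmetric])
  also have "\<dots> = ennreal (\<bar>det A\<bar> ^ CARD('n) * \<bar>det A\<bar> powr q * gram_const TYPE('n) q)"
    using gram_const(2)[OF q, where 'n='n] by (simp add: ennreal_mult mult.assoc)
  finally show ?thesis unfolding absA .
qed

text \<open>Singular X have to be sent somewhere into the cone. The choice \<open>mat 1\<close> is
  harmless because \<open>0 powr q = 0\<close> makes the density vanish there.\<close>

definition gram_wishart :: "real \<Rightarrow> real^'n^'n \<Rightarrow> (real^'n^'n) measure" where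
  "gram_wishart p \<sigma> =
    distr (density lborel (\<lambda>X. ennreal (gram_density (2 * p - real CARD('n)) (matrix_inv \<sigma>) X
          / (det (matrix_inv \<sigma>) powr (- p) * gram_const TYPE('n) (2 * p - real CARD('n))))))
      (restrict_space borel pos_def_matrices) (\<lambda>X. if det X = 0 then mat 1 else transpose X ** X)"

lemma nn_integral_gram_wishart:
  fixes \<sigma> :: "real^'n^'n"
  assumes G[measurable]: "G \<in> borel_measurable borel"
  shows "(\<integral>\<^sup>+u. G u \<partial>gram_wishart p \<sigma>) =
    (\<integral>\<^sup>+X. ennreal (gram_density (2 * p - real CARD('n)) (matrix_inv \<sigma>) X
          / (det (matrix_inv \<sigma>) powr (- p) * gram_const TYPE('n) (2 * p - real CARD('n)))) * G (transpose X ** X) \<partial>lborel)"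
proof -
  have [measurable]: "(\<lambda>X::real^'n^'n. if det X = 0 then mat 1 else transpose X ** X) \<in> measurable borel (restrict_space borel pos_def_matrices)"
    using gram_pos_def[of "mat 1 :: real^'n^'n"]
    by (intro measurable_restrict_space2) (auto intro: gram_pos_def)
  have [measurable]: "G \<in> borel_measurable (restrict_space borel pos_def_matrices)"
    by (rule measurable_restrict_space1) measurable
  show ?thesis
    unfolding gram_wishart_def
    by (subst nn_integral_distr, simp, simp, subst nn_integral_density)
       (auto intro!: nn_integral_cong simp: gram_density_def)
qed

text \<open>The factor exp (- tr (t u)) replaces the parameter \<open>matrix_inv \<sigma>\<close> by
  \<open>matrix_inv \<sigma> + t\<close>, so the transform is a quotient of two normalising
  integrals, and \<open>\<sigma> ** (matrix_inv \<sigma> + t) = mat 1 + \<sigma> **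
  t\<close>.\<close>

lemma is_wishart_gram_wishart:
  fixes \<sigma> :: "real^'n^'n"
  assumes p: "p > (real CARD('n) - 1) / 2" and \<sigma>: "\<sigma> \<in> pos_def_matrices"
  shows "is_wishart p \<sigma> (gram_wishart p \<sigma>)"
proof -
  let ?q = "2 * p - real CARD('n)" and ?s = "matrix_inv \<sigma>"
  \<comment> \<open>This is where the lower bound on \<open>p\<close> enters.\<close>
  have q: "?q > -1" using p by (simp add: field_simps)
  have qn: "(real CARD('n) + ?q) / 2 = p" by simp
  note s = pos_def_inv(1)[OF \<sigma>]
  let ?c = "det ?s powr (- p) * gram_const TYPE('n) ?q"
  have c: "?c > 0" using pos_def_det_pos[OF s] gram_const(2)[OF q, where 'n='n] by simp
  have sp: "space (gram_wishart p \<sigma>) = pos_def_matrices"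
    and st: "sets (gram_wishart p \<sigma>) = sets (restrict_space borel pos_def_matrices)"
    by (simp_all add: gram_wishart_def space_restrict_space)
  have "(\<integral>\<^sup>+u. 1 \<partial>gram_wishart p \<sigma>) = (\<integral>\<^sup>+X. ennreal (gram_density ?q ?s X) / ennreal ?c \<partial>lborel)"
    by (subst nn_integral_gram_wishart) (use c in \<open>simp_all add: divide_ennreal gram_density_nonneg\<close>)
  also have "\<dots> = (\<integral>\<^sup>+X. ennreal (gram_density ?q ?s X) \<partial>lborel) / ennreal ?c"
    by (rule nn_integral_divide) measurable
  also have "\<dots> = 1"
    unfolding nn_integral_gram_density[OF q s] qn
    using c pos_def_det_pos[OF s] gram_const(2)[OF q, where 'n='n] by (simp add: divide_ennreal)
  finally have "prob_space (gram_wishart p \<sigma>)"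
    by (intro prob_spaceI) simp
  moreover have "(LINT u|gram_wishart p \<sigma>. exp (- trace (t ** u))) = det (mat 1 + \<sigma> ** t) powr (- p)"
    if t: "t \<in> pos_def_matrices" for t
  proof -
    have st': "?s + t \<in> pos_def_matrices" using s t by (rule pos_def_add)
    have "(\<integral>\<^sup>+u. ennreal (exp (- trace (t ** u))) \<partial>gram_wishart p \<sigma>) = (\<integral>\<^sup>+X. ennreal (gram_density ?q (?s + t) X) / ennreal ?c \<partial>lborel)"
    proof -
      have "gram_density ?q ?s X / ?c * exp (- trace (t ** (transpose X ** X))) = gram_density ?q (?s + t) X / ?c" for X
        by (simp add: gram_density_def matrix_add_rdistrib trace_add mult_exp_exp)
      then show ?thesis
        using c by (subst nn_integral_gram_wishart)
          (auto intro!: nn_integral_cong simp: divide_ennreal gram_density_nonneg ennreal_mult''[symmetric]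
            simp del: times_divide_eq_left)
    qed
    also have "\<dots> = (\<integral>\<^sup>+X. ennreal (gram_density ?q (?s + t) X) \<partial>lborel) / ennreal ?c"
      by (rule nn_integral_divide) measurable
    also have "\<dots> = ennreal (det (?s + t) powr (- p) * gram_const TYPE('n) ?q / ?c)"
      unfolding nn_integral_gram_density[OF q st'] qn using c gram_const(2)[OF q, where 'n='n] by (simp add: divide_ennreal)
    also have "det (?s + t) powr (- p) * gram_const TYPE('n) ?q / ?c = (det (?s + t) / det ?s) powr (- p)"
      using gram_const(2)[OF q, where 'n='n] pos_def_det_pos[OF s] pos_def_det_pos[OF st'] by (simp add: powr_divide)
    also have "det (?s + t) / det ?s = det (mat 1 + \<sigma> ** t)"
    proof -
      have "mat 1 + \<sigma> ** t = \<sigma> ** (?s + t)" by (simp add: matrix_add_ldistrib pos_def_inv[OF \<sigma>])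
      moreover have "det \<sigma> * det ?s = 1" using arg_cong[OF pos_def_inv(2)[OF \<sigma>], of det] by (simp add: det_mul)
      ultimately show ?thesis using pos_def_det_pos[OF s] by (simp add: det_mul field_simps)
    qed
    finally have I: "(\<integral>\<^sup>+u. ennreal (exp (- trace (t ** u))) \<partial>gram_wishart p \<sigma>) = ennreal (det (mat 1 + \<sigma> ** t) powr (- p))" .
    have "(\<lambda>u. exp (- trace (t ** u))) \<in> borel_measurable (gram_wishart p \<sigma>)"
      by (rule measurable_if_sets_eq[OF measurable_restrict_space1 st]) measurable
    then show ?thesis
      using I by (intro integral_eq_nn_integral[THEN trans]) auto
  qed
  ultimately show ?thesis using sp st by (simp add: is_wishart_def)
qed

lemma wishart_eq_gram_wishart:
  fixes \<sigma> :: "real^'n^'n"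
  assumes "p > (real CARD('n) - 1) / 2" "\<sigma> \<in> pos_def_matrices"
  shows "wishart p \<sigma> = gram_wishart p \<sigma>"
  unfolding wishart_def using is_wishart_gram_wishart[OF assms] is_wishart_unique by blast

text \<open>Since x^T u x = tr (x x^T u), the Gaussian factor shifts the parameter by
  \<open>(1/2) *\<^sub>R outer x\<close>. The shift is only semidefinite, but its sum with
  \<open>matrix_inv \<sigma>\<close> lies in the cone, and the rank-one determinant formula
  evaluates the result.\<close>

lemma nn_integral_wishart_kernel:
  fixes \<sigma> :: "real^'n^'n"
  assumes p: "p > (real CARD('n) - 1) / 2" and \<sigma>: "\<sigma> \<in> pos_def_matrices"
  shows "(\<integral>\<^sup>+u. ennreal (exp (- (x \<bullet> (u *v x)) / 2) * sqrt (det u)) \<partial>gram_wishart p \<sigma>) =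
    ennreal (gram_const TYPE('n) (2 * p - real CARD('n) + 1) / gram_const TYPE('n) (2 * p - real CARD('n))
      * sqrt (det \<sigma>) * (1 + (x \<bullet> (\<sigma> *v x)) / 2) powr (- (p + 1/2)))"
proof -
  let ?q = "2 * p - real CARD('n)" and ?s = "matrix_inv \<sigma>"
  have q: "?q > -1" "?q + 1 > -1" using p by (simp_all add: field_simps)
  have qn: "(real CARD('n) + (?q + 1)) / 2 = p + 1/2" by simp
  let ?K = "gram_const TYPE('n) ?q" and ?K' = "gram_const TYPE('n) (?q + 1)"
  note s = pos_def_inv(1)[OF \<sigma>]
  have K: "?K > 0" "?K' > 0" using gram_const(2) q by blast+
  note ds = pos_def_det_pos[OF s] note d\<sigma> = pos_def_det_pos[OF \<sigma>]
  let ?c = "det ?s powr (- p) * ?K"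
  have c: "?c > 0" using ds K by simp
  let ?t = "?s + (1/2) *\<^sub>R outer x"
  have t: "?t \<in> pos_def_matrices" using s by (rule pos_def_add_outer) simp
  have dens: "gram_density ?q ?s X / ?c * (exp (- (x \<bullet> ((transpose X ** X) *v x)) / 2) * sqrt (det (transpose X ** X)))
     = gram_density (?q + 1) ?t X / ?c" for X
  proof -
    have "trace (?t ** (transpose X ** X)) = trace (?s ** (transpose X ** X)) + (x \<bullet> ((transpose X ** X) *v x)) / 2"
      using trace_mult_outer[of "transpose X ** X" x] trace_mul_sym[of "outer x" "transpose X ** X"]
      by (simp add: matrix_add_rdistrib trace_add matrix_scaleR_left trace_scaleR)
    then have "exp (- trace (?t ** (transpose X ** X))) = exp (- trace (?s ** (transpose X ** X))) * exp (- (x \<bullet> ((transpose X ** X) *v x)) / 2)"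
      by (simp add: exp_add[symmetric])
    moreover have "sqrt (det (transpose X ** X)) = \<bar>det X\<bar>" by (simp add: det_mul)
    moreover have "\<bar>det X\<bar> powr (?q + 1) = \<bar>det X\<bar> powr ?q * \<bar>det X\<bar>"
      using powr_mult_base[of "\<bar>det X\<bar>" ?q] by (simp add: add.commute mult.commute)
    ultimately show ?thesis by (simp add: gram_density_def)
  qed
  have "(\<integral>\<^sup>+u. ennreal (exp (- (x \<bullet> (u *v x)) / 2) * sqrt (det u)) \<partial>gram_wishart p \<sigma>)
     = (\<integral>\<^sup>+X. ennreal (gram_density ?q ?s X / ?c) * ennreal (exp (- (x \<bullet> ((transpose X ** X) *v x)) / 2) * sqrt (det (transpose X ** X))) \<partial>lborel)"
    by (intro nn_integral_gram_wishart) measurable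
  also have "\<dots> = (\<integral>\<^sup>+X. ennreal (gram_density (?q + 1) ?t X) / ennreal ?c \<partial>lborel)"
    using c by (intro nn_integral_cong)
      (simp add: dens[symmetric] ennreal_mult'[symmetric] divide_ennreal gram_density_nonneg del: times_divide_eq_left)
  also have "\<dots> = (\<integral>\<^sup>+X. ennreal (gram_density (?q + 1) ?t X) \<partial>lborel) / ennreal ?c"
    by (rule nn_integral_divide) measurable
  also have "\<dots> = ennreal (det ?t powr (- (p + 1/2)) * ?K' / ?c)"
    unfolding nn_integral_gram_density[OF q(2) t] qn using c K by (simp add: divide_ennreal)
  also have "det ?t powr (- (p + 1/2)) * ?K' / ?c = ?K' / ?K * sqrt (det \<sigma>) * (1 + (x \<bullet> (\<sigma> *v x)) / 2) powr (- (p + 1/2))"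
  proof -
    have r: "1 + (x \<bullet> (\<sigma> *v x)) / 2 > 0"
      using \<sigma> by (cases "x = 0") (auto simp: pos_def_matrices_def intro!: add_pos_pos)
    have dets: "det ?s = 1 / det \<sigma>" using arg_cong[OF pos_def_inv(2)[OF \<sigma>], of det] d\<sigma> by (simp add: det_mul field_simps)
    have t1: "det ?t = (1 + (x \<bullet> (\<sigma> *v x)) / 2) / det \<sigma>" using det_inv_plus_outer[OF \<sigma>, of "1/2" x] by simp
    have t2: "det \<sigma> powr (p + 1/2) / det \<sigma> powr p = sqrt (det \<sigma>)"
      using d\<sigma> by (simp add: powr_add powr_half_sqrt)
    have alg: "(R / d) powr (- b) * c' / ((1 / d) powr (- p) * c) = c' / c * (d powr b / d powr p) * R powr (- b)"
      if "R > 0" "d > 0" "c > 0" for R d b c c' :: real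
      using that by (simp add: powr_divide powr_minus field_simps)
    show ?thesis unfolding t1 dets t2[symmetric] using r d\<sigma> K(1) by (rule alg)
  qed
  finally show ?thesis .
qed

text \<open>The closed form serves for differentiation, the nonnegative integral for interchanging
  the order of integration when the total mass is computed.\<close>

lemma mix_density_eq:
  fixes \<sigma> :: "real^'n^'n"
  assumes p: "p > (real CARD('n) - 1) / 2" and \<sigma>: "\<sigma> \<in> pos_def_matrices"
  shows "mix_density p \<sigma> x = gram_const TYPE('n) (2 * p - real CARD('n) + 1) / gram_const TYPE('n) (2 * p - real CARD('n))
      / (2 * pi) powr (real CARD('n) / 2) * sqrt (det \<sigma>) * (1 + (x \<bullet> (\<sigma> *v x)) / 2) powr (- (p + 1/2))" (is "_ = ?rhs")
    and "ennreal (mix_density p \<sigma> x) = (\<integral>\<^sup>+u. ennreal (exp (- (x \<bullet> (u *v x)) / 2) * sqrt (det u)) \<partial>gram_wishart p \<sigma>)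
      / ennreal ((2 * pi) powr (real CARD('n) / 2))"
proof -
  let ?q = "2 * p - real CARD('n)"
  have q: "?q > -1" "?q + 1 > -1" using p by (simp_all add: field_simps)
  have K: "gram_const TYPE('n) ?q > 0" "gram_const TYPE('n) (?q + 1) > 0" using gram_const(2) q by blast+
  note W = is_wishart_gram_wishart[OF p \<sigma>]
  have st: "sets (gram_wishart p \<sigma>) = sets (restrict_space borel pos_def_matrices)"
    and sp: "space (gram_wishart p \<sigma>) = pos_def_matrices" using W by (auto simp: is_wishart_def)
  have "(\<lambda>u. exp (- (x \<bullet> (u *v x)) / 2) * sqrt (det u)) \<in> borel_measurable (gram_wishart p \<sigma>)"
    by (rule measurable_if_sets_eq[OF measurable_restrict_space1 st]) measurable
  then have "(LINT u|gram_wishart p \<sigma>. exp (- (x \<bullet> (u *v x)) / 2) * sqrt (det u))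
     = enn2real (\<integral>\<^sup>+u. ennreal (exp (- (x \<bullet> (u *v x)) / 2) * sqrt (det u)) \<partial>gram_wishart p \<sigma>)"
    by (rule integral_eq_nn_integral) (auto intro!: AE_I2 simp: sp less_imp_le pos_def_det_pos)
  then show eq: "mix_density p \<sigma> x = ?rhs"
    unfolding mix_density_def wishart_eq_gram_wishart[OF p \<sigma>] nn_integral_wishart_kernel[OF p \<sigma>]
    using K pos_def_det_pos[OF \<sigma>] by (simp add: field_simps)
  show "ennreal (mix_density p \<sigma> x) = (\<integral>\<^sup>+u. ennreal (exp (- (x \<bullet> (u *v x)) / 2) * sqrt (det u)) \<partial>gram_wishart p \<sigma>)
      / ennreal ((2 * pi) powr (real CARD('n) / 2))"
    unfolding eq nn_integral_wishart_kernel[OF p \<sigma>] using K pos_def_det_pos[OF \<sigma>]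
    by (simp add: divide_ennreal field_simps)
qed

section \<open>Total mass of the mixture density\<close>

lemma nn_integral_exp_gram:
  fixes X :: "real^'n^'n"
  assumes "det X \<noteq> 0"
  shows "(\<integral>\<^sup>+x. ennreal (exp (- (x \<bullet> ((transpose X ** X) *v x)) / 2) * sqrt (det (transpose X ** X))) \<partial>lborel)
    = ennreal ((2 * pi) powr (real CARD('n) / 2))"
proof -
  have quad: "x \<bullet> ((transpose X ** X) *v x) = (X *v x) \<bullet> (X *v x)" for x
    by (metis inner_matrix_vector_transpose matrix_vector_mul_assoc transpose_transpose)
  have [measurable]: "(\<lambda>x. X *v x) \<in> borel_measurable borel"
    by (intro borel_measurable_linear matrix_vector_mul_linear)
  have "(\<integral>\<^sup>+x. ennreal (exp (- (x \<bullet> ((transpose X ** X) *v x)) / 2) * sqrt (det (transpose X ** X))) \<partial>lborel)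
     = (\<integral>\<^sup>+x. ennreal \<bar>det X\<bar> * ennreal (exp (- (1/2) * ((X *v x) \<bullet> (X *v x)))) \<partial>lborel)"
    unfolding quad by (simp add: det_mul ennreal_mult' mult.commute)
  also have "\<dots> = ennreal \<bar>det X\<bar> * (\<integral>\<^sup>+x. ennreal (exp (- (1/2) * ((X *v x) \<bullet> (X *v x)))) \<partial>lborel)"
    by (rule nn_integral_cmult) measurable
  also have "\<dots> = (\<integral>\<^sup>+x. ennreal (exp (- (1/2) * (x \<bullet> x))) \<partial>(lborel :: (real^'n) measure))"
    by (rule nn_integral_lborel_matrix_vector_mult[OF assms]) measurable
  also have "\<dots> = ennreal (sqrt (pi / (1/2)) ^ DIM(real^'n))" by (rule nn_integral_exp_neg_inner) simp
  also have "sqrt (pi / (1/2)) ^ DIM(real^'n) = (2 * pi) powr (real CARD('n) / 2)"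
    by (simp add: powr_realpow[symmetric] powr_half_sqrt[symmetric] powr_powr mult.commute)
  finally show ?thesis .
qed

text \<open>Integrating first over \<open>x\<close> leaves the Gaussian normalisation, the same for
  all nonsingular X, and then the total mass of the Wishart law. The interchange is made in the
  variables (x, X), where both measures are \<open>lborel\<close>.\<close>

lemma nn_integral_mix_density:
  fixes \<sigma> :: "real^'n^'n"
  assumes p: "p > (real CARD('n) - 1) / 2" and \<sigma>: "\<sigma> \<in> pos_def_matrices"
  shows "(\<integral>\<^sup>+x. ennreal (mix_density p \<sigma> x) \<partial>lborel) = 1"
proof -
  let ?q = "2 * p - real CARD('n)" and ?s = "matrix_inv \<sigma>"
  let ?c = "det ?s powr (- p) * gram_const TYPE('n) ?q"
  let ?k = "\<lambda>x u::real^'n^'n. exp (- (x \<bullet> (u *v x)) / 2) * sqrt (det u)"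
  let ?P = "(2 * pi) powr (real CARD('n) / 2)"
  let ?w = "\<lambda>X. ennreal (gram_density ?q ?s X / ?c)"
  have "continuous_on UNIV (\<lambda>z::(real^'n) \<times> (real^'n^'n). fst z \<bullet> ((transpose (snd z) ** snd z) *v fst z))"
    unfolding matrix_matrix_mult_def matrix_vector_mult_def transpose_def
    by (auto intro!: continuous_intros)
  then have "(\<lambda>z::(real^'n) \<times> (real^'n^'n). fst z \<bullet> ((transpose (snd z) ** snd z) *v fst z)) \<in> borel_measurable borel"
    by (rule borel_measurable_continuous_onI)
  then have [measurable]: "(\<lambda>z::(real^'n) \<times> (real^'n^'n). fst z \<bullet> ((transpose (snd z) ** snd z) *v fst z)) \<in> borel_measurable (borel \<Otimes>\<^sub>M borel)"
    by (simp add: borel_prod)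
  have jm: "(\<lambda>(x, X). ?w X * ennreal (?k x (transpose X ** X))) \<in> borel_measurable ((lborel :: (real^'n) measure) \<Otimes>\<^sub>M (lborel :: (real^'n^'n) measure))"
    unfolding case_prod_beta by measurable
  have kern: "(\<integral>\<^sup>+u. ennreal (?k x u) \<partial>gram_wishart p \<sigma>) = (\<integral>\<^sup>+X. ?w X * ennreal (?k x (transpose X ** X)) \<partial>lborel)" for x
    by (intro nn_integral_gram_wishart) measurable
  have one: "(\<integral>\<^sup>+X. ?w X \<partial>lborel) = 1"
  proof -
    have "prob_space (gram_wishart p \<sigma>)" using is_wishart_gram_wishart[OF p \<sigma>] by (simp add: is_wishart_def)
    then have "(\<integral>\<^sup>+u. 1 \<partial>gram_wishart p \<sigma>) = 1" by (simp add: prob_space.emeasure_space_1)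
    then show ?thesis by (subst (asm) nn_integral_gram_wishart) simp_all
  qed
  have "(\<integral>\<^sup>+x. ennreal (mix_density p \<sigma> x) \<partial>lborel)
     = (\<integral>\<^sup>+x. (\<integral>\<^sup>+X. ?w X * ennreal (?k x (transpose X ** X)) \<partial>lborel) / ennreal ?P \<partial>lborel)"
    unfolding mix_density_eq(2)[OF p \<sigma>] kern ..
  also have "\<dots> = (\<integral>\<^sup>+x. (\<integral>\<^sup>+X. ?w X * ennreal (?k x (transpose X ** X)) \<partial>lborel) \<partial>lborel) / ennreal ?P"
    using lborel.borel_measurable_nn_integral_fst[OF jm] by (intro nn_integral_divide) simp
  also have "(\<integral>\<^sup>+x. (\<integral>\<^sup>+X. ?w X * ennreal (?k x (transpose X ** X)) \<partial>lborel) \<partial>lborel)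
     = (\<integral>\<^sup>+X. (\<integral>\<^sup>+x. ?w X * ennreal (?k x (transpose X ** X)) \<partial>lborel) \<partial>lborel)"
    using lborel_pair.Fubini'[OF jm] by simp
  also have "\<dots> = (\<integral>\<^sup>+X. ?w X * ennreal ?P \<partial>lborel)"
  proof (rule nn_integral_cong)
    fix X :: "real^'n^'n"
    show "(\<integral>\<^sup>+x. ?w X * ennreal (?k x (transpose X ** X)) \<partial>lborel) = ?w X * ennreal ?P"
    proof (cases "det X = 0")
      \<comment> \<open>For singular X the weight is zero, as \<open>0 powr q = 0\<close>, so both
        sides vanish.\<close>
      case True
      then show ?thesis by (simp add: gram_density_def)
    next
      case False
      have "(\<lambda>x. ?k x (transpose X ** X)) \<in> borel_measurable borel"
        unfolding matrix_matrix_mult_def matrix_vector_mult_def transpose_def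
        by (intro borel_measurable_continuous_onI) (auto intro!: continuous_intros)
      then show ?thesis using nn_integral_exp_gram[OF False] by (simp add: nn_integral_cmult)
    qed
  qed
  also have "\<dots> = ennreal ?P" using one by (simp add: nn_integral_multc)
  finally show ?thesis by (simp add: divide_ennreal)
qed

subsection \<open>Moments of the mixture density\<close>

lemma nn_integral_Gamma_scaled:
  fixes b r :: real
  assumes b: "b > 0" and r: "r > 0"
  shows "(\<integral>\<^sup>+t. ennreal (indicator {0<..} t * t powr (b - 1) * exp (- (t * r))) \<partial>lborel) = ennreal (Gamma b * r powr (- b))"
proof -
  let ?g = "\<lambda>t. ennreal (indicator {0<..} t * t powr (b - 1) * exp (- t))"
  have "ennreal (Gamma b) = (\<integral>\<^sup>+t. ennreal (indicator {0..} t * t powr (b - 1) / exp t) \<partial>lborel)"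
    by (rule Gamma_conv_nn_integral_real[OF b])
  also have "\<dots> = (\<integral>\<^sup>+t. ?g t \<partial>lborel)"
    by (intro nn_integral_cong) (auto simp: indicator_def exp_minus divide_inverse)
  also have "\<dots> = ennreal \<bar>r\<bar> * (\<integral>\<^sup>+t. ?g (0 + r * t) \<partial>lborel)"
    by (rule nn_integral_real_affine) (use r in auto)
  also have "\<dots> = ennreal r * (\<integral>\<^sup>+t. ennreal (r powr (b - 1)) * ennreal (indicator {0<..} t * t powr (b - 1) * exp (- (t * r))) \<partial>lborel)"
    using r by (auto intro!: arg_cong[of _ _ "(*) _"] nn_integral_cong
       simp: indicator_def zero_less_mult_iff powr_mult ennreal_mult'[symmetric] mult_ac)
  also have "\<dots> = ennreal (r powr b) * (\<integral>\<^sup>+t. ennreal (indicator {0<..} t * t powr (b - 1) * exp (- (t * r))) \<partial>lborel)"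
    using r powr_mult_base[of r "b - 1"]
    by (subst nn_integral_cmult) (auto simp: mult.assoc[symmetric] ennreal_mult'[symmetric])
  finally have "ennreal (r powr (- b)) * ennreal (Gamma b) = ennreal (r powr (- b)) * ennreal (r powr b)
      * (\<integral>\<^sup>+t. ennreal (indicator {0<..} t * t powr (b - 1) * exp (- (t * r))) \<partial>lborel)"
    by (simp add: mult.assoc)
  also have "ennreal (r powr (- b)) * ennreal (r powr b) = 1"
    using r by (simp add: ennreal_mult'[symmetric] powr_minus)
  finally show ?thesis using Gamma_real_pos[OF b] by (simp add: ennreal_mult'[symmetric] mult.commute)
qed

text \<open>Moments of a centred normal law with variance 1/t, up to its normalising factor; the
  quotient of factorials is the double factorial (2k - 1)!!.\<close>

lemma nn_integral_even_moment_exp_neg_square: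
  fixes t :: real
  assumes t: "t > 0"
  shows "(\<integral>\<^sup>+x. ennreal (x ^ (2 * k) * exp (- (t / 2) * x\<^sup>2)) \<partial>lborel)
    = ennreal (sqrt (2 * pi) * (fact (2 * k) / (2 ^ k * fact k)) * t powr (- (1/2 + real k)))"
proof -
  let ?s = "1 / sqrt t"
  have s: "?s > 0" using t by simp
  have eq: "x ^ (2 * k) * exp (- (t / 2) * x\<^sup>2) = sqrt (2 * pi / t) * (normal_density 0 ?s x * (x - 0) ^ (2 * k))" for x
    using t by (simp add: normal_density_def power_divide real_sqrt_divide real_sqrt_mult field_simps)
  have hb: "has_bochner_integral lborel (\<lambda>x. normal_density 0 ?s x * (x - 0) ^ (2 * k)) (fact (2 * k) / ((2 / ?s\<^sup>2)^k * fact k))"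
    by (rule normal_moment_even[OF s])
  have nn: "0 \<le> normal_density 0 ?s x * (x - 0) ^ (2 * k)" for x
    by (simp add: power_mult)
  have "(\<integral>\<^sup>+x. ennreal (x ^ (2 * k) * exp (- (t / 2) * x\<^sup>2)) \<partial>lborel)
    = ennreal (sqrt (2 * pi / t)) * (\<integral>\<^sup>+x. ennreal (normal_density 0 ?s x * (x - 0) ^ (2 * k)) \<partial>lborel)"
    unfolding eq using t by (subst nn_integral_cmult[symmetric]) (auto intro!: nn_integral_cong simp: ennreal_mult'[symmetric])
  also have "(\<integral>\<^sup>+x. ennreal (normal_density 0 ?s x * (x - 0) ^ (2 * k)) \<partial>lborel) = ennreal (fact (2 * k) / ((2 / ?s\<^sup>2)^k * fact k))"
    using hb nn by (subst nn_integral_eq_integral) (auto simp: has_bochner_integral_iff)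
  also have "ennreal (sqrt (2 * pi / t)) * \<dots> = ennreal (sqrt (2 * pi / t) * (fact (2 * k) / ((2 / ?s\<^sup>2)^k * fact k)))"
    using t by (simp add: ennreal_mult'[symmetric])
  also have "sqrt (2 * pi / t) * (fact (2 * k) / ((2 / ?s\<^sup>2)^k * fact k))
     = sqrt (2 * pi) * (fact (2 * k) / (2 ^ k * fact k)) * t powr (- (1/2 + real k))"
  proof -
    have "t powr (1/2 + real k) = sqrt t * t ^ k"
      using t by (simp add: powr_add powr_half_sqrt powr_realpow)
    then have "t powr (- (1/2 + real k)) = 1 / (sqrt t * t ^ k)"
      by (simp only: powr_minus_divide)
    then show ?thesis using t by (simp add: real_sqrt_divide power_divide power_mult_distrib)
  qed
  finally show ?thesis .
qed

text \<open>The product of the double factorials (2 m_i - 1)!!, that is, the moment of the monomial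
  with exponents 2 m_i under the standard Gaussian law.\<close>

definition double_fact_prod :: "('n::finite \<Rightarrow> nat) \<Rightarrow> real" where
  "double_fact_prod m = (\<Prod>i\<in>UNIV. fact (2 * m i) / (2 ^ m i * fact (m i)))"

lemma nn_integral_even_monomial_exp_neg:
  fixes m :: "'n::finite \<Rightarrow> nat" and t :: real
  assumes t: "t > 0"
  shows "(\<integral>\<^sup>+y. ennreal ((\<Prod>i\<in>UNIV. y $ i ^ (2 * m i)) * exp (- (t / 2) * (y \<bullet> y))) \<partial>(lborel :: (real^'n) measure))
    = ennreal ((2 * pi) powr (real CARD('n) / 2) * double_fact_prod m * t powr (- (real CARD('n) / 2 + real (\<Sum>i\<in>UNIV. m i))))"
proof -
  define m' where "m' b = m (SOME i. b = axis i 1)" for b :: "real^'n"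
  have m': "m' (axis i 1) = m i" for i
    unfolding m'_def by (rule arg_cong[of _ _ m]) (auto simp: axis_eq_axis)
  let ?f = "\<lambda>b x. ennreal (x ^ (2 * m' b) * exp (- (t / 2) * x\<^sup>2))"
  have "ennreal ((\<Prod>i\<in>UNIV. y $ i ^ (2 * m i)) * exp (- (t / 2) * (y \<bullet> y))) = (\<Prod>b\<in>Basis. ?f b (y \<bullet> b))" for y :: "real^'n"
  proof -
    have "(\<Prod>b\<in>Basis. ?f b (y \<bullet> b)) = ennreal (\<Prod>i\<in>UNIV. y $ i ^ (2 * m i) * exp (- (t / 2) * (y $ i)\<^sup>2))"
      by (subst prod_ennreal[symmetric]) (auto simp: prod_Basis_vec m' inner_axis power_mult)
    also have "(\<Prod>i\<in>UNIV. y $ i ^ (2 * m i) * exp (- (t / 2) * (y $ i)\<^sup>2)) = (\<Prod>i\<in>UNIV. y $ i ^ (2 * m i)) * exp (- (t / 2) * (y \<bullet> y))"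
      by (simp add: prod.distrib exp_sum[symmetric] inner_vec_def power2_eq_square sum_distrib_left sum_negf)
    finally show ?thesis ..
  qed
  then have "(\<integral>\<^sup>+y. ennreal ((\<Prod>i\<in>UNIV. y $ i ^ (2 * m i)) * exp (- (t / 2) * (y \<bullet> y))) \<partial>(lborel :: (real^'n) measure))
     = (\<integral>\<^sup>+y. (\<Prod>b\<in>Basis. ?f b (y \<bullet> b)) \<partial>(lborel :: (real^'n) measure))" by simp
  also have "\<dots> = (\<Prod>b\<in>Basis. (\<integral>\<^sup>+x. ?f b x \<partial>lborel))"
    by (rule nn_integral_lborel_prod) auto
  also have "\<dots> = (\<Prod>i\<in>(UNIV::'n set). ennreal (sqrt (2 * pi) * (fact (2 * m i) / (2 ^ m i * fact (m i))) * t powr (- (1/2 + real (m i)))))"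
    unfolding nn_integral_even_moment_exp_neg_square[OF t] by (simp add: prod_Basis_vec m')
  also have "\<dots> = ennreal (\<Prod>i\<in>(UNIV::'n set). sqrt (2 * pi) * (fact (2 * m i) / (2 ^ m i * fact (m i))) * t powr (- (1/2 + real (m i))))"
    by (rule prod_ennreal) auto
  also have "(\<Prod>i\<in>(UNIV::'n set). sqrt (2 * pi) * (fact (2 * m i) / (2 ^ m i * fact (m i))) * t powr (- (1/2 + real (m i))))
     = (2 * pi) powr (real CARD('n) / 2) * double_fact_prod m * t powr (- (real CARD('n) / 2 + real (\<Sum>i\<in>UNIV. m i)))"
  proof -
    have "(\<Prod>i\<in>(UNIV::'n set). t powr (- (1/2 + real (m i)))) = t powr (\<Sum>i\<in>(UNIV::'n set). - (1/2 + real (m i)))"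
      using t by (simp add: powr_sum)
    also have "(\<Sum>i\<in>(UNIV::'n set). - (1/2 + real (m i))) = - (real CARD('n) / 2 + real (\<Sum>i\<in>UNIV. m i))"
      by (simp add: sum_subtractf)
    finally have 1: "(\<Prod>i\<in>(UNIV::'n set). t powr (- (1/2 + real (m i)))) = t powr (- (real CARD('n) / 2 + real (\<Sum>i\<in>UNIV. m i)))" .
    have "sqrt (2 * pi) ^ CARD('n) = (2 * pi) powr (real CARD('n) / 2)"
      by (simp add: powr_realpow[symmetric] powr_half_sqrt[symmetric] powr_powr)
    then show ?thesis unfolding prod.distrib 1 double_fact_prod_def by simp
  qed
  finally show ?thesis .
qed

abbreviation radial :: "real^'n \<Rightarrow> real" where
  "radial y \<equiv> 1 + (y \<bullet> y) / 2"

lemma radial_pos: "radial y > 0"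
  by (intro add_pos_nonneg) auto

text \<open>Writing \<open>radial y powr (- b)\<close> as a Gamma integral of Gaussians reduces these moments to Gaussian ones.\<close>

lemma nn_integral_even_monomial_radial:
  fixes m :: "'n::finite \<Rightarrow> nat"
  assumes b: "b > real CARD('n) / 2 + real (\<Sum>i\<in>UNIV. m i)"
  shows "(\<integral>\<^sup>+y. ennreal ((\<Prod>i\<in>UNIV. y $ i ^ (2 * m i)) * radial y powr (- b)) \<partial>(lborel :: (real^'n) measure))
    = ennreal ((2 * pi) powr (real CARD('n) / 2) * double_fact_prod m * Gamma (b - (real CARD('n) / 2 + real (\<Sum>i\<in>UNIV. m i))) / Gamma b)"
proof -
  let ?M = "real CARD('n) / 2 + real (\<Sum>i\<in>UNIV. m i)"
  let ?h = "\<lambda>y::real^'n. \<Prod>i\<in>UNIV. y $ i ^ (2 * m i)"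
  let ?\<kappa> = "(2 * pi) powr (real CARD('n) / 2) * double_fact_prod m"
  have b0: "b > 0" using b by (rule le_less_trans[rotated]) (simp add: sum_nonneg)
  have \<kappa>: "?\<kappa> \<ge> 0" by (simp add: double_fact_prod_def prod_nonneg)
  have h: "?h y \<ge> 0" for y by (simp add: power_mult prod_nonneg)
  have hm[measurable]: "?h \<in> borel_measurable borel"
    by (intro borel_measurable_continuous_onI) (auto intro!: continuous_intros)
  let ?F = "\<lambda>(t, y::real^'n). ennreal (indicator {0<..} t * t powr (b - 1) * exp (- t)) * ennreal (?h y * exp (- (t / 2) * (y \<bullet> y)))"
  have Fm: "?F \<in> borel_measurable (lborel \<Otimes>\<^sub>M lborel)"
    unfolding case_prod_beta by measurable
  have F: "?F (t, y) = ennreal (?h y) * ennreal (indicator {0<..} t * t powr (b - 1) * exp (- (t * radial y)))" for t y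
  proof -
    have "exp (- (t * radial y)) = exp (- t) * exp (- (t / 2) * (y \<bullet> y))" by (simp add: mult_exp_exp algebra_simps)
    then show ?thesis using h[of y] by (simp add: ennreal_mult'[symmetric] mult_ac)
  qed
  have "ennreal (Gamma b) * (\<integral>\<^sup>+y. ennreal (?h y * radial y powr (- b)) \<partial>lborel)
     = (\<integral>\<^sup>+y. ennreal (?h y) * ennreal (Gamma b * radial y powr (- b)) \<partial>lborel)"
    using h Gamma_real_pos[OF b0] by (subst nn_integral_cmult[symmetric]) (auto intro!: nn_integral_cong simp: ennreal_mult'[symmetric] mult_ac)
  also have "\<dots> = (\<integral>\<^sup>+y. (\<integral>\<^sup>+t. ?F (t, y) \<partial>lborel) \<partial>lborel)"
    unfolding F by (simp add: nn_integral_cmult nn_integral_Gamma_scaled[OF b0 radial_pos])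
  also have "\<dots> = (\<integral>\<^sup>+t. (\<integral>\<^sup>+y. ?F (t, y) \<partial>lborel) \<partial>lborel)"
    by (rule lborel_pair.Fubini[OF Fm])
  \<comment> \<open>The Gaussian moment contributes \<open>t powr (- ?M)\<close> and leaves a Gamma
    integral with parameter \<open>b - ?M\<close>; the assumption on \<open>b\<close> is its
    convergence.\<close>
  also have "\<dots> = (\<integral>\<^sup>+t. ennreal ?\<kappa> * ennreal (indicator {0<..} t * t powr ((b - ?M) - 1) * exp (- (t * 1))) \<partial>lborel)"
  proof (rule nn_integral_cong)
    fix t :: real
    show "(\<integral>\<^sup>+y. ?F (t, y) \<partial>lborel) = ennreal ?\<kappa> * ennreal (indicator {0<..} t * t powr ((b - ?M) - 1) * exp (- (t * 1)))"
    proof (cases "t > 0")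
      case True
      have pw: "t powr (b - 1) * t powr (- ?M) = t powr ((b - ?M) - 1)" by (simp add: powr_add[symmetric] algebra_simps)
      have "(\<integral>\<^sup>+y. ?F (t, y) \<partial>lborel) = ennreal (t powr (b - 1) * exp (- t)) * (\<integral>\<^sup>+y. ennreal (?h y * exp (- (t / 2) * (y \<bullet> y))) \<partial>lborel)"
        using True by (simp add: nn_integral_cmult)
      also have "\<dots> = ennreal (t powr (b - 1) * exp (- t)) * ennreal (?\<kappa> * t powr (- ?M))"
        unfolding nn_integral_even_monomial_exp_neg[OF True] ..
      also have "\<dots> = ennreal (t powr (b - 1) * exp (- t) * (?\<kappa> * t powr (- ?M)))"
        by (rule ennreal_mult'[symmetric]) simp
      also have "t powr (b - 1) * exp (- t) * (?\<kappa> * t powr (- ?M)) = ?\<kappa> * (t powr (b - 1) * t powr (- ?M) * exp (- t))"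
        by (simp only: mult_ac)
      also have "ennreal \<dots> = ennreal ?\<kappa> * ennreal (t powr ((b - ?M) - 1) * exp (- t))"
        unfolding pw using \<kappa> by (rule ennreal_mult')
      finally show ?thesis using True by simp
    qed simp
  qed
  also have "\<dots> = ennreal ?\<kappa> * ennreal (Gamma (b - ?M) * 1 powr (- (b - ?M)))"
    using b by (subst nn_integral_cmult) (auto simp only: nn_integral_Gamma_scaled, auto)
  finally have eq: "ennreal (Gamma b) * (\<integral>\<^sup>+y. ennreal (?h y * radial y powr (- b)) \<partial>lborel) = ennreal (?\<kappa> * Gamma (b - ?M))"
    using \<kappa> by (simp add: ennreal_mult'[symmetric])
  have "(\<integral>\<^sup>+y. ennreal (?h y * radial y powr (- b)) \<partial>lborel)
     = ennreal (1 / Gamma b) * (ennreal (Gamma b) * (\<integral>\<^sup>+y. ennreal (?h y * radial y powr (- b)) \<partial>lborel))"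
    using Gamma_real_pos[OF b0] by (simp add: mult.assoc[symmetric] ennreal_mult'[symmetric])
  then show ?thesis
    unfolding eq using Gamma_real_pos[OF b0] by (simp add: ennreal_mult'[symmetric])
qed

section \<open>Reflections, and the second and fourth moments\<close>

definition flip :: "'n \<Rightarrow> real^'n \<Rightarrow> real^'n" where
  "flip e y = (\<chi> i. if i = e then - y $ i else y $ i)"

text \<open>The reflection has determinant -1, so the substitution preserves the integral, while
  \<open>odd\<close> changes its sign.\<close>

lemma integral_flip_odd:
  fixes f :: "real^'n \<Rightarrow> real"
  assumes [measurable]: "f \<in> borel_measurable borel" and odd: "\<And>y. f (flip e y) = - f y"
  shows "(LINT y|lborel. f y) = 0"
proof -
  let ?A = "(\<chi> i j. if i = j then (if i = e then -1 else 1) else 0) :: real^'n^'n"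
  have A: "?A *v y = flip e y" for y
    by (simp add: vec_eq_iff flip_def matrix_vector_mult_def if_distrib[of "\<lambda>x. x * _"] cong: if_cong)
  have "det ?A = (\<Prod>i\<in>UNIV. if i = e then -1 else 1)"
    by (subst det_diagonal) auto
  then have d: "det ?A = -1" by simp
  have "(LINT y|lborel. f y) = (LINT y|lborel. \<bar>det ?A\<bar> *\<^sub>R f (?A *v y))"
    by (rule integral_lborel_matrix_vector_mult) (simp_all add: d)
  also have "\<dots> = - (LINT y|lborel. f y)" by (simp add: A d odd)
  finally show ?thesis by simp
qed

lemma flip_inner: "flip e y \<bullet> flip e y = y \<bullet> (y :: real^'n)"
  unfolding inner_vec_def by (rule sum.cong) (auto simp: flip_def)

lemma nth_measurable[measurable]: "(\<lambda>y::real^'n. y $ i) \<in> borel_measurable borel"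
  by (intro borel_measurable_continuous_onI) (auto intro!: continuous_intros)

lemma powr_minus_add_1: "(r::real) > 0 \<Longrightarrow> r powr (- (a + 1)) = r powr (- a) / r"
  by (simp add: powr_diff)

lemma powr_minus_add_2: "(r::real) > 0 \<Longrightarrow> r powr (- (a + 2)) = r powr (- a) / r / r"
  by (simp add: powr_diff powr_numeral power2_eq_square)

definition radial_mass :: "'n::finite itself \<Rightarrow> real \<Rightarrow> real" where
  "radial_mass _ a = (2 * pi) powr (real CARD('n) / 2) * Gamma (a - real CARD('n) / 2) / Gamma a"

context
  fixes a :: real
  assumes a: "a > real CARD('n::finite) / 2"
begin

lemma radial_exponent_pos: "a > 0"
  using a by (rule le_less_trans[rotated]) simp

text \<open>Raising the exponent by half the degree of the monomial keeps the Gamma factor in the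
  numerator at a - n/2, so only a rational factor in \<open>a\<close> is left besides
  \<open>radial_mass\<close>. The exponents needed have this form because each 1/r in the Fisher
  integrand comes with two coordinates.\<close>

lemma has_bochner_integral_even_monomial_radial:
  fixes m :: "'n \<Rightarrow> nat"
  shows "has_bochner_integral lborel (\<lambda>y::real^'n. (\<Prod>i\<in>UNIV. y $ i ^ (2 * m i)) * radial y powr (- (a + real (\<Sum>i\<in>UNIV. m i))))
    (radial_mass TYPE('n) a * double_fact_prod m * Gamma a / Gamma (a + real (\<Sum>i\<in>UNIV. m i)))"
proof -
  let ?S = "real (\<Sum>i\<in>UNIV. m i)"
  have S: "?S \<ge> 0" by (rule of_nat_0_le_iff)
  have G: "Gamma a > 0" "Gamma (a + ?S) > 0" "Gamma (a - real CARD('n) / 2) > 0"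
    using a radial_exponent_pos S by (auto intro!: Gamma_real_pos add_pos_nonneg)
  have "a + ?S - (real CARD('n) / 2 + ?S) = a - real CARD('n) / 2" by simp
  then have "(\<integral>\<^sup>+y. ennreal ((\<Prod>i\<in>UNIV. y $ i ^ (2 * m i)) * radial y powr (- (a + ?S))) \<partial>(lborel :: (real^'n) measure))
    = ennreal ((2 * pi) powr (real CARD('n) / 2) * double_fact_prod m * Gamma (a - real CARD('n) / 2) / Gamma (a + ?S))"
    using nn_integral_even_monomial_radial[of m "a + ?S"] a by (simp only:)
  also have "(2 * pi) powr (real CARD('n) / 2) * double_fact_prod m * Gamma (a - real CARD('n) / 2) / Gamma (a + ?S)
     = radial_mass TYPE('n) a * double_fact_prod m * Gamma a / Gamma (a + ?S)"
    using G by (simp add: radial_mass_def)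
  finally have I: "(\<integral>\<^sup>+y. ennreal ((\<Prod>i\<in>UNIV. y $ i ^ (2 * m i)) * radial y powr (- (a + ?S))) \<partial>(lborel :: (real^'n) measure))
    = ennreal (radial_mass TYPE('n) a * double_fact_prod m * Gamma a / Gamma (a + ?S))" .
  show ?thesis
    using I
  proof (rule has_bochner_integral_nn_integral[rotated 3])
    show "(\<lambda>y::real^'n. (\<Prod>i\<in>UNIV. y $ i ^ (2 * m i)) * radial y powr (- (a + ?S))) \<in> borel_measurable lborel"
      by measurable
    show "AE y in lborel. 0 \<le> (\<Prod>i\<in>UNIV. y $ i ^ (2 * m i)) * radial (y::real^'n) powr (- (a + ?S))"
      by (simp add: power_mult prod_nonneg)
    show "0 \<le> radial_mass TYPE('n) a * double_fact_prod m * Gamma a / Gamma (a + ?S)"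
      using G by (simp add: radial_mass_def double_fact_prod_def prod_nonneg)
  qed
qed

lemma radial_moment_0:
  "has_bochner_integral lborel (\<lambda>y::real^'n. radial y powr (- a)) (radial_mass TYPE('n) a)"
  using has_bochner_integral_even_monomial_radial[of "\<lambda>_. 0"] Gamma_real_pos[OF radial_exponent_pos]
  by (simp add: double_fact_prod_def)

lemma Gamma_ratio: "Gamma a / Gamma (a + 1) = 1 / a" "Gamma a / Gamma (a + 2) = 1 / (a * (a + 1))"
proof -
  have 1: "Gamma (a + 1) = a * Gamma a"
    using radial_exponent_pos by (intro Gamma_plus1) (auto simp: nonpos_Ints_def)
  have "Gamma ((a + 1) + 1) = (a + 1) * Gamma (a + 1)"
    using radial_exponent_pos by (intro Gamma_plus1) (auto simp: nonpos_Ints_def)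
  moreover have "(a + 1) + 1 = a + 2" by simp
  ultimately have 2: "Gamma (a + 2) = a * (a + 1) * Gamma a" unfolding 1 by (simp only: mult_ac)
  have *: "x / (b * x) = 1 / b" if "x > 0" for x b :: real using that by simp
  show "Gamma a / Gamma (a + 1) = 1 / a" "Gamma a / Gamma (a + 2) = 1 / (a * (a + 1))"
    unfolding 1 2 by (rule *[OF Gamma_real_pos[OF radial_exponent_pos]])+
qed

text \<open>Serves the odd moments, which the formula for nonnegative integrands does not reach; the
  bound is available because the quotients y_i y_j / r are bounded.\<close>

lemma integrable_if_radial_bound:
  fixes f :: "real^'n \<Rightarrow> real"
  assumes "f \<in> borel_measurable borel" "\<And>y. \<bar>f y\<bar> \<le> C * radial y powr (- a)"
  shows "integrable lborel f"
proof (rule Bochner_Integration.integrable_bound)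
  show "integrable lborel (\<lambda>y::real^'n. C * radial y powr (- a))"
    using radial_moment_0 by (auto simp: has_bochner_integral_iff)
qed (use assms in \<open>auto intro!: AE_I2 order.trans[OF _ abs_ge_self]\<close>)

lemma abs_coord_mult_le: "\<bar>y $ i * y $ j\<bar> \<le> 2 * radial (y :: real^'n)"
proof -
  have "\<bar>y $ i * y $ j\<bar> \<le> norm y * norm y"
    unfolding abs_mult by (intro mult_mono component_le_norm_cart) auto
  then show ?thesis by (simp add: dot_square_norm power2_eq_square)
qed

lemma radial_moment_2:
  fixes i j :: 'n
  shows "has_bochner_integral lborel (\<lambda>y::real^'n. y $ i * y $ j * radial y powr (- (a + 1)))
    (of_bool (i = j) * radial_mass TYPE('n) a / a)"
proof (cases "i = j")
  case True
  have e: "(\<Prod>l\<in>UNIV. y $ l ^ (2 * of_bool (l = i))) = y $ i * y $ i" for y :: "real^'n"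
    by (subst prod.remove[of _ i]) (auto simp: power2_eq_square)
  have d: "double_fact_prod (\<lambda>l. of_bool (l = i)) = 1"
    unfolding double_fact_prod_def by (rule prod.neutral) auto
  have s: "real (\<Sum>l\<in>UNIV. of_bool (l = i)) = 1" by (simp add: of_bool_def)
  show ?thesis
    using has_bochner_integral_even_monomial_radial[of "\<lambda>l. of_bool (l = i)"] True
    unfolding e d s times_divide_eq_right[symmetric] Gamma_ratio by simp
next
  case False
  let ?f = "\<lambda>y::real^'n. y $ i * y $ j * radial y powr (- (a + 1))"
  have m: "?f \<in> borel_measurable borel" by measurable
  have "\<bar>?f y\<bar> \<le> 2 * radial y powr (- a)" for y
  proof -
    have "\<bar>?f y\<bar> \<le> 2 * radial y * radial y powr (- (a + 1))"
      unfolding abs_mult[of "_ * _"] using abs_coord_mult_le[of y i j] by (intro mult_mono) auto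
    also have "\<dots> = 2 * radial y powr (- a)"
    proof -
      have *: "2 * r * (R / r) = 2 * R" if "r > 0" for r R :: real using that by simp
      show ?thesis unfolding powr_minus_add_1[OF radial_pos] by (rule *[OF radial_pos])
    qed
    finally show ?thesis .
  qed
  then have "integrable lborel ?f" by (rule integrable_if_radial_bound[OF m])
  moreover have "(LINT y|lborel. ?f y) = 0"
    by (rule integral_flip_odd[OF m, of i]) (use False in \<open>simp only: flip_inner, simp add: flip_def\<close>)
  ultimately show ?thesis using False by (simp add: has_bochner_integral_iff)
qed

lemma radial_moment_4_even:
  fixes i k :: 'n
  shows "has_bochner_integral lborel (\<lambda>y::real^'n. y $ i * y $ i * y $ k * y $ k * radial y powr (- (a + 2)))
    ((1 + 2 * of_bool (i = k)) * radial_mass TYPE('n) a / (a * (a + 1)))"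
proof -
  let ?m = "\<lambda>l. of_bool (l = i) + of_bool (l = k) :: nat"
  have e: "(\<Prod>l\<in>UNIV. y $ l ^ (2 * ?m l)) = y $ i * y $ i * y $ k * y $ k" for y :: "real^'n"
  proof -
    have 1: "(\<Prod>l\<in>UNIV. y $ l ^ (2 * of_bool (l = i))) = y $ i * y $ i" for i
      by (subst prod.remove[of _ i]) (auto simp: power2_eq_square)
    show ?thesis unfolding distrib_left power_add prod.distrib 1 by simp
  qed
  \<comment> \<open>For i = k the coordinate has exponent 4, with double factorial 3!! = 3;
    otherwise all factors are 1.\<close>
  have d: "double_fact_prod ?m = 1 + 2 * of_bool (i = k)"
  proof -
    have "double_fact_prod ?m = (\<Prod>l\<in>{i}. 1 + 2 * of_bool (i = k))"
      unfolding double_fact_prod_def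
      by (rule prod.mono_neutral_cong_right) (auto simp: fact_numeral)
    then show ?thesis by simp
  qed
  have s: "real (\<Sum>l\<in>UNIV. ?m l) = 2" by (simp add: sum.distrib of_bool_def)
  show ?thesis
    using has_bochner_integral_even_monomial_radial[of ?m]
    unfolding e d s times_divide_eq_right[symmetric] Gamma_ratio by (simp add: mult_ac)
qed

lemma radial_moment_4_odd:
  fixes i j k l :: 'n
  assumes odd: "\<And>y::real^'n. flip e y $ i * flip e y $ j * flip e y $ k * flip e y $ l = - (y $ i * y $ j * y $ k * y $ l)"
  shows "has_bochner_integral lborel (\<lambda>y::real^'n. y $ i * y $ j * y $ k * y $ l * radial y powr (- (a + 2))) 0"
proof -
  let ?f = "\<lambda>y::real^'n. y $ i * y $ j * y $ k * y $ l * radial y powr (- (a + 2))"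
  have m: "?f \<in> borel_measurable borel" by measurable
  have "\<bar>?f y\<bar> \<le> 4 * radial y powr (- a)" for y
  proof -
    have "\<bar>?f y\<bar> = \<bar>y $ i * y $ j\<bar> * \<bar>y $ k * y $ l\<bar> * radial y powr (- (a + 2))"
      by (simp add: abs_mult)
    also have "\<dots> \<le> (2 * radial y) * (2 * radial y) * radial y powr (- (a + 2))"
      using radial_pos[of y] by (intro mult_right_mono mult_mono abs_coord_mult_le) auto
    also have "\<dots> = 4 * radial y powr (- a)"
    proof -
      have *: "(2 * r) * (2 * r) * (R / r / r) = 4 * R" if "r > 0" for r R :: real using that by simp
      show ?thesis unfolding powr_minus_add_2[OF radial_pos] by (rule *[OF radial_pos])
    qed
    finally show ?thesis .
  qed
  then have "integrable lborel ?f" by (rule integrable_if_radial_bound[OF m])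
  moreover have "(LINT y|lborel. ?f y) = 0"
    by (rule integral_flip_odd[OF m, of e]) (simp only: flip_inner odd, simp)
  ultimately show ?thesis by (simp add: has_bochner_integral_iff)
qed

text \<open>Pairings of the indices, as in Wick's formula for Gaussian moments. If the indices do
  not pair up, some index occurs an odd number of times, and reflecting that coordinate shows that
  the moment vanishes.\<close>

lemma radial_moment_4:
  fixes i j k l :: 'n
  shows "has_bochner_integral lborel (\<lambda>y::real^'n. y $ i * y $ j * y $ k * y $ l * radial y powr (- (a + 2)))
    ((of_bool (i = j \<and> k = l) + of_bool (i = k \<and> j = l) + of_bool (i = l \<and> j = k)) * radial_mass TYPE('n) a / (a * (a + 1)))"
proof -
  consider "i = j" "k = l" | "i = j" "k \<noteq> l" | "i \<noteq> j" "i = k" "j = l" | "i \<noteq> j" "i = k" "j \<noteq> l"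
    | "i \<noteq> j" "i \<noteq> k" "i = l" "j = k" | "i \<noteq> j" "i \<noteq> k" "i = l" "j \<noteq> k" | "i \<noteq> j" "i \<noteq> k" "i \<noteq> l" by blast
  then show ?thesis
  proof cases
    case 1
    then show ?thesis using radial_moment_4_even[of i k] by (auto simp: of_bool_def split: if_splits)
  next
    case 2
    then show ?thesis using radial_moment_4_odd[of k i j k l] by (auto simp: flip_def)
  next
    case 3
    then show ?thesis using radial_moment_4_even[of i j] by (simp add: mult_ac)
  next
    case 4
    then show ?thesis using radial_moment_4_odd[of j i j k l] by (auto simp: flip_def)
  next
    case 5
    then show ?thesis using radial_moment_4_even[of i j] by (simp add: mult_ac)
  next
    case 6
    then show ?thesis using radial_moment_4_odd[of j i j k l] by (auto simp: flip_def)
  next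
    case 7
    then show ?thesis using radial_moment_4_odd[of i i j k l] by (auto simp: flip_def)
  qed
qed

end

subsection \<open>The Fisher information\<close>

lemma has_bochner_integral_matrixI:
  fixes f :: "'b \<Rightarrow> real^'n^'m"
  assumes "\<And>i j. has_bochner_integral M (\<lambda>x. f x $ i $ j) (E $ i $ j)"
  shows "has_bochner_integral M f E"
proof -
  have rep: "X = (\<Sum>i\<in>UNIV. \<Sum>j\<in>UNIV. X $ i $ j *\<^sub>R axis i (axis j 1))" for X :: "real^'n^'m"
  proof -
    have "(\<Sum>i\<in>UNIV. \<Sum>j\<in>UNIV. X $ i $ j *\<^sub>R axis i (axis j 1)) $ k $ l = (\<Sum>i\<in>UNIV. \<Sum>j\<in>UNIV. if i = k \<and> j = l then X $ i $ j else 0)" for k l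
      by (auto simp: axis_def intro!: sum.cong)
    also have "\<dots> k l = (\<Sum>i\<in>UNIV. if i = k then X $ i $ l else 0)" for k l
      by (intro sum.cong refl) (auto simp: if_distrib cong: if_cong)
    finally show ?thesis by (simp add: vec_eq_iff)
  qed
  have "has_bochner_integral M (\<lambda>x. \<Sum>i\<in>UNIV. \<Sum>j\<in>UNIV. f x $ i $ j *\<^sub>R (axis i (axis j 1) :: real^'n^'m))
     (\<Sum>i\<in>UNIV. \<Sum>j\<in>UNIV. E $ i $ j *\<^sub>R axis i (axis j 1))"
    using assms by (intro has_bochner_integral_sum has_bochner_integral_scaleR_left) auto
  then show ?thesis using rep[of E] rep[of "f _"] by simp
qed


text \<open>As \<open>k\<close> does not depend on \<sigma>, total mass one at \<open>mat 1\<close>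
  alone determines it, and there the density is radial.\<close>

lemma mix_density_radial:
  fixes p :: real
  assumes p: "p > (real CARD('n) - 1) / 2"
  obtains k where "k > 0" "k * radial_mass TYPE('n::finite) (p + 1/2) = 1"
    "\<And>(\<sigma>::real^'n^'n) x. \<sigma> \<in> pos_def_matrices \<Longrightarrow>
       mix_density p \<sigma> x = k * sqrt (det \<sigma>) * (1 + (x \<bullet> (\<sigma> *v x)) / 2) powr (- (p + 1/2))"
proof -
  define k where "k = gram_const TYPE('n) (2 * p - real CARD('n) + 1) / gram_const TYPE('n) (2 * p - real CARD('n))
      / (2 * pi) powr (real CARD('n) / 2)"
  have "2 * p - real CARD('n) > -1" "2 * p - real CARD('n) + 1 > -1" using p by (simp_all add: field_simps)
  then have k: "k > 0" unfolding k_def using gram_const(2)[where 'n='n] by (intro divide_pos_pos) auto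
  have f: "mix_density p \<sigma> x = k * sqrt (det \<sigma>) * (1 + (x \<bullet> (\<sigma> *v x)) / 2) powr (- (p + 1/2))"
    if "\<sigma> \<in> pos_def_matrices" for \<sigma> :: "real^'n^'n" and x
    unfolding k_def by (rule mix_density_eq(1)[OF p that])
  have one: "mat 1 \<in> (pos_def_matrices :: (real^'n^'n) set)"
    by (simp add: pos_def_matrices_def sym_matrices_def)
  have a: "p + 1/2 > real CARD('n) / 2" using p by (simp add: field_simps)
  have hb: "has_bochner_integral lborel (\<lambda>y::real^'n. k * radial y powr (- (p + 1/2))) (k * radial_mass TYPE('n) (p + 1/2))"
    by (intro has_bochner_integral_mult_right radial_moment_0 a)
  have "1 = (\<integral>\<^sup>+x. ennreal (mix_density p (mat 1 :: real^'n^'n) x) \<partial>lborel)"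
    by (rule nn_integral_mix_density[OF p one, symmetric])
  also have "\<dots> = (\<integral>\<^sup>+y. ennreal (k * radial y powr (- (p + 1/2))) \<partial>(lborel :: (real^'n) measure))"
    by (simp add: f[OF one])
  also have "\<dots> = ennreal (k * radial_mass TYPE('n) (p + 1/2))"
    using hb k by (subst nn_integral_eq_integral) (auto simp: has_bochner_integral_iff)
  finally have "k * radial_mass TYPE('n) (p + 1/2) = 1" by (metis ennreal_eq_1)
  then show ?thesis using that k f by blast
qed

text \<open>The Fisher integral at the identity parameter in the direction \<open>w\<close>. In
  units of trace w / 4 on the diagonal, the constant term, the two mixed terms and the diagonal
  pairing of the fourth moment contribute 1 - 1 - 1 + a / (a + 1) = -1 / (a + 1); the multiple of
  \<open>w\<close> comes from the other two pairings.\<close>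

lemma fisher_integral_standard:
  fixes w :: "real^'n^'n"
  assumes a: "a > real CARD('n) / 2" and k: "k * radial_mass TYPE('n) a = 1" and w: "w \<in> sym_matrices"
  shows "has_bochner_integral lborel
    (\<lambda>y. (k * radial y powr (- a) * (trace w / 2 - a / (2 * radial y) * (y \<bullet> (w *v y)))) *\<^sub>R
       ((1/2) *\<^sub>R mat 1 - (a / (2 * radial y)) *\<^sub>R outer y))
    ((1 / (2 * (a + 1))) *\<^sub>R (a *\<^sub>R w - (trace w / 2) *\<^sub>R mat 1))"
proof (rule has_bochner_integral_matrixI)
  fix i j :: 'n
  have a0: "a > 0" by (rule radial_exponent_pos[OF a])
  let ?J = "radial_mass TYPE('n) a"
  let ?\<delta> = "of_bool (i = j) :: real"
  define m4 where "m4 c d = (of_bool (i = j \<and> c = d) + of_bool (i = c \<and> j = d) + of_bool (i = d \<and> j = c)) * ?J / (a * (a + 1))" for c d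
  have E: "((k * radial y powr (- a) * (trace w / 2 - a / (2 * radial y) * (y \<bullet> (w *v y)))) *\<^sub>R
       ((1/2) *\<^sub>R mat 1 - (a / (2 * radial y)) *\<^sub>R outer y)) $ i $ j =
     k * (trace w / 4 * ?\<delta> * radial y powr (- a)
      - a / 4 * trace w * (y $ i * y $ j * radial y powr (- (a + 1)))
      - a / 4 * ?\<delta> * (\<Sum>c\<in>UNIV. \<Sum>d\<in>UNIV. w $ c $ d * (y $ c * y $ d * radial y powr (- (a + 1))))
      + a\<^sup>2 / 4 * (\<Sum>c\<in>UNIV. \<Sum>d\<in>UNIV. w $ c $ d * (y $ i * y $ j * y $ c * y $ d * radial y powr (- (a + 2)))))" for y
  proof -
    define Q where "Q = y \<bullet> (w *v y)"
    have Q: "Q = (\<Sum>c\<in>UNIV. \<Sum>d\<in>UNIV. w $ c $ d * (y $ c * y $ d))"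
      by (simp add: Q_def inner_vec_def matrix_vector_mult_def sum_distrib_left mult_ac)
    have r1: "radial y powr (- (a + 1)) = radial y powr (- a) / radial y"
      by (rule powr_minus_add_1[OF radial_pos])
    have r2: "radial y powr (- (a + 2)) = radial y powr (- a) / radial y / radial y"
      by (rule powr_minus_add_2[OF radial_pos])
    have S1: "(\<Sum>c\<in>UNIV. \<Sum>d\<in>UNIV. w $ c $ d * (y $ c * y $ d * z)) = Q * z" for z
      by (simp add: Q sum_distrib_right mult.assoc)
    have S2: "(\<Sum>c\<in>UNIV. \<Sum>d\<in>UNIV. w $ c $ d * (y $ i * y $ j * y $ c * y $ d * z)) = y $ i * y $ j * Q * z" for z
      by (simp add: Q sum_distrib_right sum_distrib_left mult_ac)
    have alg: "k * R * (T / 2 - a / (2 * r) * Q) * (1 / 2 * \<delta> - a / (2 * r) * z) =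
      k * (T / 4 * \<delta> * R - a / 4 * T * (z * (R / r)) - a / 4 * \<delta> * (Q * (R / r)) + a\<^sup>2 / 4 * (z * Q * (R / r / r)))"
      if "r > 0" for R T r Q \<delta> z :: real
      using that by (simp add: field_simps power2_eq_square)
    have "((k * radial y powr (- a) * (trace w / 2 - a / (2 * radial y) * Q)) *\<^sub>R
       ((1/2) *\<^sub>R mat 1 - (a / (2 * radial y)) *\<^sub>R outer y)) $ i $ j
       = k * radial y powr (- a) * (trace w / 2 - a / (2 * radial y) * Q) * (1 / 2 * ?\<delta> - a / (2 * radial y) * (y $ i * y $ j))"
      by (simp add: mat_def outer_def of_bool_def)
    also have "\<dots> = k * (trace w / 4 * ?\<delta> * radial y powr (- a) - a / 4 * trace w * (y $ i * y $ j * (radial y powr (- a) / radial y))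
       - a / 4 * ?\<delta> * (Q * (radial y powr (- a) / radial y)) + a\<^sup>2 / 4 * (y $ i * y $ j * Q * (radial y powr (- a) / radial y / radial y)))"
      by (rule alg[OF radial_pos])
    finally show ?thesis unfolding S1 S2 r1 r2 Q_def .
  qed
  have hb: "has_bochner_integral lborel (\<lambda>y::real^'n. k * (trace w / 4 * ?\<delta> * radial y powr (- a)
      - a / 4 * trace w * (y $ i * y $ j * radial y powr (- (a + 1)))
      - a / 4 * ?\<delta> * (\<Sum>c\<in>UNIV. \<Sum>d\<in>UNIV. w $ c $ d * (y $ c * y $ d * radial y powr (- (a + 1))))
      + a\<^sup>2 / 4 * (\<Sum>c\<in>UNIV. \<Sum>d\<in>UNIV. w $ c $ d * (y $ i * y $ j * y $ c * y $ d * radial y powr (- (a + 2))))))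
    (k * (trace w / 4 * ?\<delta> * ?J - a / 4 * trace w * (?\<delta> * ?J / a)
      - a / 4 * ?\<delta> * (\<Sum>c\<in>UNIV. \<Sum>d\<in>UNIV. w $ c $ d * (of_bool (c = d) * ?J / a))
      + a\<^sup>2 / 4 * (\<Sum>c\<in>UNIV. \<Sum>d\<in>UNIV. w $ c $ d * m4 c d)))"
    unfolding m4_def
    by (intro has_bochner_integral_mult_right has_bochner_integral_add has_bochner_integral_diff
       has_bochner_integral_sum radial_moment_0[OF a] radial_moment_2[OF a] radial_moment_4[OF a])
  have s2: "(\<Sum>c\<in>UNIV. \<Sum>d\<in>UNIV. w $ c $ d * (of_bool (c = d) * ?J / a)) = trace w * (?J / a)"
  proof -
    have "(\<Sum>d\<in>UNIV. w $ c $ d * (of_bool (c = d) * ?J / a)) = w $ c $ c * (?J / a)" for c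
      by (subst sum.remove[of _ c]) auto
    then show ?thesis by (simp add: trace_def sum_distrib_right sum_divide_distrib)
  qed
  have s4: "(\<Sum>c\<in>UNIV. \<Sum>d\<in>UNIV. w $ c $ d * m4 c d) = (?\<delta> * trace w + 2 * w $ i $ j) * (?J / (a * (a + 1)))"
  proof -
    let ?z = "?J / (a * (a + 1))"
    have delta: "(\<Sum>c\<in>UNIV. \<Sum>d\<in>UNIV. w $ c $ d * of_bool (s = c \<and> t = d)) = w $ s $ t" for s t
    proof -
      have "(\<Sum>d\<in>UNIV. w $ c $ d * of_bool (s = c \<and> t = d)) = (if c = s then w $ s $ t else 0)" for c
        by (subst sum.remove[of _ t]) auto
      then show ?thesis by simp
    qed
    have diag: "(\<Sum>c\<in>UNIV. \<Sum>d\<in>UNIV. w $ c $ d * of_bool (i = j \<and> c = d)) = ?\<delta> * trace w"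
    proof -
      have "(\<Sum>d\<in>UNIV. w $ c $ d * of_bool (i = j \<and> c = d)) = ?\<delta> * w $ c $ c" for c
        by (subst sum.remove[of _ c]) auto
      then show ?thesis by (simp add: trace_def sum_distrib_left)
    qed
    have anti: "(\<Sum>c\<in>UNIV. \<Sum>d\<in>UNIV. w $ c $ d * of_bool (i = d \<and> j = c)) = w $ j $ i"
      using delta[of j i] by (simp add: conj_commute)
    have "(\<Sum>c\<in>UNIV. \<Sum>d\<in>UNIV. w $ c $ d * m4 c d) =
      ((\<Sum>c\<in>UNIV. \<Sum>d\<in>UNIV. w $ c $ d * of_bool (i = j \<and> c = d)) + (\<Sum>c\<in>UNIV. \<Sum>d\<in>UNIV. w $ c $ d * of_bool (i = c \<and> j = d))
       + (\<Sum>c\<in>UNIV. \<Sum>d\<in>UNIV. w $ c $ d * of_bool (i = d \<and> j = c))) * ?z"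
      unfolding m4_def sum.distrib[symmetric] sum_distrib_right
      by (intro sum.cong refl) (simp add: algebra_simps add_divide_distrib)
    \<comment> \<open>Two of the three pairings give w_ij and w_ji, which agree because
      \<open>w\<close> is symmetric.\<close>
    then show ?thesis unfolding delta diag anti using sym_matrices_component[OF w, of j i] by simp
  qed
  have "k * (trace w / 4 * ?\<delta> * ?J - a / 4 * trace w * (?\<delta> * ?J / a) - a / 4 * ?\<delta> * (trace w * (?J / a))
      + a\<^sup>2 / 4 * ((?\<delta> * trace w + 2 * w $ i $ j) * (?J / (a * (a + 1)))))
     = (k * ?J) * ((1 / (2 * (a + 1))) * (a * w $ i $ j - trace w / 2 * ?\<delta>))"
  proof -
    have "k * (T / 4 * \<delta> * J - a / 4 * T * (\<delta> * J / a) - a / 4 * \<delta> * (T * (J / a))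
        + a\<^sup>2 / 4 * ((\<delta> * T + 2 * x) * (J / (a * (a + 1)))))
      = (k * J) * ((1 / (2 * (a + 1))) * (a * x - T / 2 * \<delta>))" for T \<delta> J x :: real
    proof -
      have "a / 4 * T * (\<delta> * J / a) = T * \<delta> * J / 4" "a / 4 * \<delta> * (T * (J / a)) = T * \<delta> * J / 4"
        "a\<^sup>2 / 4 * ((\<delta> * T + 2 * x) * (J / (a * (a + 1)))) = a / 4 * (\<delta> * T + 2 * x) * J / (a + 1)"
        using a0 by (simp_all add: power2_eq_square)
      moreover have "a + 1 \<noteq> 0" using a0 by simp
      ultimately show ?thesis by (simp only:) (simp add: field_simps)
    qed
    then show ?thesis .
  qed
  also have "\<dots> = ((1 / (2 * (a + 1))) *\<^sub>R (a *\<^sub>R w - (trace w / 2) *\<^sub>R mat 1)) $ i $ j"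
    unfolding k by (simp add: mat_def of_bool_def)
  finally show "has_bochner_integral lborel
    (\<lambda>y. ((k * radial y powr (- a) * (trace w / 2 - a / (2 * radial y) * (y \<bullet> (w *v y)))) *\<^sub>R
       ((1/2) *\<^sub>R mat 1 - (a / (2 * radial y)) *\<^sub>R outer y)) $ i $ j)
    (((1 / (2 * (a + 1))) *\<^sub>R (a *\<^sub>R w - (trace w / 2) *\<^sub>R mat 1)) $ i $ j)"
    using hb unfolding E s2 s4 by simp
qed


theorem proposition3p1:
  fixes p :: real and \<sigma> :: "real^'n^'n"
  assumes "p > (real CARD('n) - 1) / 2"
    and "\<sigma> \<in> pos_def_matrices"
  shows "\<forall>v\<in>sym_matrices.
    fisher_information p \<sigma> v =
      (1 / (2 * (2 * p + 3))) *\<^sub>R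
        ((2 * p + 1) *\<^sub>R quad_rep (matrix_inv \<sigma>) v - tensor_square (matrix_inv \<sigma>) v)"
proof
  fix v :: "real^'n^'n" assume v: "v \<in> sym_matrices"
  note p = assms(1) and \<sigma> = assms(2)
  define a where "a = p + 1/2"
  have a: "a > real CARD('n) / 2" using p by (simp add: a_def field_simps)
  have a0: "a > 0" by (rule radial_exponent_pos[OF a])
  obtain k where k: "k > 0" "k * radial_mass TYPE('n) a = 1"
    and f: "\<And>(\<tau>::real^'n^'n) x. \<tau> \<in> pos_def_matrices \<Longrightarrow>
       mix_density p \<tau> x = k * sqrt (det \<tau>) * (1 + (x \<bullet> (\<tau> *v x)) / 2) powr (- a)"
    using mix_density_radial[OF p] unfolding a_def by blast
  define g where "g x = (1/2) *\<^sub>R matrix_inv \<sigma> - (a / (2 * (1 + (x \<bullet> (\<sigma> *v x)) / 2))) *\<^sub>R outer x" for x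
  have grad: "sym_gradient (log_lik p x) \<sigma> = g x" for x
    unfolding g_def by (rule sym_gradient_log_lik[OF \<sigma> k(1) f])
  obtain A :: "real^'n^'n" where A: "transpose A ** \<sigma> ** A = mat 1" using pos_def_diagonalize[OF \<sigma>] .
  note dA = diagonalize_det[OF A] and inv = diagonalize_inverse(1)[OF A]
  \<comment> \<open>\<open>w\<close> is the direction \<open>v\<close> seen from the identity
    parameter: in the trace, conjugation by \<open>A\<close> moves from the gradient onto
    \<open>v\<close>.\<close>
  define w where "w = transpose A ** v ** A"
  have w: "w \<in> sym_matrices"
    using v by (simp add: w_def sym_matrices_def matrix_transpose_mul matrix_mul_assoc)
  let ?R = "\<lambda>y. (k * radial y powr (- a) * (trace w / 2 - a / (2 * radial y) * (y \<bullet> (w *v y)))) *\<^sub>R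
       ((1/2) *\<^sub>R mat 1 - (a / (2 * radial y)) *\<^sub>R outer y)"
  \<comment> \<open>Conjugation by \<open>A\<close> is linear and bounded, so it may be pulled out
    of the integral.\<close>
  have conj_lin: "bounded_linear (\<lambda>X. A ** X ** transpose A)"
    by (auto intro!: linear_conv_bounded_linear[THEN iffD1] linearI
        simp: matrix_add_ldistrib matrix_add_rdistrib matrix_scaleR_left matrix_scaleR_right)
  have pull: "\<bar>det A\<bar> *\<^sub>R (mix_density p \<sigma> (A *v y) *\<^sub>R tensor_square (g (A *v y)) v) = A ** ?R y ** transpose A" for y
  proof -
    let ?h = "(1/2) *\<^sub>R mat 1 - (a / (2 * radial y)) *\<^sub>R outer y :: real^'n^'n"
    have quad: "(A *v y) \<bullet> (\<sigma> *v (A *v y)) = y \<bullet> y"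
    proof -
      have "(A *v y) \<bullet> (\<sigma> *v (A *v y)) = y \<bullet> ((transpose A ** \<sigma> ** A) *v y)"
        by (metis inner_matrix_vector_transpose matrix_vector_mul_assoc transpose_transpose)
      then show ?thesis by (simp add: A)
    qed
    have gA: "g (A *v y) = A ** ?h ** transpose A"
      unfolding g_def quad inv outer_conj[symmetric]
      by (simp add: matrix_diff_ldistrib matrix_diff_rdistrib matrix_scaleR_left matrix_scaleR_right)
    have "trace (g (A *v y) ** v) = trace (?h ** w)"
      unfolding gA w_def by (rule trace_conj_mult)
    also have "\<dots> = trace w / 2 - a / (2 * radial y) * (y \<bullet> (w *v y))"
      using trace_mult_outer[of w y] trace_mul_sym[of "outer y" w]
      by (simp add: matrix_diff_rdistrib matrix_scaleR_left trace_sub trace_scaleR)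
    finally have tr: "trace (g (A *v y) ** v) = trace w / 2 - a / (2 * radial y) * (y \<bullet> (w *v y))" .
    \<comment> \<open>The Jacobian cancels sqrt (det \<sigma>), which removes the last dependence on
      \<sigma> from the density.\<close>
    have "\<bar>det A\<bar> * sqrt (det \<sigma>) = sqrt (det A ^ 2 * det \<sigma>)" by (simp add: real_sqrt_mult)
    then have "\<bar>det A\<bar> * sqrt (det \<sigma>) = 1" using dA(1) by simp
    then have md: "\<bar>det A\<bar> * mix_density p \<sigma> (A *v y) = k * radial y powr (- a)"
      unfolding f[OF \<sigma>] quad by (simp add: mult.assoc[symmetric])
    have "\<bar>det A\<bar> *\<^sub>R (mix_density p \<sigma> (A *v y) *\<^sub>R tensor_square (g (A *v y)) v)
       = (k * radial y powr (- a) * (trace w / 2 - a / (2 * radial y) * (y \<bullet> (w *v y)))) *\<^sub>R (A ** ?h ** transpose A)"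
      unfolding tensor_square_def tr scaleR_scaleR mult.assoc[symmetric] md unfolding gA ..
    then show ?thesis by (simp only: matrix_scaleR_left matrix_scaleR_right)
  qed
  have "(\<lambda>x. mix_density p \<sigma> x *\<^sub>R tensor_square (g x) v) \<in> borel_measurable borel"
  proof -
    have r: "1 + (x \<bullet> (\<sigma> *v x)) / 2 > 0" for x
      using \<sigma> by (cases "x = 0") (auto simp: pos_def_matrices_def intro!: add_pos_pos)
    then have r0: "1 + (x \<bullet> (\<sigma> *v x)) / 2 \<noteq> 0" for x by (metis less_irrefl)
    then have r02: "2 + x \<bullet> (\<sigma> *v x) \<noteq> 0" for x using r[of x] by simp
    have q: "continuous_on UNIV (\<lambda>x. 1 + (x \<bullet> (\<sigma> *v x)) / 2)"
      unfolding matrix_vector_mult_def by (auto intro!: continuous_intros)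
    have "continuous_on UNIV (\<lambda>x. mix_density p \<sigma> x)"
      unfolding f[OF \<sigma>] using r0 by (intro continuous_intros q) simp
    moreover have "continuous_on UNIV g"
      unfolding g_def outer_def using r02 by (intro continuous_intros q ballI) simp_all
    moreover from this have "continuous_on UNIV (\<lambda>x. trace (g x ** v))"
      unfolding trace_def matrix_matrix_mult_def by (auto intro!: continuous_intros)
    ultimately show ?thesis
      unfolding tensor_square_def by (intro borel_measurable_continuous_onI continuous_intros)
  qed
  then have "fisher_information p \<sigma> v = (LINT y|lborel. A ** ?R y ** transpose A)"
    unfolding fisher_information_def grad
    by (subst integral_lborel_matrix_vector_mult[OF dA(2)]) (simp_all only: pull)
  also have "\<dots> = A ** ((1 / (2 * (a + 1))) *\<^sub>R (a *\<^sub>R w - (trace w / 2) *\<^sub>R mat 1)) ** transpose A"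
    by (rule has_bochner_integral_integral_eq[OF has_bochner_integral_bounded_linear[OF conj_lin fisher_integral_standard[OF a k(2) w]]])
  also have "\<dots> = (1 / (2 * (a + 1))) *\<^sub>R (a *\<^sub>R (A ** w ** transpose A) - (trace w / 2) *\<^sub>R (A ** transpose A))"
    by (simp add: matrix_diff_ldistrib matrix_diff_rdistrib matrix_scaleR_left matrix_scaleR_right)
  also have "A ** w ** transpose A = quad_rep (matrix_inv \<sigma>) v"
    by (simp add: w_def quad_rep_def inv matrix_mul_assoc)
  also have "trace w = trace (matrix_inv \<sigma> ** v)"
    unfolding w_def inv using trace_conj_mult[of A "mat 1" v] by simp
  also have "(1 / (2 * (a + 1))) *\<^sub>R (a *\<^sub>R quad_rep (matrix_inv \<sigma>) v - (trace (matrix_inv \<sigma> ** v) / 2) *\<^sub>R (A ** transpose A))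
     = (1 / (2 * (2 * p + 3))) *\<^sub>R ((2 * p + 1) *\<^sub>R quad_rep (matrix_inv \<sigma>) v - tensor_square (matrix_inv \<sigma>) v)"
  proof -
    \<comment> \<open>With a = p + 1/2 one has 2 (a + 1) = 2p + 3 and 2a = 2p + 1; the factor 2
      split off from the scalar doubles the bracket and clears its fractions.\<close>
    have "(1 / (2 * (a + 1))) *\<^sub>R (a *\<^sub>R X - (t / 2) *\<^sub>R Y) = (1 / (2 * (2 * p + 3))) *\<^sub>R ((2 * p + 1) *\<^sub>R X - t *\<^sub>R Y)"
      for X Y :: "real^'n^'n" and t
    proof -
      have c: "1 / (2 * (a + 1)) = 1 / (2 * (2 * p + 3)) * 2" using a0 by (simp add: a_def field_simps)
      have d: "2 *\<^sub>R (a *\<^sub>R X - (t / 2) *\<^sub>R Y) = (2 * p + 1) *\<^sub>R X - t *\<^sub>R Y"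
        by (simp add: a_def scaleR_diff_right distrib_left mult.commute)
      show ?thesis unfolding c scaleR_scaleR[symmetric] d ..
    qed
    then show ?thesis unfolding tensor_square_def inv .
  qed
  finally show "fisher_information p \<sigma> v = (1 / (2 * (2 * p + 3))) *\<^sub>R
        ((2 * p + 1) *\<^sub>R quad_rep (matrix_inv \<sigma>) v - tensor_square (matrix_inv \<sigma>) v)" .
qed

end
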